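(* Let $n\ge 2$ and let $P_n(\mathbb K)$ be the pure braid group of the Klein bottle $\mathbb K$ on $n$ strings. There exists a normal subgroup $H\le \mathrm{Aut}(P_n(\mathbb K))$ of finite index $|\mathrm{Aut}(P_n(\mathbb K)):H|\le\left(2\binom n2\right)!$ such that the Reidemeister number $R(\varphi)$ is infinite for every $\varphi\in H$.
   Context: $P_n(\mathbb K)=\pi_1(F_n(\mathbb K))$, where $F_n(\mathbb K)=\{(x_1,\dots,x_n)\in\mathbb K^n : x_i\neq x_j\text{ for }i\ne j\}$. For a group $G$ and $\varphi\in\mathrm{Aut}(G)$, twisted conjugacy is the equivalence relation on $G$ given by $x\sim_\varphi y$ iff there is $z\in G$ with $zx\varphi(z)^{-1}=y$; the Reidemeister number $R(\varphi)$ is the number of its equivalence classes. *)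

theory Defs
  imports "HOL-Analysis.Analysis" "HOL-Algebra.Bij" "HOL-Algebra.Coset" "HOL-Library.Extended_Nat"
begin

section \<open>The Klein bottle\<close>

definition quotient_topology :: "'a topology \<Rightarrow> ('a \<times> 'a) set \<Rightarrow> 'a set topology" where
  "quotient_topology X r = topology (\<lambda>U. U \<subseteq> topspace X // r \<and> openin X (\<Union>U))"

text \<open>
  The Klein bottle is the orbit space of the plane under the group generated by
  the isometries \<open>(x, y) \<mapsto> (x + 1, y)\<close> and \<open>(x, y) \<mapsto> (- x, y + 1)\<close>. Every element of
  this group has the form \<open>(x, y) \<mapsto> ((-1)^k x + m, y + k)\<close> with integers \<open>m\<close> and \<open>k\<close>.
\<close>

definition klein_rel :: "((real \<times> real) \<times> (real \<times> real)) set" where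
  "klein_rel = {((x, y), (x', y')). \<exists>m k :: int.
     x' = (if even k then x else - x) + of_int m \<and> y' = y + of_int k}"

definition klein_bottle :: "(real \<times> real) set topology" where
  "klein_bottle = quotient_topology euclidean klein_rel"

lemma Union_Int_quotient:
  assumes "equiv A r" "U \<subseteq> A // r" "V \<subseteq> A // r"
  shows "\<Union>(U \<inter> V) = \<Union>U \<inter> \<Union>V"
  using quotient_disj[OF assms(1)] assms(2,3) by blast

lemma openin_quotient_topology:
  assumes "equiv (topspace X) r"
  shows "openin (quotient_topology X r) U \<longleftrightarrow> U \<subseteq> topspace X // r \<and> openin X (\<Union>U)"
proof -
  have "istopology (\<lambda>U. U \<subseteq> topspace X // r \<and> openin X (\<Union>U))"
    unfolding istopology_def
  proof (intro conjI allI impI)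
    fix S T
    assume S: "S \<subseteq> topspace X // r \<and> openin X (\<Union>S)"
      and T: "T \<subseteq> topspace X // r \<and> openin X (\<Union>T)"
    show "S \<inter> T \<subseteq> topspace X // r" using S by blast
    show "openin X (\<Union>(S \<inter> T))"
      using S T Union_Int_quotient[OF assms, of S T] by (simp add: openin_Int)
  next
    fix \<K>
    assume K: "\<forall>K\<in>\<K>. K \<subseteq> topspace X // r \<and> openin X (\<Union>K)"
    show "\<Union>\<K> \<subseteq> topspace X // r" using K by blast
    have "\<Union>(\<Union>\<K>) = \<Union>(Union ` \<K>)" by blast
    then show "openin X (\<Union>(\<Union>\<K>))" using K by auto
  qed
  then show ?thesis by (simp add: quotient_topology_def topology_inverse')
qed

lemma topspace_quotient_topology:
  assumes "equiv (topspace X) r"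
  shows "topspace (quotient_topology X r) = topspace X // r"
proof -
  have "openin (quotient_topology X r) (topspace X // r)"
    using assms by (simp add: openin_quotient_topology Union_quotient)
  then show ?thesis
    using openin_quotient_topology[OF assms] openin_subset openin_topspace by blast
qed

lemma quotient_map_quotient_topology:
  assumes "equiv (topspace X) r"
  shows "quotient_map X (quotient_topology X r) (\<lambda>x. r `` {x})"
proof -
  have "{x \<in> topspace X. r `` {x} \<in> U} = \<Union>U" if "U \<subseteq> topspace X // r" for U
  proof (intro Set.set_eqI iffI)
    fix x assume "x \<in> {x \<in> topspace X. r `` {x} \<in> U}"
    then show "x \<in> \<Union>U" using equiv_class_self[OF assms] by blast
  next
    fix x assume "x \<in> \<Union>U"
    then obtain C where C: "C \<in> U" "x \<in> C" by blast
    then have "C \<in> topspace X // r" using that by blast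
    then obtain y where "y \<in> topspace X" "C = r `` {y}" by (rule quotientE)
    then have "C = r `` {x}" "x \<in> topspace X"
      using C assms by (auto simp: equiv_class_eq_iff)
    then show "x \<in> {x \<in> topspace X. r `` {x} \<in> U}" using C by blast
  qed
  then show ?thesis
    using assms unfolding quotient_map_def
    by (auto simp: openin_quotient_topology topspace_quotient_topology quotient_def)
qed

lemma equiv_klein_rel: "equiv UNIV klein_rel"
proof (rule equivI)
  show "klein_rel \<subseteq> UNIV \<times> UNIV" by simp
  show "refl klein_rel"
  proof (rule refl_onI)
    fix p :: "real \<times> real"
    show "(p, p) \<in> klein_rel"
      by (cases p) (auto simp: klein_rel_def intro!: exI[of _ "0::int"])
  qed
  show "sym klein_rel"
  proof (rule symI)
    fix p q assume "(p, q) \<in> klein_rel"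
    then obtain x y x' y' and m k :: int where pq: "p = (x, y)" "q = (x', y')"
      and e: "x' = (if even k then x else - x) + of_int m" "y' = y + of_int k"
      by (auto simp: klein_rel_def)
    have "x = (if even (- k) then x' else - x') + of_int (if even k then - m else m)"
         "y = y' + of_int (- k)"
      using e by auto
    then show "(q, p) \<in> klein_rel" unfolding klein_rel_def pq by blast
  qed
  show "trans klein_rel"
  proof (rule transI)
    fix p q s assume "(p, q) \<in> klein_rel" "(q, s) \<in> klein_rel"
    then obtain x y x' y' x'' y'' and m k m' k' :: int
      where pqs: "p = (x, y)" "q = (x', y')" "s = (x'', y'')"
      and e: "x' = (if even k then x else - x) + of_int m" "y' = y + of_int k"
        "x'' = (if even k' then x' else - x') + of_int m'" "y'' = y' + of_int k'"
      by (fastforce simp: klein_rel_def)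
    have "x'' = (if even (k + k') then x else - x) + of_int ((if even k' then m else - m) + m')"
         "y'' = y + of_int (k + k')"
      using e by auto
    then show "(p, s) \<in> klein_rel" unfolding klein_rel_def pqs by blast
  qed
qed

lemma quotient_map_klein_bottle: "quotient_map euclidean klein_bottle (\<lambda>p. klein_rel `` {p})"
  unfolding klein_bottle_def
  by (rule quotient_map_quotient_topology) (simp add: equiv_klein_rel)


section \<open>Ordered configuration spaces and fundamental groups\<close>

definition config_space :: "nat \<Rightarrow> 'a topology \<Rightarrow> (nat \<Rightarrow> 'a) topology" where
  "config_space n X =
     subtopology (product_topology (\<lambda>_. X) {1..n}) {f. inj_on f {1..n}}"

definition loops :: "'a topology \<Rightarrow> 'a \<Rightarrow> (real \<Rightarrow> 'a) set" where
  "loops X x = {p. pathin X p \<and> p 0 = x \<and> p 1 = x}"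

text \<open>
  Only the values of a loop on the unit interval matter: loops that agree there
  are related.
\<close>

definition loop_homotopy :: "'a topology \<Rightarrow> 'a \<Rightarrow> ((real \<Rightarrow> 'a) \<times> (real \<Rightarrow> 'a)) set" where
  "loop_homotopy X x = {(p, q). p \<in> loops X x \<and> q \<in> loops X x \<and>
     homotopic_with (\<lambda>h. h 0 = x \<and> h 1 = x) (top_of_set {0..1}) X p q}"

text \<open>This is \<open>joinpaths\<close> without its restriction to types of class \<open>topological_space\<close>.\<close>

definition concat_loops :: "(real \<Rightarrow> 'a) \<Rightarrow> (real \<Rightarrow> 'a) \<Rightarrow> real \<Rightarrow> 'a" where
  "concat_loops p q = (\<lambda>t. if t \<le> 1/2 then p (2 * t) else q (2 * t - 1))"

definition fundamental_group :: "'a topology \<Rightarrow> 'a \<Rightarrow> (real \<Rightarrow> 'a) set monoid" where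
  "fundamental_group X x =
     \<lparr>carrier = loops X x // loop_homotopy X x,
      mult = (\<lambda>A B. \<Union>p\<in>A. \<Union>q\<in>B. loop_homotopy X x `` {concat_loops p q}),
      one = loop_homotopy X x `` {\<lambda>_. x}\<rparr>"

definition klein_pure_braid_group ::
    "nat \<Rightarrow> (nat \<Rightarrow> (real \<times> real) set) \<Rightarrow> (real \<Rightarrow> nat \<Rightarrow> (real \<times> real) set) set monoid" where
  "klein_pure_braid_group n x = fundamental_group (config_space n klein_bottle) x"


section \<open>Twisted conjugacy\<close>

definition twisted_conj :: "('a, 'b) monoid_scheme \<Rightarrow> ('a \<Rightarrow> 'a) \<Rightarrow> ('a \<times> 'a) set" where
  "twisted_conj G \<phi> = {(x, y). x \<in> carrier G \<and> y \<in> carrier G \<and>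
     (\<exists>z\<in>carrier G. z \<otimes>\<^bsub>G\<^esub> x \<otimes>\<^bsub>G\<^esub> inv\<^bsub>G\<^esub> (\<phi> z) = y)}"

definition reidemeister_number :: "('a, 'b) monoid_scheme \<Rightarrow> ('a \<Rightarrow> 'a) \<Rightarrow> enat" where
  "reidemeister_number G \<phi> =
     (let C = carrier G // twisted_conj G \<phi> in if finite C then enat (card C) else \<infinity>)"

end

theory Submission
  imports Defs "HOL-Complex_Analysis.Winding_Numbers" "Jordan_Normal_Form.Determinant"
begin

text \<open>
  Let \<open>w\<^sub>i\<close> be the homomorphism that assigns to a pure braid the winding number of its \<open>i\<close>-th string
  in the vertical direction of the Klein bottle. Three facts are used.

  \<^item> The flow along the vertical circles gives a central braid with \<open>w\<^sub>i = 2\<close> for all \<open>i\<close>.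
  \<^item> All \<open>w\<^sub>i\<close> agree on a central braid, because it commutes with the braids in which one string
    moves around another one: lift both strings to the plane and compare the winding numbers of their
    difference.
  \<^item> Every homomorphism to the reals is a linear combination of the \<open>w\<^sub>i\<close>, because on a nonorientable
    surface the braid in which one string encircles another one is conjugate to its inverse.

  By the third fact an automorphism \<open>\<phi>\<close> acts on the \<open>w\<^sub>i\<close> by an integer matrix, and by the second one
  it multiplies their common restriction to the centre by a scalar, which is \<open>1\<close> or \<open>- 1\<close> since \<open>\<phi>\<close> is
  invertible. On the kernel of this sign character, a normal subgroup of index at most two, all row sums
  of the matrix are \<open>1\<close>. Hence the matrix also has a nonzero fixed row vector, that is, a nonzero
  homomorphism \<open>f\<close> to the reals with \<open>f \<circ> \<phi> = f\<close>. It is constant on twisted conjugacy classes and takes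
  infinitely many values.
\<close>

section \<open>The fundamental groupoid of an abstract topological space\<close>

text \<open>Most of the length goes into the third fact, which is obtained without a presentation of
  the group. A homomorphism \<open>h\<close> is turned into an additive, homotopy invariant
  functional on paths, like the integral of a closed 1-form, and pulled back to the covering
  \<open>Y\<close> of the configuration space: \<open>n\<close> points of the plane with pairwise
  different orbits. A primitive on \<open>Y\<close> shows that \<open>h\<close> depends only on the
  end of the lifted braid, that is, on its image in the \<open>n\<close>-th power of the Klein
  bottle group, whose abelianisation has rank \<open>n\<close>. The obstacle is that
  \<open>Y\<close> is the complement of infinitely many subspaces of codimension two, one for each
  pair of strings and each deck transformation. If a single string moves, only countably many points
  are missing from the plane, and the integral around each of them vanishes. Moves of two different
  strings commute, and this suffices to define the primitive on a dense set of configurations and to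
  extend it from there.\<close>

definition path_homotopic :: "'a topology \<Rightarrow> (real \<Rightarrow> 'a) \<Rightarrow> (real \<Rightarrow> 'a) \<Rightarrow> bool" where
  "path_homotopic X p q \<longleftrightarrow>
     homotopic_with (\<lambda>h. h 0 = p 0 \<and> h 1 = p 1) (top_of_set {0..1}) X p q"

lemma path_homotopic:
  "path_homotopic X p q \<longleftrightarrow>
     (\<exists>h. continuous_map (top_of_set ({0..1} \<times> {0..1})) X h \<and>
        (\<forall>s\<in>{0..1}. h (0, s) = p s \<and> h (1, s) = q s \<and> h (s, 0) = p 0 \<and> h (s, 1) = p 1))"
proof -
  have "homotopic_with (\<lambda>h. h 0 = p 0 \<and> h 1 = p 1) (top_of_set {0..1}) X p q \<longleftrightarrow>
    (\<exists>h. continuous_map (prod_topology (subtopology euclideanreal {0..1}) (top_of_set {0..1::real})) X h \<and>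
      (\<forall>x \<in> topspace (top_of_set {0..1}). h(0,x) = p x) \<and>
      (\<forall>x \<in> topspace (top_of_set {0..1}). h(1,x) = q x) \<and>
      (\<forall>t \<in> {0..1}. h(t,0) = p 0 \<and> h(t,1) = p 1))"
    by (rule homotopic_with) auto
  then show ?thesis
    unfolding path_homotopic_def by (auto simp: prod_topology_subtopology_eu)
qed

lemma path_homotopic_endpoints: "path_homotopic X p q \<Longrightarrow> q 0 = p 0 \<and> q 1 = p 1"
  by (auto simp: path_homotopic_def dest: homotopic_with_imp_property)

lemma path_homotopic_imp_pathin: "path_homotopic X p q \<Longrightarrow> pathin X p \<and> pathin X q"
  by (auto simp: path_homotopic_def pathin_def dest: homotopic_with_imp_continuous_maps)

lemma path_homotopic_refl: "pathin X p \<Longrightarrow> path_homotopic X p p"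
  by (auto simp: path_homotopic_def pathin_def)

lemma path_homotopic_sym: "path_homotopic X p q \<Longrightarrow> path_homotopic X q p"
  using path_homotopic_endpoints by (fastforce simp: path_homotopic_def homotopic_with_sym)

lemma path_homotopic_trans [trans]:
  assumes "path_homotopic X p q" "path_homotopic X q r"
  shows "path_homotopic X p r"
proof -
  have "homotopic_with (\<lambda>h. h 0 = p 0 \<and> h 1 = p 1) (top_of_set {0..1}) X q r"
    using assms path_homotopic_endpoints[OF assms(1)] by (simp add: path_homotopic_def)
  then show ?thesis using assms(1) unfolding path_homotopic_def by (blast intro: homotopic_with_trans)
qed

text \<open>All homotopies of the groupoid laws are of this form: two ways to run through the same map
  on a convex set.\<close>

lemma path_homotopic_convex:
  fixes C :: "'b :: real_normed_vector set"
  assumes C: "convex C" and F: "continuous_map (top_of_set C) X F"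
    and a: "continuous_on {0..1} a" "a \<in> {0..1} \<rightarrow> C" and b: "continuous_on {0..1} b" "b \<in> {0..1} \<rightarrow> C"
    and ab: "a 0 = b 0" "a 1 = b 1"
    and p: "\<And>t. t \<in> {0..1} \<Longrightarrow> p t = F (a t)" and q: "\<And>t. t \<in> {0..1} \<Longrightarrow> q t = F (b t)"
  shows "path_homotopic X p q"
proof -
  define k where "k = (\<lambda>(s, t). (1 - s) *\<^sub>R a t + s *\<^sub>R b t)"
  have "continuous_on ({0..1} \<times> {0..1}) k"
    unfolding k_def case_prod_beta
    by (intro continuous_intros continuous_on_compose2[OF a(1)] continuous_on_compose2[OF b(1)]) auto
  moreover have "k \<in> {0..1} \<times> {0..1} \<rightarrow> C"
    using a(2) b(2) C by (auto simp: k_def convex_alt Pi_iff)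
  ultimately have "continuous_map (top_of_set ({0..1} \<times> {0..1})) (top_of_set C) k"
    by (simp add: continuous_map_in_subtopology image_subset_iff_funcset)
  then have "continuous_map (top_of_set ({0..1} \<times> {0..1})) X (F \<circ> k)"
    using F by (rule continuous_map_compose)
  moreover have "(1 - s) *\<^sub>R a 0 + s *\<^sub>R b 0 = a 0" "(1 - s) *\<^sub>R a 1 + s *\<^sub>R b 1 = a 1" for s
    using ab by (simp_all add: algebra_simps)
  ultimately show ?thesis
    unfolding path_homotopic using p q ab
    by (intro exI[of _ "F \<circ> k"]) (auto simp: k_def)
qed

lemma continuous_map_paste:
  fixes a b c :: real
  assumes "continuous_map (top_of_set {a..b}) X f" "continuous_map (top_of_set {b..c}) X g" "f b = g b"
  shows "continuous_map (top_of_set {a..c}) X (\<lambda>t. if t \<le> b then f t else g t)"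
proof (rule continuous_map_cases_le)
  show "continuous_map (top_of_set {a..c}) euclideanreal (\<lambda>t. t)"
    "continuous_map (top_of_set {a..c}) euclideanreal (\<lambda>t. b)" by auto
  show "continuous_map (subtopology (top_of_set {a..c}) {x \<in> topspace (top_of_set {a..c}). x \<le> b}) X f"
    unfolding subtopology_subtopology
    by (rule continuous_map_from_subtopology_mono[OF assms(1)]) auto
  show "continuous_map (subtopology (top_of_set {a..c}) {x \<in> topspace (top_of_set {a..c}). b \<le> x}) X g"
    unfolding subtopology_subtopology
    by (rule continuous_map_from_subtopology_mono[OF assms(2)]) auto
qed (use assms in auto)

lemma continuous_map_compose_on:
  assumes "continuous_map (top_of_set C) X F" "continuous_on S f" "f \<in> S \<rightarrow> C"
  shows "continuous_map (top_of_set S) X (\<lambda>t. F (f t))"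
proof -
  have "continuous_map (top_of_set S) (top_of_set C) f"
    using assms by (simp add: continuous_map_in_subtopology image_subset_iff_funcset)
  from continuous_map_compose[OF this assms(1)] show ?thesis by (simp add: o_def)
qed

lemma pathin_concat_loops:
  assumes "pathin X p" "pathin X q" "p 1 = q 0"
  shows "pathin X (concat_loops p q)"
  unfolding pathin_def concat_loops_def
  by (rule continuous_map_paste; (rule continuous_map_compose_on[OF assms(1)[unfolded pathin_def]]
      continuous_map_compose_on[OF assms(2)[unfolded pathin_def]])?)
     (use assms in \<open>auto intro!: continuous_intros\<close>)

lemma concat_loops_01 [simp]: "concat_loops p q 0 = p 0" "concat_loops p q 1 = q 1"
  by (auto simp: concat_loops_def)

text \<open>This is \<open>reversepath\<close> without its restriction to types of class \<open>topological_space\<close>.\<close>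

definition rev_path :: "(real \<Rightarrow> 'a) \<Rightarrow> real \<Rightarrow> 'a" where
  "rev_path p = (\<lambda>t. p (1 - t))"

lemma rev_path_01 [simp]: "rev_path p 0 = p 1" "rev_path p 1 = p 0"
  by (simp_all add: rev_path_def)

lemma pathin_rev_path: "pathin X p \<Longrightarrow> pathin X (rev_path p)"
  unfolding pathin_def rev_path_def
  by (rule continuous_map_compose_on) (auto intro!: continuous_intros)

lemma path_homotopic_concat:
  assumes "path_homotopic X p p'" "path_homotopic X q q'" "p 1 = q 0"
  shows "path_homotopic X (concat_loops p q) (concat_loops p' q')"
proof -
  obtain h where h: "continuous_map (top_of_set ({0..1} \<times> {0..1})) X h"
    "\<And>s. s \<in> {0..1} \<Longrightarrow> h (0, s) = p s \<and> h (1, s) = p' s \<and> h (s, 0) = p 0 \<and> h (s, 1) = p 1"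
    using assms(1) unfolding path_homotopic by blast
  obtain k where k: "continuous_map (top_of_set ({0..1} \<times> {0..1})) X k"
    "\<And>s. s \<in> {0..1} \<Longrightarrow> k (0, s) = q s \<and> k (1, s) = q' s \<and> k (s, 0) = q 0 \<and> k (s, 1) = q 1"
    using assms(2) unfolding path_homotopic by blast
  let ?S = "{0..1::real} \<times> {0..1::real}"
  let ?H = "\<lambda>x. if snd x \<le> 1/2 then h (fst x, 2 * snd x) else k (fst x, 2 * snd x - 1)"
  have "continuous_map (top_of_set ?S) X ?H"
  proof (rule continuous_map_cases_le)
    show "continuous_map (top_of_set ?S) euclideanreal snd"
      "continuous_map (top_of_set ?S) euclideanreal (\<lambda>t. 1/2)" by (auto intro!: continuous_intros)
    have *: "{x \<in> ?S. P (snd x)} = {0..1} \<times> {x\<in>{0..1}. P x}" for P by auto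
    show "continuous_map (subtopology (top_of_set ?S) {x \<in> topspace (top_of_set ?S). snd x \<le> 1/2}) X
      (\<lambda>x. h (fst x, 2 * snd x))"
      unfolding subtopology_subtopology
      by (rule continuous_map_compose_on[OF h(1)]) (auto intro!: continuous_intros)
    show "continuous_map (subtopology (top_of_set ?S) {x \<in> topspace (top_of_set ?S). 1/2 \<le> snd x}) X
      (\<lambda>x. k (fst x, 2 * snd x - 1))"
      unfolding subtopology_subtopology
      by (rule continuous_map_compose_on[OF k(1)]) (auto intro!: continuous_intros)
    fix x assume "x \<in> topspace (top_of_set ?S)" "snd x = 1/2"
    then have "2 * snd x = 1" "fst x \<in> {0..1}" by auto
    then show "h (fst x, 2 * snd x) = k (fst x, 2 * snd x - 1)"
      using h(2)[of "fst x"] k(2)[of "fst x"] assms(3) by simp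
  qed
  moreover have "\<forall>s\<in>{0..1}. ?H (0, s) = concat_loops p q s \<and> ?H (1, s) = concat_loops p' q' s \<and>
      ?H (s, 0) = concat_loops p q 0 \<and> ?H (s, 1) = concat_loops p q 1"
    using h(2) k(2) by (auto simp: concat_loops_def)
  ultimately show ?thesis unfolding path_homotopic by blast
qed

lemma path_homotopic_const_left:
  assumes "pathin X p" shows "path_homotopic X (concat_loops (\<lambda>_. p 0) p) p"
proof (rule path_homotopic_convex)
  \<comment> \<open>Both paths follow \<open>p\<close>; this is the time change of the one that
    waits during the first half.\<close>
  show "continuous_on {0..1} (\<lambda>t::real. max 0 (2 * t - 1))" by (intro continuous_intros)
  show "continuous_on {0..1} (\<lambda>t::real. t)" by (intro continuous_intros)
qed (use assms in \<open>auto simp: pathin_def concat_loops_def max_def field_simps\<close>)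

lemma path_homotopic_rev_path_right:
  assumes "pathin X p" shows "path_homotopic X (concat_loops p (rev_path p)) (\<lambda>_. p 0)"
proof (rule path_homotopic_convex)
  \<comment> \<open>The tent function runs \<open>p\<close> to its end and back, and it contracts to
    the constant time 0.\<close>
  show "continuous_on {0..1} (\<lambda>t::real. min (2 * t) (2 - 2 * t))" by (intro continuous_intros)
  show "continuous_on {0..1} (\<lambda>t::real. 0::real)" by (intro continuous_intros)
qed (use assms in \<open>auto simp: pathin_def concat_loops_def rev_path_def min_def field_simps\<close>)

lemma path_homotopic_rev_path_left:
  assumes "pathin X p" shows "path_homotopic X (concat_loops (rev_path p) p) (\<lambda>_. p 1)"
  using path_homotopic_rev_path_right[OF pathin_rev_path[OF assms]]
  by (simp add: rev_path_def)

lemma path_homotopic_assoc: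
  assumes p: "pathin X p" and q: "pathin X q" and r: "pathin X r" and pq: "p 1 = q 0" and qr: "q 1 = r 0"
  shows "path_homotopic X (concat_loops (concat_loops p q) r) (concat_loops p (concat_loops q r))"
proof -
  \<comment> \<open>The three paths in a row on [0, 3]. Both bracketings are time changes of
    \<open>F\<close>: one gives the pieces a quarter, a quarter and a half of the time, the other a
    half, a quarter and a quarter.\<close>
  define F where "F = (\<lambda>t. if t \<le> 1 then p t else if t \<le> 2 then q (t - 1) else r (t - 2))"
  have F: "continuous_map (top_of_set {0..3}) X F"
    unfolding F_def
    by (rule continuous_map_paste continuous_map_compose_on[OF p[unfolded pathin_def]]
        continuous_map_compose_on[OF q[unfolded pathin_def]]
        continuous_map_compose_on[OF r[unfolded pathin_def]] continuous_intros | use pq qr in simp)+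
  show ?thesis
  proof (rule path_homotopic_convex[OF _ F])
    show "continuous_on {0..1} (\<lambda>t::real. min (4 * t) (2 * t + 1))"
      "continuous_on {0..1} (\<lambda>t::real. max (2 * t) (4 * t - 1))" by (intro continuous_intros)+
    show "concat_loops (concat_loops p q) r t = F (min (4 * t) (2 * t + 1))"
      and "concat_loops p (concat_loops q r) t = F (max (2 * t) (4 * t - 1))" if "t \<in> {0..1}" for t :: real
    proof -
      \<comment> \<open>At t = 1/2 the argument of \<open>p\<close> is 1, but it appears in this
        form because \<open>max\<close> then picks its second entry.\<close>
      have "p (4 * t - 1) = q 0" if "2 * t = 1"
      proof -
        have "4 * t - 1 = 1" using that by simp
        then have "p (4 * t - 1) = p 1" by (rule arg_cong)
        with pq show ?thesis by simp
      qed
      then show "concat_loops (concat_loops p q) r t = F (min (4 * t) (2 * t + 1))"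
        and "concat_loops p (concat_loops q r) t = F (max (2 * t) (4 * t - 1))"
        using \<open>t \<in> {0..1}\<close> pq qr
        by (auto simp: F_def concat_loops_def min_def max_def not_le mult.commute[of t] not_less)
    qed
  qed auto
qed

section \<open>The fundamental group\<close>

lemma loopsD: "p \<in> loops X x \<Longrightarrow> pathin X p \<and> p 0 = x \<and> p 1 = x"
  by (simp add: loops_def)

lemma loop_homotopy_iff:
  "(p, q) \<in> loop_homotopy X x \<longleftrightarrow> p \<in> loops X x \<and> path_homotopic X p q"
proof
  assume "(p, q) \<in> loop_homotopy X x"
  then show "p \<in> loops X x \<and> path_homotopic X p q"
    by (simp add: loop_homotopy_def path_homotopic_def loops_def)
next
  assume *: "p \<in> loops X x \<and> path_homotopic X p q"
  then have "q \<in> loops X x"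
    using path_homotopic_endpoints[of X p q] path_homotopic_imp_pathin[of X p q] by (simp add: loops_def)
  with * show "(p, q) \<in> loop_homotopy X x"
    by (auto simp: loop_homotopy_def path_homotopic_def loops_def)
qed

lemma equiv_loop_homotopy: "equiv (loops X x) (loop_homotopy X x)"
proof (rule equivI)
  show "loop_homotopy X x \<subseteq> loops X x \<times> loops X x" by (auto simp: loop_homotopy_def)
  show "refl_on (loops X x) (loop_homotopy X x)"
    by (rule refl_onI) (auto simp: loop_homotopy_iff loops_def path_homotopic_refl)
  show "sym (loop_homotopy X x)"
    by (rule symI) (auto simp: loop_homotopy_iff loops_def path_homotopic_sym
        dest: path_homotopic_endpoints path_homotopic_imp_pathin)
  show "trans (loop_homotopy X x)"
    by (rule transI) (auto simp: loop_homotopy_iff intro: path_homotopic_trans)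
qed

definition loop_class :: "'a topology \<Rightarrow> 'a \<Rightarrow> (real \<Rightarrow> 'a) \<Rightarrow> (real \<Rightarrow> 'a) set" where
  "loop_class X x p = loop_homotopy X x `` {p}"

lemma loop_class_eqI:
  "p \<in> loops X x \<Longrightarrow> path_homotopic X p q \<Longrightarrow> loop_class X x p = loop_class X x q"
  unfolding loop_class_def by (rule equiv_class_eq[OF equiv_loop_homotopy]) (simp add: loop_homotopy_iff)

lemma loop_class_eqD:
  "loop_class X x p = loop_class X x q \<Longrightarrow> q \<in> loops X x \<Longrightarrow> path_homotopic X p q"
  unfolding loop_class_def using eq_equiv_class[OF _ equiv_loop_homotopy] by (fastforce simp: loop_homotopy_iff)

lemma loop_class_in_carrier: "p \<in> loops X x \<Longrightarrow> loop_class X x p \<in> carrier (fundamental_group X x)"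
  by (simp add: fundamental_group_def loop_class_def quotientI)

lemma carrier_fundamental_groupE:
  assumes "A \<in> carrier (fundamental_group X x)"
  obtains p where "p \<in> loops X x" "A = loop_class X x p"
  using assms by (auto simp: fundamental_group_def loop_class_def elim: quotientE)

lemma concat_in_loops: "p \<in> loops X x \<Longrightarrow> q \<in> loops X x \<Longrightarrow> concat_loops p q \<in> loops X x"
  by (simp add: loops_def pathin_concat_loops)

lemma rev_path_in_loops: "p \<in> loops X x \<Longrightarrow> rev_path p \<in> loops X x"
  using pathin_rev_path by (fastforce simp: loops_def rev_path_def)

lemma const_in_loops: "x \<in> topspace X \<Longrightarrow> (\<lambda>_. x) \<in> loops X x"
  by (simp add: loops_def pathin_const)

text \<open>The product of \<open>fundamental_group\<close> is a union over all pairs of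
  representatives. Concatenation respects homotopy, so all classes in this union coincide.\<close>

lemma mult_loop_class:
  assumes p: "p \<in> loops X x" and q: "q \<in> loops X x"
  shows "loop_class X x p \<otimes>\<^bsub>fundamental_group X x\<^esub> loop_class X x q = loop_class X x (concat_loops p q)"
proof -
  have "loop_class X x (concat_loops p' q') = loop_class X x (concat_loops p q)"
    if "p' \<in> loop_class X x p" "q' \<in> loop_class X x q" for p' q'
  proof (rule sym, rule loop_class_eqI)
    show "path_homotopic X (concat_loops p q) (concat_loops p' q')"
      using that p q by (intro path_homotopic_concat) (auto simp: loop_class_def loop_homotopy_iff loops_def)
  qed (use p q in \<open>simp add: concat_in_loops\<close>)
  moreover have "p \<in> loop_class X x p" "q \<in> loop_class X x q"
    using p q by (auto simp: loop_class_def loop_homotopy_iff loops_def path_homotopic_refl)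
  ultimately have "(\<Union>p\<in>loop_class X x p. \<Union>q\<in>loop_class X x q. loop_class X x (concat_loops p q))
      = loop_class X x (concat_loops p q)" by blast
  then show ?thesis by (simp add: fundamental_group_def loop_class_def)
qed

lemma one_fundamental_group: "\<one>\<^bsub>fundamental_group X x\<^esub> = loop_class X x (\<lambda>_. x)"
  by (simp add: fundamental_group_def loop_class_def)

lemma group_fundamental_group:
  assumes "x \<in> topspace X" shows "Group.group (fundamental_group X x)"
proof (rule groupI)
  let ?G = "fundamental_group X x"
  show "\<one>\<^bsub>?G\<^esub> \<in> carrier ?G"
    by (simp add: one_fundamental_group loop_class_in_carrier const_in_loops assms)
  fix A assume "A \<in> carrier ?G"
  then obtain p where p: "p \<in> loops X x" "A = loop_class X x p" by (rule carrier_fundamental_groupE)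
  show "\<one>\<^bsub>?G\<^esub> \<otimes>\<^bsub>?G\<^esub> A = A"
    using p path_homotopic_const_left[of X p] assms
    by (auto simp: one_fundamental_group mult_loop_class const_in_loops concat_in_loops loopsD intro!: loop_class_eqI)
  show "\<exists>B\<in>carrier ?G. B \<otimes>\<^bsub>?G\<^esub> A = \<one>\<^bsub>?G\<^esub>"
    using p path_homotopic_rev_path_left[of X p]
    by (intro bexI[of _ "loop_class X x (rev_path p)"])
      (auto simp: one_fundamental_group mult_loop_class rev_path_in_loops concat_in_loops loopsD
          loop_class_in_carrier intro!: loop_class_eqI)
  fix B assume "B \<in> carrier ?G"
  then obtain q where q: "q \<in> loops X x" "B = loop_class X x q" by (rule carrier_fundamental_groupE)
  show "A \<otimes>\<^bsub>?G\<^esub> B \<in> carrier ?G"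
    using p q by (simp add: mult_loop_class loop_class_in_carrier concat_in_loops)
  fix C assume "C \<in> carrier ?G"
  then obtain r where r: "r \<in> loops X x" "C = loop_class X x r" by (rule carrier_fundamental_groupE)
  show "A \<otimes>\<^bsub>?G\<^esub> B \<otimes>\<^bsub>?G\<^esub> C = A \<otimes>\<^bsub>?G\<^esub> (B \<otimes>\<^bsub>?G\<^esub> C)"
    using p q r
    by (auto simp: mult_loop_class concat_in_loops loopsD intro!: loop_class_eqI path_homotopic_assoc)
qed

section \<open>Extending a homomorphism to the fundamental groupoid\<close>

definition connecting_path :: "'a topology \<Rightarrow> 'a \<Rightarrow> 'a \<Rightarrow> real \<Rightarrow> 'a" where
  "connecting_path X x u = (SOME p. pathin X p \<and> p 0 = x \<and> p 1 = u)"

lemma connecting_path: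
  assumes "path_component_of X x u"
  shows "pathin X (connecting_path X x u) \<and> connecting_path X x u 0 = x \<and> connecting_path X x u 1 = u"
  using assms unfolding connecting_path_def path_component_of_def by (rule someI_ex)

text \<open>Chosen paths from \<open>x\<close> close \<open>p\<close> up to a loop to which
  \<open>h\<close> applies. The value 0 away from the path component of \<open>x\<close> keeps the
  extension additive on paths in the other components.\<close>

definition groupoid_extension ::
    "'a topology \<Rightarrow> 'a \<Rightarrow> ((real \<Rightarrow> 'a) set \<Rightarrow> real) \<Rightarrow> (real \<Rightarrow> 'a) \<Rightarrow> real" where
  "groupoid_extension X x h p =
     (if path_component_of X x (p 0)
      then h (loop_class X x (concat_loops (concat_loops (connecting_path X x (p 0)) p)
             (rev_path (connecting_path X x (p 1))))) else 0)"

context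
  fixes X :: "'a topology" and x :: 'a and h :: "(real \<Rightarrow> 'a) set \<Rightarrow> real"
  assumes x: "x \<in> topspace X"
    and h: "\<And>A B. A \<in> carrier (fundamental_group X x) \<Longrightarrow> B \<in> carrier (fundamental_group X x) \<Longrightarrow>
      h (A \<otimes>\<^bsub>fundamental_group X x\<^esub> B) = h A + h B"
begin

lemma additive_loop_class: "p \<in> loops X x \<Longrightarrow> q \<in> loops X x \<Longrightarrow>
    h (loop_class X x (concat_loops p q)) = h (loop_class X x p) + h (loop_class X x q)"
  using h[of "loop_class X x p" "loop_class X x q"] by (simp add: mult_loop_class loop_class_in_carrier)

lemma groupoid_extension_homotopic:
  assumes "path_homotopic X p q"
  shows "groupoid_extension X x h p = groupoid_extension X x h q"
proof -
  have e: "q 0 = p 0" "q 1 = p 1" "pathin X p" "pathin X q"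
    using assms by (auto dest: path_homotopic_endpoints path_homotopic_imp_pathin)
  show ?thesis
  proof (cases "path_component_of X x (p 0)")
    case True
    have "path_component_of X (p 0) (p 1)" using e by (auto simp: path_component_of_def)
    then have "path_component_of X x (p 1)" using True path_component_of_trans by metis
    note c = connecting_path[OF True] connecting_path[OF this]
    have "loop_class X x (concat_loops (concat_loops (connecting_path X x (p 0)) p) (rev_path (connecting_path X x (p 1))))
      = loop_class X x (concat_loops (concat_loops (connecting_path X x (p 0)) q) (rev_path (connecting_path X x (p 1))))"
      using c e assms
      by (intro loop_class_eqI path_homotopic_concat)
        (auto simp: loops_def pathin_concat_loops pathin_rev_path path_homotopic_refl)
    then show ?thesis by (simp add: groupoid_extension_def e)
  qed (simp add: groupoid_extension_def e)
qed

text \<open>The path chosen for the middle point enters once backwards and once forwards and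
  cancels. Apart from this cancellation the calculation only rebrackets.\<close>

lemma groupoid_extension_concat:
  assumes p: "pathin X p" and q: "pathin X q" and pq: "p 1 = q 0"
  shows "groupoid_extension X x h (concat_loops p q) = groupoid_extension X x h p + groupoid_extension X x h q"
proof (cases "path_component_of X x (p 0)")
  case True
  have "path_component_of X (p 0) (p 1)" "path_component_of X (q 0) (q 1)"
    using p q by (auto simp: path_component_of_def)
  then have 2: "path_component_of X x (p 1)" and 3: "path_component_of X x (q 1)"
    using True pq path_component_of_trans by metis+
  define a b c where "a = connecting_path X x (p 0)" "b = connecting_path X x (p 1)" "c = connecting_path X x (q 1)"
  have a: "pathin X a" "a 0 = x" "a 1 = p 0" and b: "pathin X b" "b 0 = x" "b 1 = q 0"
    and c: "pathin X c" "c 0 = x" "c 1 = q 1"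
    using connecting_path[OF True] connecting_path[OF 2] connecting_path[OF 3] pq by (auto simp: a_b_c_def)
  let ?b = "rev_path b" and ?c = "rev_path c"
  have b': "pathin X ?b" "?b 0 = p 1" "?b 1 = x" and c': "pathin X ?c" "?c 0 = q 1" "?c 1 = x"
    using b c pq by (simp_all add: pathin_rev_path)
  have bb: "path_homotopic X (concat_loops ?b b) (\<lambda>_. q 0)"
    using path_homotopic_rev_path_left[OF b(1)] b by simp
  note [simp] = pathin_concat_loops a b c b' c' p q pq path_homotopic_refl
  have 4: "concat_loops (concat_loops a p) ?b \<in> loops X x" "concat_loops (concat_loops b q) ?c \<in> loops X x"
    by (simp_all add: loops_def)
  have "path_homotopic X (concat_loops (concat_loops (concat_loops a p) ?b) (concat_loops (concat_loops b q) ?c))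
     (concat_loops (concat_loops a p) (concat_loops ?b (concat_loops (concat_loops b q) ?c)))"
    by (rule path_homotopic_assoc) simp_all
  also have "path_homotopic X \<dots> (concat_loops (concat_loops a p) (concat_loops (concat_loops ?b (concat_loops b q)) ?c))"
    by (rule path_homotopic_concat[OF _ path_homotopic_sym[OF path_homotopic_assoc]]) simp_all
  also have "path_homotopic X \<dots> (concat_loops (concat_loops a p) (concat_loops (concat_loops (concat_loops ?b b) q) ?c))"
    by (rule path_homotopic_concat[OF _ path_homotopic_concat[OF path_homotopic_sym[OF path_homotopic_assoc]]]) simp_all
  also have "path_homotopic X \<dots> (concat_loops (concat_loops a p) (concat_loops (concat_loops (\<lambda>_. q 0) q) ?c))"
    by (rule path_homotopic_concat[OF _ path_homotopic_concat[OF path_homotopic_concat[OF bb]]]) simp_all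
  also have "path_homotopic X \<dots> (concat_loops (concat_loops a p) (concat_loops q ?c))"
    by (rule path_homotopic_concat[OF _ path_homotopic_concat[OF path_homotopic_const_left]]) simp_all
  also have "path_homotopic X \<dots> (concat_loops (concat_loops (concat_loops a p) q) ?c)"
    by (rule path_homotopic_sym[OF path_homotopic_assoc]) simp_all
  also have "path_homotopic X \<dots> (concat_loops (concat_loops a (concat_loops p q)) ?c)"
    by (rule path_homotopic_concat[OF path_homotopic_assoc]) simp_all
  finally have "loop_class X x (concat_loops (concat_loops (concat_loops a p) ?b) (concat_loops (concat_loops b q) ?c))
    = loop_class X x (concat_loops (concat_loops a (concat_loops p q)) ?c)"
    by (rule loop_class_eqI[rotated]) (use 4 in \<open>simp add: concat_in_loops\<close>)
  then show ?thesis
    using True 2 3 additive_loop_class[OF 4]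
    by (simp add: groupoid_extension_def a_b_c_def(1,3) flip: pq) (simp add: a_b_c_def(2))
next
  case False
  have "path_component_of X (p 0) (p 1)" using p by (auto simp: path_component_of_def)
  then have "\<not> path_component_of X x (p 1)"
    using False path_component_of_trans path_component_of_sym by metis
  then show ?thesis using False pq by (simp add: groupoid_extension_def)
qed

text \<open>The path chosen from \<open>x\<close> to itself may be any loop, but it enters by
  conjugation and disappears because the reals are commutative.\<close>

lemma groupoid_extension_loop:
  assumes p: "p \<in> loops X x"
  shows "groupoid_extension X x h p = h (loop_class X x p)"
proof -
  have x': "path_component_of X x x" using x by (simp add: path_component_of_refl)
  define a where "a = connecting_path X x x"
  have a: "a \<in> loops X x" using connecting_path[OF x'] by (simp add: loops_def a_def)
  have 1: "rev_path a \<in> loops X x" using a by (rule rev_path_in_loops)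
  have "h (loop_class X x (\<lambda>_. x)) = 0"
  proof -
    have "loop_class X x (concat_loops (\<lambda>_. x) (\<lambda>_. x)) = loop_class X x (\<lambda>_. x)"
      using path_homotopic_const_left[of X "\<lambda>_. x"] x
      by (intro loop_class_eqI) (simp_all add: concat_in_loops const_in_loops pathin_const)
    then show ?thesis using additive_loop_class[of "\<lambda>_. x" "\<lambda>_. x"] x by (simp add: const_in_loops)
  qed
  moreover have "loop_class X x (concat_loops a (rev_path a)) = loop_class X x (\<lambda>_. x)"
    using path_homotopic_rev_path_right[of X a] a 1
    by (intro loop_class_eqI) (auto simp: concat_in_loops dest: loopsD)
  ultimately have "h (loop_class X x a) + h (loop_class X x (rev_path a)) = 0"
    using additive_loop_class[OF a 1] by simp
  then show ?thesis
    using p a 1 x' by (simp add: groupoid_extension_def loopsD additive_loop_class concat_in_loops flip: a_def)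
qed

end

section \<open>The plane as universal cover of the Klein bottle\<close>

text \<open>The deck transformations. They act on complex numbers instead of pairs so that winding
  numbers and logarithms apply.\<close>

definition act :: "int \<Rightarrow> int \<Rightarrow> complex \<Rightarrow> complex" where
  "act m k z = Complex ((if even k then Re z else - Re z) + of_int m) (Im z + of_int k)"

definition kproj :: "complex \<Rightarrow> (real \<times> real) set" where
  "kproj z = klein_rel `` {(Re z, Im z)}"

lemma Re_act [simp]: "Re (act m k z) = (if even k then Re z else - Re z) + of_int m"
  and Im_act [simp]: "Im (act m k z) = Im z + of_int k"
  by (simp_all add: act_def)

lemma act_00 [simp]: "act 0 0 z = z"
  by (simp add: complex_eq_iff)

lemma act_act: "act m k (act m' k' z) = act (m + (if even k then m' else - m')) (k + k') z"
  by (simp add: complex_eq_iff)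

lemma dist_act [simp]: "dist (act m k z) (act m k w) = dist z w"
  by (simp add: dist_norm cmod_def power2_commute)

lemma continuous_on_act [continuous_intros]:
  assumes "continuous_on S f" shows "continuous_on S (\<lambda>t. act m k (f t))"
proof -
  have "(\<lambda>t. act m k (f t)) = (\<lambda>t. complex_of_real ((if even k then Re (f t) else - Re (f t)) + of_int m) +
      \<i> * complex_of_real (Im (f t) + of_int k))"
    by (auto simp: complex_eq_iff)
  moreover have "continuous_on S (\<lambda>t. complex_of_real ((if even k then Re (f t) else - Re (f t)) + of_int m) +
      \<i> * complex_of_real (Im (f t) + of_int k))"
    by (cases "even k") (auto intro!: continuous_intros assms)
  ultimately show ?thesis by (simp only:)
qed

lemma kproj_eq_iff: "kproj z = kproj w \<longleftrightarrow> (\<exists>m k. w = act m k z)"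
proof -
  have "kproj z = kproj w \<longleftrightarrow> ((Re z, Im z), (Re w, Im w)) \<in> klein_rel"
    unfolding kproj_def by (simp add: eq_equiv_class_iff[OF equiv_klein_rel])
  also have "\<dots> \<longleftrightarrow> (\<exists>m k. w = act m k z)"
    by (simp add: klein_rel_def complex_eq_iff)
  finally show ?thesis .
qed

lemma kproj_act [simp]: "kproj (act m k z) = kproj z"
  by (metis kproj_eq_iff)

lemma kproj_eqE:
  assumes "kproj z = kproj w" obtains m k where "w = act m k z"
  using assms kproj_eq_iff by blast

lemma topspace_klein_bottle: "topspace klein_bottle = range kproj"
proof -
  have "topspace klein_bottle = (\<lambda>p. klein_rel `` {p}) ` topspace euclidean"
    using quotient_map_klein_bottle unfolding quotient_map_def by blast
  also have "\<dots> = range kproj"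
  proof -
    have "klein_rel `` {p} = kproj (Complex (fst p) (snd p))" for p by (simp add: kproj_def)
    then have "range (\<lambda>p. klein_rel `` {p}) \<subseteq> range kproj" by blast
    moreover have "range kproj \<subseteq> range (\<lambda>p. klein_rel `` {p})" by (auto simp: kproj_def)
    ultimately show ?thesis by simp
  qed
  finally show ?thesis .
qed

lemma continuous_map_kproj:
  assumes "continuous_on S f" shows "continuous_map (top_of_set S) klein_bottle (\<lambda>t. kproj (f t))"
proof -
  have "continuous_map (top_of_set S) euclidean (\<lambda>t. (Re (f t), Im (f t)))"
    using assms by (auto intro!: continuous_intros)
  from continuous_map_compose[OF this quotient_imp_continuous_map[OF quotient_map_klein_bottle]]
  show ?thesis by (simp add: o_def kproj_def)
qed

text \<open>A deck transformation with \<open>k \<noteq> 0\<close> changes the height by at least 1,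
  and one with \<open>k = 0\<close> is a horizontal translation by an integer. The uniform constant
  gives unique lifting and bounds the radii of the punctured discs used later.\<close>

lemma kproj_separated: "kproj z = kproj w \<Longrightarrow> z \<noteq> w \<Longrightarrow> 1 \<le> dist z w"
proof (elim kproj_eqE)
  fix m k assume w: "w = act m k z" and "z \<noteq> w"
  have "1 \<le> \<bar>Re (z - w)\<bar> \<or> 1 \<le> \<bar>Im (z - w)\<bar>"
  proof (cases "k = 0")
    case True
    with w \<open>z \<noteq> w\<close> have "m \<noteq> 0" by (auto simp: complex_eq_iff)
    then show ?thesis using True w by simp
  next
    case False
    then have "1 \<le> \<bar>real_of_int k\<bar>" by linarith
    then show ?thesis using w by simp
  qed
  then show "1 \<le> dist z w"
    using abs_Re_le_cmod[of "z - w"] abs_Im_le_cmod[of "z - w"] by (auto simp: dist_norm)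
qed

lemma closed_orbit: "closed {w. kproj w = A}"
proof (rule discrete_imp_closed[of 1], simp, intro ballI impI)
  fix z w assume "z \<in> {w. kproj w = A}" "w \<in> {w. kproj w = A}" "dist w z < 1"
  then show "w = z" using kproj_separated[of w z] by fastforce
qed

lemma countable_orbit: "countable {w. kproj w = A}"
proof (cases "\<exists>z. kproj z = A")
  case True
  then obtain z where z: "kproj z = A" by blast
  have "{w. kproj w = A} \<subseteq> (\<lambda>(m, k). act m k z) ` UNIV"
  proof
    fix w assume "w \<in> {w. kproj w = A}"
    then obtain m k where "w = act m k z" using z kproj_eq_iff by (metis mem_Collect_eq)
    then show "w \<in> (\<lambda>(m, k). act m k z) ` UNIV" by force
  qed
  then show ?thesis by (rule countable_subset) simp
qed simp

text \<open>This is the Hausdorff property of the Klein bottle. Deck transformations are isometries,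
  so a small displacement of \<open>w\<close> can be carried over to the point of its orbit near
  \<open>z\<close>.\<close>

lemma kproj_neq_nhds:
  assumes "kproj z \<noteq> kproj w"
  obtains e where "e > 0" "\<And>z' w'. dist z' z < e \<Longrightarrow> dist w' w < e \<Longrightarrow> kproj z' \<noteq> kproj w'"
proof -
  have "open (- {w'. kproj w' = kproj w})" using closed_orbit by auto
  moreover have "z \<in> - {w'. kproj w' = kproj w}" using assms by simp
  ultimately obtain d where d: "d > 0" "\<And>v. dist v z < d \<Longrightarrow> kproj v \<noteq> kproj w"
    unfolding open_dist by blast
  show thesis
  proof (rule that[of "d / 2"])
    fix z' w' assume *: "dist z' z < d / 2" "dist w' w < d / 2"
    show "kproj z' \<noteq> kproj w'"
    proof
      assume "kproj z' = kproj w'"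
      then obtain m k where "z' = act m k w'" by (metis kproj_eqE)
      then have "dist (act m k w) z' < d / 2" using *(2) by (simp add: dist_commute)
      then have "dist (act m k w) z < d" using *(1) dist_triangle[of "act m k w" z z'] by simp
      then show False using d(2) by fastforce
    qed
  qed (use d in auto)
qed

section \<open>Lifting maps on convex sets from the Klein bottle to the plane\<close>

lemma klein_bottle_continuous_fun:
  fixes F :: "real \<times> real \<Rightarrow> complex"
  assumes F: "continuous_on UNIV F" and resp: "\<And>p q. (p, q) \<in> klein_rel \<Longrightarrow> F p = F q"
  obtains E where "continuous_map klein_bottle euclidean E" "\<And>z. E (kproj z) = F (Re z, Im z)"
proof
  define E where "E = (\<lambda>A. F (SOME p. klein_rel `` {p} = A))"
  have E: "E (klein_rel `` {p}) = F p" for p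
  proof -
    have "klein_rel `` {SOME q. klein_rel `` {q} = klein_rel `` {p}} = klein_rel `` {p}"
      by (rule someI[of "\<lambda>q. klein_rel `` {q} = klein_rel `` {p}" p]) simp
    then show ?thesis unfolding E_def by (intro resp) (simp add: eq_equiv_class_iff[OF equiv_klein_rel])
  qed
  then have "E \<circ> (\<lambda>p. klein_rel `` {p}) = F" by auto
  with F show "continuous_map klein_bottle euclidean E"
    by (simp flip: continuous_compose_quotient_map_eq[OF quotient_map_klein_bottle])
  show "E (kproj z) = F (Re z, Im z)" for z by (simp add: kproj_def E)
qed

lemma cis_add_2pi_int: "cis (2 * pi * (x + of_int k)) = cis (2 * pi * x)"
  by (metis cis_multiple_2pi Ints_of_int cis_mult distrib_left mult.right_neutral mult.assoc)

lemma cis_2pi_eqD: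
  assumes "cis (2 * pi * x) = cis (2 * pi * y)" obtains k :: int where "x = y + of_int k"
proof -
  have "cis (2 * pi * (x - y)) = 1"
    using assms by (simp add: right_diff_distrib flip: cis_divide)
  then have "cos (2 * pi * (x - y)) = 1" by (metis cis.simps(1) one_complex.simps(1))
  then obtain k :: int where "2 * pi * (x - y) = of_int k * 2 * pi" by (auto simp: cos_one_2pi_int)
  then have "2 * pi * (x - y - of_int k) = 0" by (simp add: algebra_simps)
  then have "x = y + of_int k" by simp
  then show thesis by (rule that)
qed

lemma continuous_angle:
  fixes S :: "'b :: real_normed_vector set"
  assumes "convex S" "continuous_on S e" "\<And>s. s \<in> S \<Longrightarrow> cmod (e s) = 1"
  obtains y where "continuous_on S y" "\<And>s. s \<in> S \<Longrightarrow> e s = cis (2 * pi * y s)"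
proof -
  have "e s \<noteq> 0" if "s \<in> S" for s using assms(3)[OF that] by auto
  then obtain g where g: "continuous_on S g" "\<And>s. s \<in> S \<Longrightarrow> e s = exp (g s)"
    using continuous_logarithm_on_contractible[OF assms(2) convex_imp_contractible[OF assms(1)]] by metis
  show thesis
  proof
    show "continuous_on S (\<lambda>s. Im (g s) / (2 * pi))" by (intro continuous_intros g) auto
    show "e s = cis (2 * pi * (Im (g s) / (2 * pi)))" if "s \<in> S" for s
    proof -
      have "exp (Re (g s)) = 1" using assms(3)[OF that] g(2)[OF that] by simp
      then show ?thesis using g(2)[OF that] by (simp add: exp_eq_polar)
    qed
  qed
qed

text \<open>The coordinate \<open>y\<close> is lifted first; once it is fixed, \<open>sin (2 * pi * x)\<close> is determined by
  the invariant function \<open>sin (2 * pi * x) * cis (pi * y)\<close>, so that \<open>x\<close> can be lifted as well.\<close>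

lemma klein_lift:
  fixes S :: "'b :: real_normed_vector set"
  assumes S: "convex S" and g: "continuous_map (top_of_set S) klein_bottle g"
    and s0: "s0 \<in> S" "kproj z0 = g s0"
  obtains l where "continuous_on S l" "\<And>s. s \<in> S \<Longrightarrow> kproj (l s) = g s" "l s0 = z0"
proof -
  have sin_shift: "sin (2 * pi * ((if even k then x else - x) + of_int m)) = (if even k then 1 else - 1) * sin (2 * pi * x)"
    and cos_shift: "cos (2 * pi * ((if even k then x else - x) + of_int m)) = cos (2 * pi * x)"
    and cis_shift: "cis (pi * (y + of_int k)) = (if even k then 1 else - 1) * cis (pi * y)" for x y and m k :: int
  proof -
    have "sin (2 * pi * (u + of_int m)) = sin (2 * pi * u)" "cos (2 * pi * (u + of_int m)) = cos (2 * pi * u)" for u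
      using arg_cong[OF cis_add_2pi_int, of Im u m] arg_cong[OF cis_add_2pi_int, of Re u m] by simp_all
    then show "sin (2 * pi * ((if even k then x else - x) + of_int m)) = (if even k then 1 else - 1) * sin (2 * pi * x)"
      "cos (2 * pi * ((if even k then x else - x) + of_int m)) = cos (2 * pi * x)"
      by simp_all
    show "cis (pi * (y + of_int k)) = (if even k then 1 else - 1) * cis (pi * y)"
    proof (cases "even k")
      case True
      then obtain j where "k = 2 * j" by blast
      then show ?thesis using cis_add_2pi_int[of "y / 2" j] by (simp add: algebra_simps)
    next
      case False
      then obtain j where "k = 2 * j + 1" by (rule oddE)
      then have "pi * (y + of_int k) = 2 * pi * (y / 2 + of_int j) + pi" by (simp add: algebra_simps)
      then have "cis (pi * (y + of_int k)) = cis (2 * pi * (y / 2)) * cis pi"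
        by (simp only: cis_mult[symmetric] cis_add_2pi_int)
      then show ?thesis using False by simp
    qed
  qed
  \<comment> \<open>An odd \<open>k\<close> changes the sign of both factors of \<open>F2\<close>,
    which makes it invariant. \<open>F1\<close> determines y modulo 1, and \<open>F3\<close>
    supplies the cosine that belongs to the sine in \<open>F2\<close>.\<close>
  define F1 F2 F3 :: "real \<times> real \<Rightarrow> complex"
    where "F1 = (\<lambda>p. cis (2 * pi * snd p))" and "F2 = (\<lambda>p. of_real (sin (2 * pi * fst p)) * cis (pi * snd p))"
      and "F3 = (\<lambda>p. of_real (cos (2 * pi * fst p)))"
  have contF: "continuous_on UNIV F1" "continuous_on UNIV F2" "continuous_on UNIV F3"
    unfolding F1_def F2_def F3_def by (intro continuous_intros)+
  have resp: "F1 p = F1 q" "F2 p = F2 q" "F3 p = F3 q" if "(p, q) \<in> klein_rel" for p q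
  proof -
    from that obtain x y and m k :: int
      where pq: "p = (x, y)" "q = ((if even k then x else - x) + of_int m, y + of_int k)"
      by (auto simp: klein_rel_def)
    show "F1 p = F1 q" unfolding pq F1_def snd_conv cis_add_2pi_int ..
    show "F2 p = F2 q" unfolding pq F2_def fst_conv snd_conv sin_shift cis_shift by simp
    show "F3 p = F3 q" unfolding pq F3_def fst_conv cos_shift ..
  qed
  obtain E1 where E1: "continuous_map klein_bottle euclidean E1" "\<And>z. E1 (kproj z) = F1 (Re z, Im z)"
    using klein_bottle_continuous_fun[OF contF(1) resp(1)] by blast
  obtain E2 where E2: "continuous_map klein_bottle euclidean E2" "\<And>z. E2 (kproj z) = F2 (Re z, Im z)"
    using klein_bottle_continuous_fun[OF contF(2) resp(2)] by blast
  obtain E3 where E3: "continuous_map klein_bottle euclidean E3" "\<And>z. E3 (kproj z) = F3 (Re z, Im z)"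
    using klein_bottle_continuous_fun[OF contF(3) resp(3)] by blast
  have cont: "continuous_on S (\<lambda>s. E (g s))" if "continuous_map klein_bottle euclidean E" for E :: "_ \<Rightarrow> complex"
    using continuous_map_compose[OF g that] by (simp add: o_def)
  have rep: "\<exists>z. g s = kproj z" if "s \<in> S" for s
    using continuous_map_image_subset_topspace[OF g] that unfolding topspace_klein_bottle by auto
  obtain y where y: "continuous_on S y" "\<And>s. s \<in> S \<Longrightarrow> E1 (g s) = cis (2 * pi * y s)"
  proof -
    have "cmod (E1 (g s)) = 1" if "s \<in> S" for s
      using rep[OF that] E1(2) by (auto simp: F1_def)
    then show thesis using continuous_angle[OF S cont[OF E1(1)]] that by metis
  qed
  have rep': "\<exists>x. g s = kproj (Complex x (y s))" if s: "s \<in> S" for s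
  proof -
    obtain z where z: "g s = kproj z" using rep[OF s] by blast
    then have "cis (2 * pi * y s) = cis (2 * pi * Im z)"
      using y(2)[OF s] E1(2)[of z] by (simp add: F1_def)
    then obtain k :: int where "y s = Im z + of_int k" by (rule cis_2pi_eqD)
    then have "act 0 k z = Complex (Re (act 0 k z)) (y s)" by (simp add: complex_eq_iff)
    then show ?thesis using z by (metis kproj_act)
  qed
  \<comment> \<open>Once y is chosen, \<open>cis (- (pi * y))\<close> cancels the second factor of
    \<open>F2\<close>; what remains is the point of the unit circle with angle 2 pi x.\<close>
  define e where "e = (\<lambda>s. E3 (g s) + \<i> * (E2 (g s) * cis (- (pi * y s))))"
  have e: "e s = cis (2 * pi * x)" if "s \<in> S" "g s = kproj (Complex x (y s))" for s x
    using that E2(2)[of "Complex x (y s)"] E3(2)[of "Complex x (y s)"]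
    by (simp add: e_def F2_def F3_def mult.assoc cis_mult) (simp add: complex_eq_iff)
  have "continuous_on S e"
    unfolding e_def by (intro continuous_intros cont E2 E3 y)
  moreover have "cmod (e s) = 1" if s: "s \<in> S" for s
  proof -
    obtain u where "g s = kproj (Complex u (y s))" using rep'[OF s] by blast
    then show ?thesis using e[OF s] by simp
  qed
  ultimately obtain x where x: "continuous_on S x" "\<And>s. s \<in> S \<Longrightarrow> e s = cis (2 * pi * x s)"
    using continuous_angle[OF S] by metis
  define l where "l = (\<lambda>s. Complex (x s) (y s))"
  have l: "continuous_on S l"
    unfolding l_def Complex_eq by (intro continuous_intros x y)
  have lg: "kproj (l s) = g s" if s: "s \<in> S" for s
  proof -
    obtain u where u: "g s = kproj (Complex u (y s))" using rep'[OF s] by blast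
    then obtain k :: int where "x s = u + of_int k"
      using x(2)[OF s] e[OF s] by (metis cis_2pi_eqD)
    then have "l s = act k 0 (Complex u (y s))" by (simp add: l_def complex_eq_iff)
    then show ?thesis using u by simp
  qed
  obtain m k where mk: "z0 = act m k (l s0)" using lg[OF s0(1)] s0(2) by (metis kproj_eqE)
  show thesis
    by (rule that[of "\<lambda>s. act m k (l s)"]) (auto intro!: continuous_intros l simp: lg mk)
qed

text \<open>By \<open>kproj_separated\<close> the distance of two lifts is 0 or at least 1. On a
  connected set it cannot jump past 1/2.\<close>

lemma klein_lift_unique:
  assumes S: "connected S" and l: "continuous_on S l" "continuous_on S l'"
    and eq: "\<And>s. s \<in> S \<Longrightarrow> kproj (l s) = kproj (l' s)" and s0: "s0 \<in> S" "l s0 = l' s0" and s: "s \<in> S"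
  shows "l s = l' s"
proof -
  let ?d = "\<lambda>s. dist (l s) (l' s)"
  have "connected (?d ` S)"
    by (intro connected_continuous_image continuous_intros l S)
  moreover have "?d s0 \<in> ?d ` S" "?d s \<in> ?d ` S" using s0 s by auto
  ultimately have "closed_segment (?d s0) (?d s) \<subseteq> ?d ` S" by (simp add: connected_contains_Icc closed_segment_eq_real_ivl)
  moreover have "min (?d s) (1/2) \<in> closed_segment (?d s0) (?d s)"
    using s0 by (auto simp: closed_segment_eq_real_ivl)
  ultimately obtain t where "t \<in> S" "?d t = min (?d s) (1/2)" by (metis (no_types, lifting) imageE in_mono)
  then have "l t = l' t" using kproj_separated[OF eq[of t]] by (auto simp: min_def split: if_splits)
  then have "min (?d s) (1/2) = 0" using \<open>?d t = _\<close> by simp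
  then show ?thesis by (auto simp: min_def split: if_splits)
qed

section \<open>Configurations of points in the plane over the Klein bottle\<close>

declare One_nat_def [simp del]

definition config_proj :: "nat \<Rightarrow> (nat \<Rightarrow> complex) \<Rightarrow> nat \<Rightarrow> (real \<times> real) set" where
  "config_proj n z = (\<lambda>i\<in>{1..n}. kproj (z i))"

definition config_ok :: "nat \<Rightarrow> (nat \<Rightarrow> complex) \<Rightarrow> bool" where
  "config_ok n z \<longleftrightarrow> inj_on (\<lambda>i. kproj (z i)) {1..n}"

lemma config_okD: "config_ok n z \<Longrightarrow> i \<in> {1..n} \<Longrightarrow> j \<in> {1..n} \<Longrightarrow> i \<noteq> j \<Longrightarrow> kproj (z i) \<noteq> kproj (z j)"
  unfolding config_ok_def by (metis inj_onD)

lemma config_proj_eq_iff: "config_proj n z = config_proj n w \<longleftrightarrow> (\<forall>i\<in>{1..n}. kproj (z i) = kproj (w i))"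
proof
  assume *: "config_proj n z = config_proj n w"
  show "\<forall>i\<in>{1..n}. kproj (z i) = kproj (w i)"
  proof
    fix i assume "i \<in> {1..n}"
    then show "kproj (z i) = kproj (w i)" using fun_cong[OF *, of i] by (simp add: config_proj_def)
  qed
next
  assume "\<forall>i\<in>{1..n}. kproj (z i) = kproj (w i)"
  then show "config_proj n z = config_proj n w"
    unfolding config_proj_def by (intro restrict_ext) blast
qed

lemma config_proj_apply [simp]: "i \<in> {1..n} \<Longrightarrow> config_proj n z i = kproj (z i)"
  by (simp add: config_proj_def)

lemma inj_on_config_proj: "inj_on (config_proj n z) {1..n} \<longleftrightarrow> config_ok n z"
  unfolding config_ok_def by (rule inj_on_cong) simp

lemma continuous_map_config_space:
  "continuous_map Z (config_space n X) F \<longleftrightarrow> (\<forall>i\<in>{1..n}. continuous_map Z X (\<lambda>t. F t i)) \<and>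
     (\<forall>t\<in>topspace Z. F t \<in> extensional {1..n} \<and> inj_on (F t) {1..n})"
  unfolding config_space_def continuous_map_in_subtopology continuous_map_componentwise by auto

lemma continuous_map_config_proj:
  assumes "\<And>i. i \<in> {1..n} \<Longrightarrow> continuous_on S (\<lambda>t. l t i)" "\<And>t. t \<in> S \<Longrightarrow> config_ok n (l t)"
  shows "continuous_map (top_of_set S) (config_space n klein_bottle) (\<lambda>t. config_proj n (l t))"
  unfolding continuous_map_config_space
proof (intro conjI ballI)
  show "continuous_map (top_of_set S) klein_bottle (\<lambda>t. config_proj n (l t) i)" if "i \<in> {1..n}" for i
    using continuous_map_kproj[OF assms(1)[OF that]] that by simp
  show "config_proj n (l t) \<in> extensional {1..n}" for t by (simp add: config_proj_def)
  show "inj_on (config_proj n (l t)) {1..n}" if "t \<in> topspace (top_of_set S)" for t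
    using assms(2)[of t] that by (simp add: inj_on_config_proj)
qed

lemma config_lift:
  fixes S :: "'b :: real_normed_vector set"
  assumes S: "convex S" and g: "continuous_map (top_of_set S) (config_space n klein_bottle) g"
    and s0: "s0 \<in> S" "config_proj n z0 = g s0"
  obtains l where "\<And>i. continuous_on S (\<lambda>s. l s i)" "\<And>s. s \<in> S \<Longrightarrow> config_proj n (l s) = g s"
    "\<And>s. s \<in> S \<Longrightarrow> config_ok n (l s)" "l s0 = z0" "\<And>s i. i \<notin> {1..n} \<Longrightarrow> l s i = z0 i"
proof -
  note g' = g[unfolded continuous_map_config_space]
  have "\<forall>i\<in>{1..n}. \<exists>l. continuous_on S l \<and> (\<forall>s\<in>S. kproj (l s) = g s i) \<and> l s0 = z0 i"
  proof
    fix i assume i: "i \<in> {1..n}"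
    have 1: "kproj (z0 i) = g s0 i" using s0(2) config_proj_apply[OF i, of z0] by simp
    have 2: "continuous_map (top_of_set S) klein_bottle (\<lambda>s. g s i)" by (rule bspec[OF conjunct1[OF g'] i])
    obtain l where "continuous_on S l" "\<And>s. s \<in> S \<Longrightarrow> kproj (l s) = g s i" "l s0 = z0 i"
      by (rule klein_lift[OF S 2 s0(1) 1]) blast
    then show "\<exists>l. continuous_on S l \<and> (\<forall>s\<in>S. kproj (l s) = g s i) \<and> l s0 = z0 i" by blast
  qed
  from bchoice[OF this] obtain l where l: "\<And>i. i \<in> {1..n} \<Longrightarrow> continuous_on S (l i)"
    "\<And>i s. i \<in> {1..n} \<Longrightarrow> s \<in> S \<Longrightarrow> kproj (l i s) = g s i" "\<And>i. i \<in> {1..n} \<Longrightarrow> l i s0 = z0 i"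
    by blast
  define L where "L = (\<lambda>s i. if i \<in> {1..n} then l i s else z0 i)"
  show thesis
  proof
    show "continuous_on S (\<lambda>s. L s i)" for i
      using l(1)[of i] by (cases "i \<in> {1..n}") (simp_all add: L_def del: atLeastAtMost_iff)
    show Lg: "config_proj n (L s) = g s" if "s \<in> S" for s
    proof (rule extensionalityI[of _ "{1..n}"])
      show "g s \<in> extensional {1..n}" using g' that by simp
    qed (use that in \<open>auto simp: config_proj_def L_def l\<close>)
    show "config_ok n (L s)" if "s \<in> S" for s
      unfolding inj_on_config_proj[symmetric] Lg[OF that] using g' that by simp
  qed (auto simp: L_def l)
qed

text \<open>Vertical translations commute with all deck transformations and so descend to a flow on
  the Klein bottle. Horizontal ones do not, because of the reflection.\<close>

lemma kproj_add_vertical [simp]: "kproj (z + \<i> * of_real s) = kproj (w + \<i> * of_real s) \<longleftrightarrow> kproj z = kproj w"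
proof -
  have *: "act m k (z + \<i> * of_real s) = act m k z + \<i> * of_real s" for m k z by (simp add: complex_eq_iff)
  show ?thesis by (simp add: kproj_eq_iff *)
qed

section \<open>Winding numbers in the pure braid group\<close>

lemma continuous_on_config_fun_upd:
  assumes "continuous_on S \<gamma>" shows "continuous_on S (\<lambda>t. (z(i := \<gamma> t)) j)"
  using assms by (cases "i = j") simp_all

lemma config_ok_fun_upd:
  assumes "config_ok n z" "\<And>j. j \<in> {1..n} - {i} \<Longrightarrow> kproj w \<noteq> kproj (z j)"
  shows "config_ok n (z(i := w))"
  using assms unfolding config_ok_def inj_on_def by (metis (full_types) DiffI fun_upd_apply singletonD)

text \<open>\<open>q\<close> is a lift of the base configuration. Lifts are 0 outside {1..n} and
  thus live in a function space with the product topology, whereas configurations in the Klein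
  bottle are \<open>undefined\<close> there.\<close>

locale klein_braids =
  fixes n :: nat and q :: "nat \<Rightarrow> complex"
  assumes q: "config_ok n q" and q0: "i \<notin> {1..n} \<Longrightarrow> q i = 0"
begin

abbreviation X :: "(nat \<Rightarrow> (real \<times> real) set) topology" where
  "X \<equiv> config_space n klein_bottle"

abbreviation base :: "nat \<Rightarrow> (real \<times> real) set" where
  "base \<equiv> config_proj n q"

abbreviation G :: "(real \<Rightarrow> nat \<Rightarrow> (real \<times> real) set) set monoid" where
  "G \<equiv> fundamental_group X base"

lemma base_in_X: "base \<in> topspace X"
proof -
  have "continuous_map (top_of_set {0::real}) X (\<lambda>t. base)"
    by (rule continuous_map_config_proj) (use q in auto)
  then have "base \<in> topspace X" if "(0::real) \<in> topspace (top_of_set {0})"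
    using that unfolding continuous_map_def by blast
  then show ?thesis by simp
qed

sublocale Group.group G
  by (rule group_fundamental_group[OF base_in_X])

section \<open>Lifts of braids and of their homotopies to the plane\<close>

definition is_lift :: "(real \<Rightarrow> nat \<Rightarrow> (real \<times> real) set) \<Rightarrow> (real \<Rightarrow> nat \<Rightarrow> complex) \<Rightarrow> bool" where
  "is_lift p l \<longleftrightarrow> (\<forall>i. continuous_on {0..1} (\<lambda>t. l t i)) \<and>
     (\<forall>t\<in>{0..1}. config_proj n (l t) = p t \<and> config_ok n (l t)) \<and> l 0 = q \<and>
     (\<forall>t. \<forall>i. i \<notin> {1..n} \<longrightarrow> l t i = 0)"

lemma lift_exists:
  assumes "p \<in> loops X base" obtains l where "is_lift p l"
proof -
  have p: "continuous_map (top_of_set {0..1}) X p" "base = p 0"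
    using assms by (auto simp: loops_def pathin_def)
  obtain l where "\<And>i. continuous_on {0..1} (\<lambda>s. l s i)" "\<And>s. s \<in> {0..1} \<Longrightarrow> config_proj n (l s) = p s"
    "\<And>s. s \<in> {0..1} \<Longrightarrow> config_ok n (l s)" "l 0 = q" "\<And>s i. i \<notin> {1..n} \<Longrightarrow> l s i = q i"
    by (rule config_lift[OF _ p(1) _ p(2)]) auto
  then have "is_lift p l" by (simp add: is_lift_def q0)
  then show thesis by (rule that)
qed

text \<open>The whole square is lifted from \<open>q\<close>. On each of its four edges unique
  lifting identifies the result; the edges over the fixed end points are constant, hence both lifts
  end at the same configuration.\<close>

lemma lift_homotopy:
  assumes "path_homotopic X p p'" and l: "is_lift p l" and l': "is_lift p' l'"
  obtains H :: "real \<times> real \<Rightarrow> nat \<Rightarrow> complex" where "\<And>i. continuous_on ({0..1} \<times> {0..1}) (\<lambda>s. H s i)"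
    "\<And>s. s \<in> {0..1} \<times> {0..1} \<Longrightarrow> config_ok n (H s)"
    "\<And>t i. t \<in> {0..1} \<Longrightarrow> H (0, t) i = l t i" "\<And>t i. t \<in> {0..1} \<Longrightarrow> H (1, t) i = l' t i"
    "\<And>s i. s \<in> {0..1} \<Longrightarrow> H (s, 0) i = q i" "\<And>s i. s \<in> {0..1} \<Longrightarrow> H (s, 1) i = l 1 i"
    "\<And>i. l' 1 i = l 1 i"
proof -
  obtain h where h: "continuous_map (top_of_set ({0..1} \<times> {0..1})) X h"
    "\<And>s. s \<in> {0..1} \<Longrightarrow> h (0, s) = p s \<and> h (1, s) = p' s \<and> h (s, 0) = p 0 \<and> h (s, 1) = p 1"
    using assms(1) unfolding path_homotopic by blast
  have p0: "config_proj n q = h (0, 0)" using h(2)[of 0] l by (auto simp: is_lift_def)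
  have cS: "convex ({0..1::real} \<times> {0..1::real})" by (intro convex_Times) auto
  obtain H where H: "\<And>i. continuous_on ({0..1} \<times> {0..1}) (\<lambda>s. H s i)"
    "\<And>s. s \<in> {0..1} \<times> {0..1} \<Longrightarrow> config_proj n (H s) = h s"
    "\<And>s. s \<in> {0..1} \<times> {0..1} \<Longrightarrow> config_ok n (H s)" "H (0, 0) = q"
    "\<And>s i. i \<notin> {1..n} \<Longrightarrow> H s i = q i"
    by (rule config_lift[OF cS h(1) _ p0]) auto
  have pr: "kproj (H (s, t) i) = h (s, t) i" if "s \<in> {0..1}" "t \<in> {0..1}" "i \<in> {1..n}" for s t i
    using H(2)[of "(s, t)"] that config_proj_apply[of i n "H (s, t)"] by simp
  have prl: "kproj (l t i) = p t i" "kproj (l' t i) = p' t i" if "t \<in> {0..1}" "i \<in> {1..n}" for t i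
    using that l l' config_proj_apply[of i n "l t"] config_proj_apply[of i n "l' t"] by (auto simp: is_lift_def)
  have ch: "continuous_on {0..1} (\<lambda>t. H (c, t) i)" "continuous_on {0..1} (\<lambda>t. H (t, c) i)" if "c \<in> {0..1}" for c :: real and i
    by (rule continuous_on_compose2[OF H(1)], (use that in \<open>auto intro!: continuous_intros\<close>)[2])+
  have cl: "continuous_on {0..1} (\<lambda>t. l t i)" "continuous_on {0..1} (\<lambda>t. l' t i)" for i
    using l l' by (auto simp: is_lift_def)
  have l0: "l 0 = q" "l' 0 = q" "\<And>t i. i \<notin> {1..n} \<Longrightarrow> l t i = q i" "\<And>t i. i \<notin> {1..n} \<Longrightarrow> l' t i = q i"
    using l l' q0 by (auto simp: is_lift_def)
  have H0: "H (0, t) i = l t i" if t: "t \<in> {0..1}" for t i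
  proof (cases "i \<in> {1..n}")
    case True
    show ?thesis
      by (rule klein_lift_unique[of "{0..1}" "\<lambda>t. H (0, t) i" "\<lambda>t. l t i" 0])
        (use True t pr prl h(2) ch cl H(4) l0 in auto)
  qed (use H(5) l0 in simp)
  have Hs0: "H (s, 0) i = q i" if t: "s \<in> {0..1}" for s i
  proof (cases "i \<in> {1..n}")
    case True
    show ?thesis
      by (rule klein_lift_unique[of "{0..1}" "\<lambda>t. H (t, 0) i" "\<lambda>t. q i" 0])
        (use True t pr prl(1)[of 0] h(2) ch cl H(4) l0 in auto)
  qed (use H(5) in simp)
  have H1: "H (1, t) i = l' t i" if t: "t \<in> {0..1}" for t i
  proof (cases "i \<in> {1..n}")
    case True
    show ?thesis
      by (rule klein_lift_unique[of "{0..1}" "\<lambda>t. H (1, t) i" "\<lambda>t. l' t i" 0])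
        (use True t pr prl h(2) ch cl Hs0 l0 in auto)
  qed (use H(5) l0 in simp)
  have Hs1: "H (s, 1) i = l 1 i" if t: "s \<in> {0..1}" for s i
  proof (cases "i \<in> {1..n}")
    case True
    show ?thesis
      by (rule klein_lift_unique[of "{0..1}" "\<lambda>t. H (t, 1) i" "\<lambda>t. l 1 i" 0])
        (use True t pr prl(1)[of 1] h(2) ch cl H0 l0 in auto)
  qed (use H(5) l0 in simp)
  have "l' 1 i = l 1 i" for i using H1[of 1 i] Hs1[of 1 i] by simp
  then show thesis using that[of H] H(1,3) H0 H1 Hs0 Hs1 by blast
qed

lemma lift_endpoint:
  assumes "p \<in> loops X base" "is_lift p l"
  obtains m k where "\<And>i. l 1 i = act (m i) (k i) (q i)" "\<And>i. i \<notin> {1..n} \<Longrightarrow> m i = 0 \<and> k i = 0"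
proof -
  have "config_proj n (l 1) = config_proj n q" using assms by (auto simp: loops_def is_lift_def)
  then have "\<forall>i. \<exists>mk. i \<in> {1..n} \<longrightarrow> l 1 i = act (fst mk) (snd mk) (q i)"
    by (metis config_proj_eq_iff kproj_eq_iff fst_conv snd_conv)
  then obtain f where f: "\<And>i. i \<in> {1..n} \<Longrightarrow> l 1 i = act (fst (f i)) (snd (f i)) (q i)" by metis
  show thesis
    by (rule that[of "\<lambda>i. if i \<in> {1..n} then fst (f i) else 0" "\<lambda>i. if i \<in> {1..n} then snd (f i) else 0"])
      (use f assms(2) q0 in \<open>auto simp: is_lift_def\<close>)
qed

text \<open>The second lift starts at \<open>q\<close>, not at the end of the first. Each of its
  strings is therefore transported by the deck transformation at which that string of the first lift
  ends.\<close>

lemma is_lift_concat: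
  assumes l: "is_lift p l" and l': "is_lift p' l'"
    and mk: "\<And>i. l 1 i = act (m i) (k i) (q i)" "\<And>i. i \<notin> {1..n} \<Longrightarrow> m i = 0 \<and> k i = 0"
  shows "is_lift (concat_loops p p') (\<lambda>t i. ((\<lambda>t. l t i) +++ (\<lambda>t. act (m i) (k i) (l' t i))) t)"
  unfolding is_lift_def
proof (intro conjI allI ballI impI)
  fix i
  have "path ((\<lambda>t. l t i) +++ (\<lambda>t. act (m i) (k i) (l' t i)))"
    using l l' mk
    by (intro path_join_imp) (auto simp: is_lift_def path_def pathstart_def pathfinish_def intro!: continuous_intros)
  then show "continuous_on {0..1} ((\<lambda>t. l t i) +++ (\<lambda>t. act (m i) (k i) (l' t i)))" by (simp add: path_def)
next
  fix t :: real assume t: "t \<in> {0..1}"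
  have a: "config_ok n (\<lambda>i. act (m i) (k i) (z i)) \<longleftrightarrow> config_ok n z" for z by (simp add: config_ok_def)
  have b: "config_proj n (\<lambda>i. act (m i) (k i) (z i)) = config_proj n z" for z by (simp add: config_proj_eq_iff)
  show "config_proj n (\<lambda>i. ((\<lambda>t. l t i) +++ (\<lambda>t. act (m i) (k i) (l' t i))) t) = concat_loops p p' t"
    using l l' t by (simp add: joinpaths_def concat_loops_def is_lift_def b)
  show "config_ok n (\<lambda>i. ((\<lambda>t. l t i) +++ (\<lambda>t. act (m i) (k i) (l' t i))) t)"
    using l l' t by (cases "t * 2 \<le> 1") (simp_all add: joinpaths_def is_lift_def a)
next
  show "(\<lambda>i. ((\<lambda>t. l t i) +++ (\<lambda>t. act (m i) (k i) (l' t i))) 0) = q"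
    using l by (simp add: joinpaths_def is_lift_def)
  show "((\<lambda>t. l t i) +++ (\<lambda>t. act (m i) (k i) (l' t i))) t = 0" if "i \<notin> {1..n}" for t i
    using l l' that mk by (simp add: joinpaths_def is_lift_def)
qed

text \<open>The vertical exponent of the deck transformation at the end of string \<open>i\<close>;
  its parity tells whether the string reverses the orientation. The description is unique because,
  by \<open>lift_homotopy\<close>, the end of a lift depends only on the class of the loop.\<close>

definition wnd :: "nat \<Rightarrow> (real \<Rightarrow> nat \<Rightarrow> (real \<times> real) set) set \<Rightarrow> int" where
  "wnd i A = (THE d. \<exists>p l. p \<in> loops X base \<and> A = loop_class X base p \<and> is_lift p l \<and> Im (l 1 i) = Im (q i) + of_int d)"

lemma wnd_eq:
  assumes p: "p \<in> loops X base" and l: "is_lift p l" and d: "Im (l 1 i) = Im (q i) + of_int d"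
  shows "wnd i (loop_class X base p) = d"
  unfolding wnd_def
proof (rule the_equality)
  show "\<exists>p' l. p' \<in> loops X base \<and> loop_class X base p = loop_class X base p' \<and> is_lift p' l \<and> Im (l 1 i) = Im (q i) + of_int d"
    using assms by blast
  fix d' assume "\<exists>p' l. p' \<in> loops X base \<and> loop_class X base p = loop_class X base p' \<and> is_lift p' l \<and> Im (l 1 i) = Im (q i) + of_int d'"
  then obtain p' l' where *: "p' \<in> loops X base" "loop_class X base p = loop_class X base p'" "is_lift p' l'"
    "Im (l' 1 i) = Im (q i) + of_int d'" by blast
  then have "path_homotopic X p p'" by (intro loop_class_eqD)
  from lift_homotopy[OF this l *(3)] have "l' 1 i = l 1 i" by metis
  then show "d' = d" using * d by simp
qed

lemma wnd_act:
  assumes "p \<in> loops X base" "is_lift p l" "l 1 i = act m k (q i)"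
  shows "wnd i (loop_class X base p) = k"
  using assms by (intro wnd_eq) auto

text \<open>By \<open>act_act\<close> the vertical exponents add up, while the horizontal ones are
  twisted by a sign.\<close>

lemma wnd_mult:
  assumes "A \<in> carrier G" "B \<in> carrier G"
  shows "wnd i (A \<otimes>\<^bsub>G\<^esub> B) = wnd i A + wnd i B"
proof -
  obtain p where p: "p \<in> loops X base" "A = loop_class X base p" using assms(1) by (rule carrier_fundamental_groupE)
  obtain p' where p': "p' \<in> loops X base" "B = loop_class X base p'" using assms(2) by (rule carrier_fundamental_groupE)
  obtain l where l: "is_lift p l" using lift_exists[OF p(1)] .
  obtain l' where l': "is_lift p' l'" using lift_exists[OF p'(1)] .
  obtain m k where mk: "\<And>i. l 1 i = act (m i) (k i) (q i)" "\<And>i. i \<notin> {1..n} \<Longrightarrow> m i = 0 \<and> k i = 0"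
    by (rule lift_endpoint[OF p(1) l]) blast
  obtain m' k' where mk': "\<And>i. l' 1 i = act (m' i) (k' i) (q i)"
    by (rule lift_endpoint[OF p'(1) l']) blast
  have "wnd i (loop_class X base (concat_loops p p')) = k i + k' i"
    by (rule wnd_act[OF concat_in_loops[OF p(1) p'(1)] is_lift_concat[OF l l' mk]])
      (simp_all add: joinpaths_def mk' act_act)
  then show ?thesis
    using p p' wnd_act[OF p(1) l mk(1)] wnd_act[OF p'(1) l' mk'(1)] by (simp add: mult_loop_class)
qed

section \<open>Loops that move a single string, and the central braid\<close>

lemma one_strand_loop:
  assumes i: "i \<in> {1..n}" and \<gamma>: "path \<gamma>" "pathstart \<gamma> = q i" "kproj (pathfinish \<gamma>) = kproj (q i)"
    and D: "\<And>t j. t \<in> {0..1} \<Longrightarrow> j \<in> {1..n} - {i} \<Longrightarrow> kproj (\<gamma> t) \<noteq> kproj (q j)"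
  shows "(\<lambda>t. config_proj n (q(i := \<gamma> t))) \<in> loops X base"
    and "is_lift (\<lambda>t. config_proj n (q(i := \<gamma> t))) (\<lambda>t. q(i := \<gamma> t))"
proof -
  have ok: "config_ok n (q(i := \<gamma> t))" if "t \<in> {0..1}" for t
    using D[OF that] q by (intro config_ok_fun_upd) auto
  show "is_lift (\<lambda>t. config_proj n (q(i := \<gamma> t))) (\<lambda>t. q(i := \<gamma> t))"
    unfolding is_lift_def
    using ok \<gamma> q0 i continuous_on_config_fun_upd[of "{0..1}" \<gamma> q i] by (auto simp: path_def pathstart_def)
  have "continuous_map (top_of_set {0..1}) X (\<lambda>t. config_proj n (q(i := \<gamma> t)))"
    by (rule continuous_map_config_proj) (use ok \<gamma> continuous_on_config_fun_upd in \<open>auto simp: path_def\<close>)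
  moreover have "config_proj n (q(i := \<gamma> 0)) = base" "config_proj n (q(i := \<gamma> 1)) = base"
    using \<gamma> by (auto simp: config_proj_eq_iff pathstart_def pathfinish_def)
  ultimately show "(\<lambda>t. config_proj n (q(i := \<gamma> t))) \<in> loops X base"
    by (simp add: loops_def pathin_def)
qed

lemma obstacles_eq: "{w. \<exists>j\<in>J. kproj w = kproj (z j)} = (\<Union>j\<in>J. {w. kproj w = kproj (z j)})"
  by auto

lemma countable_obstacles: "countable J \<Longrightarrow> countable {w. \<exists>j\<in>J. kproj w = kproj (z j)}"
  unfolding obstacles_eq by (intro countable_UN countable_orbit)

lemma closed_obstacles: "finite J \<Longrightarrow> closed {w. \<exists>j\<in>J. kproj w = kproj (z j)}"
  unfolding obstacles_eq by (intro closed_UN ballI closed_orbit)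

text \<open>Orbits are countable, and the plane minus a countable set is path connected. This takes
  the place of a general position argument.\<close>

lemma path_avoiding_obstacles:
  assumes "countable J" "\<And>j. j \<in> J \<Longrightarrow> kproj u \<noteq> kproj (z j)" "\<And>j. j \<in> J \<Longrightarrow> kproj v \<noteq> kproj (z j)"
  obtains \<gamma> where "path \<gamma>" "pathstart \<gamma> = u" "pathfinish \<gamma> = v"
    "\<And>t j. t \<in> {0..1} \<Longrightarrow> j \<in> J \<Longrightarrow> kproj (\<gamma> t) \<noteq> kproj (z j)"
proof -
  have "path_connected (- {w. \<exists>j\<in>J. kproj w = kproj (z j)})"
    by (rule path_connected_complement_countable) (simp_all add: countable_obstacles assms(1))
  then obtain \<gamma> where "path \<gamma>" "path_image \<gamma> \<subseteq> - {w. \<exists>j\<in>J. kproj w = kproj (z j)}" "pathstart \<gamma> = u" "pathfinish \<gamma> = v"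
    unfolding path_connected_def using assms(2,3) by blast
  moreover from this(2) have "kproj (\<gamma> t) \<noteq> kproj (z j)" if "t \<in> {0..1}" "j \<in> J" for t j
    using that unfolding path_image_def by blast
  ultimately show thesis by (intro that)
qed

text \<open>\<open>wnd\<close> sees only the end of the lift, so any path from \<open>q i\<close> to
  \<open>act 0 1 (q i)\<close> that avoids the other orbits will do.\<close>

lemma generator:
  assumes i: "i \<in> {1..n}"
  obtains B where "B \<in> carrier G" "\<And>j. wnd j B = (if j = i then 1 else 0)"
proof -
  have 1: "kproj (q i) \<noteq> kproj (q j)" "kproj (act 0 1 (q i)) \<noteq> kproj (q j)" if "j \<in> {1..n} - {i}" for j
    using config_okD[OF q i, of j] that by simp_all
  obtain \<gamma> where \<gamma>: "path \<gamma>" "pathstart \<gamma> = q i" "pathfinish \<gamma> = act 0 1 (q i)"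
    "\<And>t j. t \<in> {0..1} \<Longrightarrow> j \<in> {1..n} - {i} \<Longrightarrow> kproj (\<gamma> t) \<noteq> kproj (q j)"
    by (rule path_avoiding_obstacles[of "{1..n} - {i}" "q i" q "act 0 1 (q i)"]) (use 1 in auto)
  have "kproj (pathfinish \<gamma>) = kproj (q i)" using \<gamma>(3) by simp
  then have L: "(\<lambda>t. config_proj n (q(i := \<gamma> t))) \<in> loops X base"
    "is_lift (\<lambda>t. config_proj n (q(i := \<gamma> t))) (\<lambda>t. q(i := \<gamma> t))"
    using one_strand_loop[OF i \<gamma>(1,2)] \<gamma>(4) by blast+
  have "wnd j (loop_class X base (\<lambda>t. config_proj n (q(i := \<gamma> t)))) = (if j = i then 1 else 0)" for j
    using wnd_act[OF L, of j 0 "if j = i then 1 else 0"] \<gamma>(3) by (simp add: pathfinish_def)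
  then show thesis by (rule that[OF loop_class_in_carrier[OF L(1)]])
qed

text \<open>The loop that moves all strings simultaneously once around the orbits of the circle action
  given by vertical translation.\<close>

lemma central_element:
  obtains Z where "Z \<in> carrier G" "\<And>A. A \<in> carrier G \<Longrightarrow> Z \<otimes>\<^bsub>G\<^esub> A = A \<otimes>\<^bsub>G\<^esub> Z"
    "\<And>i. i \<in> {1..n} \<Longrightarrow> wnd i Z = 2"
proof -
  define up :: "real \<Rightarrow> (nat \<Rightarrow> complex) \<Rightarrow> nat \<Rightarrow> complex"
    where "up s z = (\<lambda>i. if i \<in> {1..n} then z i + \<i> * of_real s else 0)" for s z
  have up_ok: "config_ok n (up s z) \<longleftrightarrow> config_ok n z" for s z
    by (simp add: config_ok_def up_def inj_on_def)
  have up_proj: "config_proj n (up s z) = config_proj n (up s w)" if "config_proj n z = config_proj n w" for s z w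
    using that by (simp add: config_proj_eq_iff up_def)
  have up_0: "config_proj n (up 0 z) = config_proj n z" for z by (simp add: config_proj_eq_iff up_def)
  \<comment> \<open>Time 2 is where the winding number 2 comes from: translation by 1 induces a
    reflection of the Klein bottle, and only translation by 2 is the deck transformation
    \<open>act 0 2\<close>.\<close>
  have up_2: "config_proj n (up 2 z) = config_proj n z" for z
  proof -
    have "up 2 z i = act 0 2 (z i)" if "i \<in> {1..n}" for i using that by (simp add: up_def complex_eq_iff)
    then show ?thesis by (simp add: config_proj_eq_iff)
  qed
  define \<zeta> where "\<zeta> = (\<lambda>t. config_proj n (up (2 * t) q))"
  have cont: "continuous_on S (\<lambda>x. up (2 * f x) (g x) i)"
    if "continuous_on S f" "continuous_on S (\<lambda>x. g x i)" for i and S :: "'b :: topological_space set" and f g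
    using that by (cases "i \<in> {1..n}") (auto simp: up_def simp del: atLeastAtMost_iff intro!: continuous_intros)
  have lift: "is_lift \<zeta> (\<lambda>t. up (2 * t) q)"
  proof -
    have "up 0 q = q" using q0 by (auto simp: up_def)
    moreover have "continuous_on {0..1} (\<lambda>t. up (2 * t) q i)" for i by (intro cont continuous_intros)
    moreover have "up s q i = 0" if "i \<notin> {1..n}" for s i unfolding up_def using that by (rule if_not_P)
    ultimately show ?thesis unfolding is_lift_def \<zeta>_def by (simp add: up_ok q)
  qed
  have loop: "\<zeta> \<in> loops X base"
  proof -
    have "continuous_map (top_of_set {0..1}) X (\<lambda>t. config_proj n (up (2 * t) q))"
      by (intro continuous_map_config_proj cont continuous_intros) (simp add: up_ok q)
    then show ?thesis by (simp add: loops_def pathin_def \<zeta>_def up_0 up_2)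
  qed
  show thesis
  proof
    show "loop_class X base \<zeta> \<in> carrier G" by (rule loop_class_in_carrier[OF loop])
    show "wnd i (loop_class X base \<zeta>) = 2" if "i \<in> {1..n}" for i
      by (rule wnd_act[OF loop lift, of _ 0]) (use that in \<open>simp add: up_def complex_eq_iff\<close>)
    fix A assume "A \<in> carrier G"
    then obtain p where p: "p \<in> loops X base" "A = loop_class X base p" by (rule carrier_fundamental_groupE)
    obtain l where l: "is_lift p l" using lift_exists[OF p(1)] .
    let ?S = "{0..1::real} \<times> {0..1::real}"
    \<comment> \<open>The first coordinate is the time of the flow, the second one the time of
      \<open>p\<close>. The two concatenations are the two ways around the square from (0, 0) to (1,
      1).\<close>
    define F where "F = (\<lambda>x. config_proj n (up (2 * fst x) (l (snd x))))"
    have "continuous_map (top_of_set ?S) X F"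
      unfolding F_def
    proof (rule continuous_map_config_proj)
      show "continuous_on ?S (\<lambda>x. up (2 * fst x) (l (snd x)) i)" for i
      proof (rule cont)
        show "continuous_on ?S (\<lambda>x. l (snd x) i)"
          by (rule continuous_on_compose2[of "{0..1}" "\<lambda>t. l t i"])
            (use l in \<open>auto simp: is_lift_def intro!: continuous_intros\<close>)
      qed (intro continuous_intros)
      show "config_ok n (up (2 * fst x) (l (snd x)))" if "x \<in> ?S" for x
        using l that by (auto simp: up_ok is_lift_def)
    qed
    have l0: "l 0 = q" and l1: "config_proj n (l 1) = base" and lp: "\<And>t. t \<in> {0..1} \<Longrightarrow> config_proj n (l t) = p t"
      using l p by (auto simp: is_lift_def loops_def)
    have "path_homotopic X (concat_loops \<zeta> p) (concat_loops p \<zeta>)"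
    proof (rule path_homotopic_convex[OF _ \<open>continuous_map (top_of_set ?S) X F\<close>])
      show "convex ?S" by (intro convex_Times) auto
      show "continuous_on {0..1} (\<lambda>t::real. (min 1 (2 * t), max 0 (2 * t - 1)))"
        "continuous_on {0..1} (\<lambda>t::real. (max 0 (2 * t - 1), min 1 (2 * t)))"
        by (intro continuous_intros)+
      fix t :: real assume t: "t \<in> {0..1}"
      show "concat_loops \<zeta> p t = F (min 1 (2 * t), max 0 (2 * t - 1))"
      proof (cases "t \<le> 1/2")
        case True
        then have "min 1 (2 * t) = 2 * t" "max 0 (2 * t - 1) = 0" by auto
        with True show ?thesis by (simp add: F_def concat_loops_def \<zeta>_def l0)
      next
        case False
        then have "min 1 (2 * t) = 1" "max 0 (2 * t - 1) = 2 * t - 1" by auto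
        with False t lp show ?thesis by (simp add: F_def concat_loops_def up_2)
      qed
      show "concat_loops p \<zeta> t = F (max 0 (2 * t - 1), min 1 (2 * t))"
      proof (cases "t \<le> 1/2")
        case True
        then have "min 1 (2 * t) = 2 * t" "max 0 (2 * t - 1) = 0" by auto
        with True t lp show ?thesis by (simp add: F_def concat_loops_def up_0)
      next
        case False
        then have "min 1 (2 * t) = 1" "max 0 (2 * t - 1) = 2 * t - 1" by auto
        with False up_proj[OF l1] show ?thesis by (simp add: F_def concat_loops_def \<zeta>_def)
      qed
    qed auto
    then show "loop_class X base \<zeta> \<otimes>\<^bsub>G\<^esub> A = A \<otimes>\<^bsub>G\<^esub> loop_class X base \<zeta>"
      using p loop by (simp add: mult_loop_class concat_in_loops loop_class_eqI)
  qed
qed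

text \<open>If \<open>u\<close> lies on the orbit of \<open>z j\<close>, the other points of this
  orbit have distance at least 1, hence the bound on \<open>e\<close>. The remaining orbits form a
  closed set that misses \<open>u\<close>.\<close>

lemma punctured_ball_avoiding_obstacles:
  assumes "finite J" "\<And>k. k \<in> J - {j} \<Longrightarrow> kproj u \<noteq> kproj (z k)" "j \<in> J \<Longrightarrow> kproj u = kproj (z j)"
  obtains e where "0 < e" "e \<le> 1" "\<And>w k. dist w u < e \<Longrightarrow> w \<noteq> u \<Longrightarrow> k \<in> J \<Longrightarrow> kproj w \<noteq> kproj (z k)"
proof -
  have "open (- {w. \<exists>k\<in>J - {j}. kproj w = kproj (z k)})"
    using closed_obstacles[of "J - {j}" z] assms(1) by (simp add: open_Compl)
  then obtain e where e: "e > 0" "\<And>w. dist w u < e \<Longrightarrow> w \<in> - {w. \<exists>k\<in>J - {j}. kproj w = kproj (z k)}"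
    unfolding open_dist using assms(2) by blast
  show thesis
  proof (rule that[of "min e 1"])
    fix w k assume w: "dist w u < min e 1" "w \<noteq> u" "k \<in> J"
    show "kproj w \<noteq> kproj (z k)"
    proof (cases "k = j")
      case True
      then show ?thesis using kproj_separated[of w u] w assms(3) by force
    next
      case False
      then show ?thesis using e(2)[of w] w by simp
    qed
  qed (use e in auto)
qed

lemma winding_number_conjugate:
  assumes "path \<alpha>" "path \<kappa>" "pathfinish \<alpha> = pathstart \<kappa>" "pathfinish \<kappa> = pathstart \<kappa>"
    "\<zeta> \<notin> path_image \<alpha>" "\<zeta> \<notin> path_image \<kappa>"
  shows "winding_number (\<alpha> +++ \<kappa> +++ reversepath \<alpha>) \<zeta> = winding_number \<kappa> \<zeta>"
  using assms by (simp add: winding_number_join winding_number_reversepath path_image_join)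

text \<open>Moving string \<open>i\<close> to a small circle around string \<open>j\<close> and back gives a loop whose lift winds
  once around the lift of \<open>j\<close>. If a loop commutes with it, then the lift that starts at the endpoint
  of the lift of that loop does so as well, and this forces string \<open>i\<close> and \<open>j\<close> to be displaced by the
  same deck transformation.\<close>

lemma central_imp_wnd_eq:
  assumes c: "c \<in> carrier G" "\<And>A. A \<in> carrier G \<Longrightarrow> c \<otimes>\<^bsub>G\<^esub> A = A \<otimes>\<^bsub>G\<^esub> c"
    and i: "i \<in> {1..n}" and j: "j \<in> {1..n}"
  shows "wnd i c = wnd j c"
proof (rule ccontr)
  assume neq: "wnd i c \<noteq> wnd j c"
  then have ij: "i \<noteq> j" by auto
  obtain p where p: "p \<in> loops X base" "c = loop_class X base p" using c(1) by (rule carrier_fundamental_groupE)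
  obtain l where l: "is_lift p l" using lift_exists[OF p(1)] .
  obtain m k where mk: "\<And>i. l 1 i = act (m i) (k i) (q i)" "\<And>i. i \<notin> {1..n} \<Longrightarrow> m i = 0 \<and> k i = 0"
    by (rule lift_endpoint[OF p(1) l]) blast
  have kij: "k i \<noteq> k j" using neq wnd_act[OF p(1) l mk(1)] p(2) by simp
  let ?J = "{1..n} - {i}"
  have qq: "kproj (q a) \<noteq> kproj (q b)" if "a \<in> {1..n}" "b \<in> {1..n}" "a \<noteq> b" for a b
    using config_okD[OF q that] .
  obtain e where e: "0 < e" "e \<le> 1" "\<And>w k. dist w (q j) < e \<Longrightarrow> w \<noteq> q j \<Longrightarrow> k \<in> ?J \<Longrightarrow> kproj w \<noteq> kproj (q k)"
    by (rule punctured_ball_avoiding_obstacles[of ?J j "q j" q]) (use qq[OF j] in auto)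
  \<comment> \<open>The circle of radius \<open>r\<close> lies in the punctured ball, and
    \<open>e \<le> 1\<close> makes \<open>r\<close> smaller than the distance of two points of one
    orbit.\<close>
  define r where "r = e / 2"
  have r: "0 < r" "r < e" using e by (auto simp: r_def)
  define \<kappa> where "\<kappa> = circlepath (q j) r"
  have \<kappa>: "path \<kappa>" "pathstart \<kappa> = q j + r" "pathfinish \<kappa> = q j + r" "path_image \<kappa> = sphere (q j) r"
    using r by (simp_all add: \<kappa>_def)
  have on_sphere: "kproj w \<noteq> kproj (q b)" if "w \<in> sphere (q j) r" "b \<in> ?J" for w b
    using that r by (intro e(3)) (auto simp: dist_commute)
  obtain \<alpha> where \<alpha>: "path \<alpha>" "pathstart \<alpha> = q i" "pathfinish \<alpha> = q j + r"
    "\<And>t b. t \<in> {0..1} \<Longrightarrow> b \<in> ?J \<Longrightarrow> kproj (\<alpha> t) \<noteq> kproj (q b)"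
    by (rule path_avoiding_obstacles[of ?J "q i" q "q j + r"])
      (use qq[OF i] on_sphere[of "q j + r"] r in \<open>auto simp: dist_norm\<close>)
  define \<gamma> where "\<gamma> = \<alpha> +++ \<kappa> +++ reversepath \<alpha>"
  have \<gamma>: "path \<gamma>" "pathstart \<gamma> = q i" "kproj (pathfinish \<gamma>) = kproj (q i)" "pathfinish \<gamma> = q i"
    by (simp_all add: \<gamma>_def \<alpha>(1-3) \<kappa>(1-3))
  have \<gamma>im: "path_image \<gamma> = path_image \<alpha> \<union> sphere (q j) r"
  proof -
    have "path_image \<gamma> = path_image \<alpha> \<union> (path_image \<kappa> \<union> path_image \<alpha>)"
      unfolding \<gamma>_def by (simp add: path_image_join \<alpha>(3) \<kappa>(2,3))
    then show ?thesis using \<kappa>(4) by blast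
  qed
  have avoid: "kproj w \<noteq> kproj (q b)" if "w \<in> path_image \<gamma>" "b \<in> ?J" for w b
  proof (cases "w \<in> sphere (q j) r")
    case False
    then have "w \<in> path_image \<alpha>" using that(1) \<gamma>im by blast
    then obtain t where "t \<in> {0..1}" "w = \<alpha> t" by (auto simp: path_image_def)
    then show ?thesis using \<alpha>(4) that(2) by simp
  qed (rule on_sphere[OF _ that(2)])
  then have avoid': "kproj (\<gamma> t) \<noteq> kproj (q b)" if "t \<in> {0..1}" "b \<in> ?J" for t b
    using that by (simp add: path_image_def)
  define a where "a = (\<lambda>t. config_proj n (q(i := \<gamma> t)))"
  have A: "a \<in> loops X base" "is_lift a (\<lambda>t. q(i := \<gamma> t))"
    unfolding a_def using one_strand_loop[OF i \<gamma>(1-3)] avoid' by blast+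
  have "loop_class X base (concat_loops a p) = loop_class X base (concat_loops p a)"
    using c(2)[OF loop_class_in_carrier[OF A(1)]] p A(1) by (simp add: mult_loop_class)
  then have hom: "path_homotopic X (concat_loops a p) (concat_loops p a)"
    by (rule loop_class_eqD[OF _ concat_in_loops[OF p(1) A(1)]])
  \<comment> \<open>Lifts of the two products. The lift of \<open>a\<close> is closed, so
    \<open>l\<close> follows it unchanged; after \<open>l\<close>, each string of \<open>a\<close>
    is transported by its own deck transformation.\<close>
  define L1 where "L1 = (\<lambda>t b. ((\<lambda>t. (q(i := \<gamma> t)) b) +++ (\<lambda>t. act 0 0 (l t b))) t)"
  define L2 where "L2 = (\<lambda>t b. ((\<lambda>t. l t b) +++ (\<lambda>t. act (m b) (k b) ((q(i := \<gamma> t)) b))) t)"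
  have L1: "is_lift (concat_loops a p) L1"
    unfolding L1_def by (rule is_lift_concat[OF A(2) l, of "\<lambda>_. 0" "\<lambda>_. 0"]) (use \<gamma>(4) in \<open>auto simp: pathfinish_def\<close>)
  have L2: "is_lift (concat_loops p a) L2" unfolding L2_def by (rule is_lift_concat[OF l A(2) mk]) blast
  obtain H :: "real \<times> real \<Rightarrow> nat \<Rightarrow> complex" where H: "\<And>i. continuous_on ({0..1} \<times> {0..1}) (\<lambda>s. H s i)"
    "\<And>s. s \<in> {0..1} \<times> {0..1} \<Longrightarrow> config_ok n (H s)"
    "\<And>t i. t \<in> {0..1} \<Longrightarrow> H (0, t) i = L1 t i" "\<And>t i. t \<in> {0..1} \<Longrightarrow> H (1, t) i = L2 t i"
    "\<And>s i. s \<in> {0..1} \<Longrightarrow> H (s, 0) i = q i" "\<And>s i. s \<in> {0..1} \<Longrightarrow> H (s, 1) i = L1 1 i"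
    "\<And>i. L2 1 i = L1 1 i"
    by (rule lift_homotopy[OF hom L1 L2]) blast
  \<comment> \<open>The difference of strings \<open>i\<close> and \<open>j\<close> never vanishes,
    so the homotopy of braids yields one in the punctured plane. The part \<open>d\<close> occurs in
    both products and cancels from the winding numbers.\<close>
  define d where "d = (\<lambda>t. l t i - l t j)"
  have lc: "continuous_on {0..1} (\<lambda>t. l t b)" for b using l by (simp add: is_lift_def)
  then have d: "path d" unfolding d_def path_def by (intro continuous_intros)
  have d0: "0 \<notin> path_image d"
  proof
    assume "0 \<in> path_image d"
    then obtain t where t: "t \<in> {0..1}" "l t i = l t j" by (auto simp: path_image_def d_def)
    then have "config_ok n (l t)" using l by (simp add: is_lift_def)
    then show False using config_okD[OF _ i j ij, of "l t"] t by simp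
  qed
  let ?g1 = "\<lambda>t. \<gamma> t - q j" and ?g2 = "\<lambda>t. act (m i) (k i) (\<gamma> t) - act (m j) (k j) (q j)"
  have eq1: "L1 t i - L1 t j = (?g1 +++ d) t" and eq2: "L2 t i - L2 t j = (d +++ ?g2) t" for t
    using ij by (simp_all add: L1_def L2_def joinpaths_def d_def)
  have "homotopic_paths (- {0}) (?g1 +++ d) (d +++ ?g2)"
    unfolding homotopic_paths
  proof (intro exI[of _ "\<lambda>s. H s i - H s j"] conjI ballI)
    show "continuous_on ({0..1} \<times> {0..1}) (\<lambda>s. H s i - H s j)" by (intro continuous_intros H)
    show "(\<lambda>s. H s i - H s j) \<in> {0..1} \<times> {0..1} \<rightarrow> - {0}"
    proof (rule Pi_I)
      fix s assume "s \<in> {0..1::real} \<times> {0..1::real}"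
      then have "kproj (H s i) \<noteq> kproj (H s j)" by (rule config_okD[OF H(2) i j ij])
      then show "H s i - H s j \<in> - {0}" by auto
    qed
    show e0: "H (0, t) i - H (0, t) j = (?g1 +++ d) t" if "t \<in> {0..1}" for t
      by (simp only: H(3)[OF that] eq1)
    show "H (1, t) i - H (1, t) j = (d +++ ?g2) t" if "t \<in> {0..1}" for t
      by (simp only: H(4)[OF that] eq2)
    fix t :: real assume t: "t \<in> {0..1}"
    show "pathstart ((\<lambda>s. H s i - H s j) \<circ> Pair t) = pathstart (?g1 +++ d)"
      using e0[of 0] H(5)[OF t] H(5)[of 0] by (simp add: pathstart_def)
    show "pathfinish ((\<lambda>s. H s i - H s j) \<circ> Pair t) = pathfinish (?g1 +++ d)"
      unfolding pathfinish_def o_def by (simp only: H(6)[OF t] eq1)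
  qed
  then have wn: "winding_number (?g1 +++ d) 0 = winding_number (d +++ ?g2) 0"
    by (rule winding_number_homotopic_paths)
  have pg: "path ?g1" "path ?g2" using \<gamma>(1) by (auto simp: path_def intro!: continuous_intros)
  have g1: "0 \<notin> path_image ?g1" and g2: "0 \<notin> path_image ?g2"
  proof -
    show "0 \<notin> path_image ?g1" using avoid'[of _ j] j ij by (fastforce simp: path_image_def)
    show "0 \<notin> path_image ?g2"
    proof
      assume "0 \<in> path_image ?g2"
      then obtain t where "t \<in> {0..1}" "act (m i) (k i) (\<gamma> t) = act (m j) (k j) (q j)"
        by (auto simp: path_image_def)
      then have "kproj (\<gamma> t) = kproj (q j)" by (metis kproj_act)
      then show False using avoid'[OF \<open>t \<in> {0..1}\<close>, of j] j ij by simp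
    qed
  qed
  have ends: "pathfinish ?g1 = pathstart d" "pathfinish d = pathstart ?g2"
    using \<gamma> l mk by (simp_all add: pathfinish_def pathstart_def d_def is_lift_def)
  have "winding_number ?g1 0 = winding_number ?g2 0"
    using wn by (simp add: winding_number_join pg d g1 g2 d0 ends)
  moreover have "winding_number ?g1 0 = 1"
  proof -
    have qj: "q j \<notin> path_image \<alpha>" using \<alpha>(4)[of _ j] j ij by (fastforce simp: path_image_def)
    have "winding_number \<gamma> (q j) = winding_number \<kappa> (q j)"
      unfolding \<gamma>_def by (rule winding_number_conjugate) (use r qj in \<open>simp_all add: \<alpha>(1-3) \<kappa>\<close>)
    also have "\<dots> = 1" unfolding \<kappa>_def by (rule winding_number_circlepath_centre[OF r(1)])
    finally show ?thesis using winding_number_offset[of \<gamma> "q j"] by simp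
  qed
  moreover have "winding_number ?g2 0 = 0"
  proof -
    let ?f = "act (m i) (k i)" and ?\<zeta> = "act (m j) (k j) (q j)"
    have f: "?f \<circ> \<gamma> = (?f \<circ> \<alpha>) +++ (?f \<circ> \<kappa>) +++ reversepath (?f \<circ> \<alpha>)"
      by (simp add: \<gamma>_def path_compose_join path_compose_reversepath)
    have "continuous_on S ?f" for S by (intro continuous_intros)
    then have pf: "path (?f \<circ> \<alpha>)" "path (?f \<circ> \<kappa>)"
      using \<alpha>(1) \<kappa>(1) by (auto intro: path_continuous_image)
    have out: "?\<zeta> \<notin> ?f ` path_image \<gamma>"
    proof
      assume "?\<zeta> \<in> ?f ` path_image \<gamma>"
      then obtain w where "w \<in> path_image \<gamma>" "?f w = ?\<zeta>" by auto
      moreover from this(2) have "kproj w = kproj (q j)" by (metis kproj_act)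
      ultimately show False using avoid[of w j] j ij by simp
    qed
    \<comment> \<open>As \<open>k i \<noteq> k j\<close>, the transported circle surrounds another
      point of the orbit of \<open>?\<zeta>\<close>. This point has distance at least 1 from
      \<open>?\<zeta>\<close>, which is more than the radius.\<close>
    have "?f (q j) \<noteq> ?\<zeta>" using kij by (auto simp: complex_eq_iff)
    then have "1 \<le> dist (?f (q j)) ?\<zeta>" by (intro kproj_separated) simp_all
    then have \<zeta>: "?\<zeta> \<notin> cball (?f (q j)) r" using r e by simp
    have sub: "path_image (?f \<circ> \<kappa>) \<subseteq> cball (?f (q j)) r"
      using \<kappa>(4) by (auto simp: path_image_compose)
    have "winding_number (?f \<circ> \<gamma>) ?\<zeta> = winding_number (?f \<circ> \<kappa>) ?\<zeta>"
      unfolding f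
      by (rule winding_number_conjugate)
        (use out in \<open>simp_all add: pf pathstart_compose pathfinish_compose path_image_compose \<gamma>im image_Un \<alpha>(1-3) \<kappa>\<close>)
    also have "\<dots> = 0"
      by (rule winding_number_zero_outside[OF pf(2) convex_cball _ \<zeta> sub]) (simp add: pathstart_compose pathfinish_compose \<kappa>)
    finally show ?thesis using winding_number_offset[of "?f \<circ> \<gamma>" ?\<zeta>] by (simp add: o_def)
  qed
  ultimately show False by simp
qed

end

section \<open>Homotopy invariant additive functionals on paths\<close>

text \<open>If \<open>L\<close> gives the path integrals of a 1-form, then \<psi> is a primitive of
  it.\<close>

definition potential_on :: "'a::topological_space set \<Rightarrow> ((real \<Rightarrow> 'a) \<Rightarrow> real) \<Rightarrow> ('a \<Rightarrow> real) \<Rightarrow> bool" where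
  "potential_on V L \<psi> \<longleftrightarrow>
     (\<forall>p. path p \<longrightarrow> path_image p \<subseteq> V \<longrightarrow> L p = \<psi> (pathfinish p) - \<psi> (pathstart p))"

definition exact_on :: "'a::topological_space set \<Rightarrow> ((real \<Rightarrow> 'a) \<Rightarrow> real) \<Rightarrow> bool" where
  "exact_on V L \<longleftrightarrow> (\<exists>\<psi>. potential_on V L \<psi>)"

lemma potential_onD:
  "potential_on V L \<psi> \<Longrightarrow> path p \<Longrightarrow> path_image p \<subseteq> V \<Longrightarrow> L p = \<psi> (pathfinish p) - \<psi> (pathstart p)"
  by (simp add: potential_on_def)

lemma potential_on_subset: "potential_on V L \<psi> \<Longrightarrow> W \<subseteq> V \<Longrightarrow> potential_on W L \<psi>"
  by (auto simp: potential_on_def)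

lemma exact_on_subset: "exact_on V L \<Longrightarrow> W \<subseteq> V \<Longrightarrow> exact_on W L"
  unfolding exact_on_def using potential_on_subset by blast

lemma exact_onE:
  assumes "exact_on V L" obtains \<psi> where "potential_on V L \<psi>"
  using assms by (auto simp: exact_on_def)

lemma potentials_differ_by_const:
  assumes "path_connected V" "potential_on V L \<psi>" "potential_on V L \<phi>" "a \<in> V" "b \<in> V"
  shows "\<psi> b - \<phi> b = \<psi> a - \<phi> a"
proof -
  obtain p where "path p" "path_image p \<subseteq> V" "pathstart p = a" "pathfinish p = b"
    using assms unfolding path_connected_def by blast
  then show ?thesis using potential_onD[OF assms(2)] potential_onD[OF assms(3)] by fastforce
qed

text \<open>A closed 1-form on \<open>U\<close>, represented by its path integrals.\<close>

locale path_functional =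
  fixes U :: "'a::topological_space set" and L :: "(real \<Rightarrow> 'a) \<Rightarrow> real"
  assumes homotopic: "homotopic_paths U p q \<Longrightarrow> L p = L q"
    and join: "path p \<Longrightarrow> path q \<Longrightarrow> path_image p \<subseteq> U \<Longrightarrow> path_image q \<subseteq> U \<Longrightarrow>
      pathfinish p = pathstart q \<Longrightarrow> L (p +++ q) = L p + L q"
begin

lemma cong: "path p \<Longrightarrow> path_image p \<subseteq> U \<Longrightarrow> (\<And>t. t \<in> {0..1} \<Longrightarrow> p t = q t) \<Longrightarrow> L p = L q"
  by (rule homotopic, rule homotopic_paths_eq)

lemma pullback:
  assumes "continuous_on V F" "F \<in> V \<rightarrow> U"
  shows "path_functional V (\<lambda>p. L (F \<circ> p))"
proof
  show "L (F \<circ> p) = L (F \<circ> q)" if "homotopic_paths V p q" for p q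
    by (rule homotopic, rule homotopic_paths_continuous_image[OF that]) (use assms in auto)
  fix p q assume *: "path p" "path q" "path_image p \<subseteq> V" "path_image q \<subseteq> V" "pathfinish p = pathstart q"
  then have "path (F \<circ> p)" "path (F \<circ> q)"
    using assms(1) continuous_on_subset path_continuous_image by blast+
  moreover have "path_image (F \<circ> p) \<subseteq> U" "path_image (F \<circ> q) \<subseteq> U"
    using * assms(2) by (auto simp: path_image_compose)
  ultimately show "L (F \<circ> (p +++ q)) = L (F \<circ> p) + L (F \<circ> q)"
    using join[of "F \<circ> p" "F \<circ> q"] * by (simp add: path_compose_join pathfinish_compose pathstart_compose)
qed

lemma exact_onI:
  assumes V: "path_connected V" "V \<subseteq> U"
    and eq: "\<And>p q. path p \<Longrightarrow> path q \<Longrightarrow> path_image p \<subseteq> V \<Longrightarrow> path_image q \<subseteq> V \<Longrightarrow>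
      pathstart p = pathstart q \<Longrightarrow> pathfinish p = pathfinish q \<Longrightarrow> L p = L q"
  shows "exact_on V L"
proof (cases "V = {}")
  case True
  then show ?thesis by (auto simp: exact_on_def potential_on_def)
next
  case False
  then obtain a where a: "a \<in> V" by blast
  have "\<forall>x\<in>V. \<exists>p. path p \<and> path_image p \<subseteq> V \<and> pathstart p = a \<and> pathfinish p = x"
    using V(1) a unfolding path_connected_def by blast
  then obtain \<sigma> where \<sigma>: "\<And>x. x \<in> V \<Longrightarrow> path (\<sigma> x) \<and> path_image (\<sigma> x) \<subseteq> V \<and> pathstart (\<sigma> x) = a \<and> pathfinish (\<sigma> x) = x"
    by metis
  have "L p = L (\<sigma> (pathfinish p)) - L (\<sigma> (pathstart p))" if p: "path p" "path_image p \<subseteq> V" for p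
  proof -
    have e: "pathstart p \<in> V" "pathfinish p \<in> V" using p by auto
    have "L (\<sigma> (pathstart p) +++ p) = L (\<sigma> (pathfinish p))"
      by (rule eq) (use p \<sigma>[OF e(1)] \<sigma>[OF e(2)] in \<open>auto simp: path_image_join\<close>)
    moreover have "L (\<sigma> (pathstart p) +++ p) = L (\<sigma> (pathstart p)) + L p"
      by (rule join) (use p \<sigma>[OF e(1)] V(2) in auto)
    ultimately show ?thesis by simp
  qed
  then show ?thesis unfolding exact_on_def potential_on_def by (intro exI[of _ "\<lambda>x. L (\<sigma> x)"]) blast
qed

end

lemma exact_on_convex:
  fixes V :: "'a::real_normed_vector set"
  assumes "path_functional V L" "convex V" shows "exact_on V L"
proof -
  interpret path_functional V L by fact
  show ?thesis
  proof (rule exact_onI)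
    show "path_connected V" using assms(2) by (rule convex_imp_path_connected)
    fix p q :: "real \<Rightarrow> 'a" assume *: "path p" "path q" "path_image p \<subseteq> V" "path_image q \<subseteq> V"
      "pathstart p = pathstart q" "pathfinish p = pathfinish q"
    show "L p = L q"
    proof (rule homotopic, rule homotopic_paths_linear)
      show "closed_segment (p t) (q t) \<subseteq> V" if "t \<in> {0..1}" for t
        using that * assms(2) by (intro closed_segment_subset) (auto simp: path_image_def)
    qed (use * in auto)
  qed simp
qed

context path_functional
begin

text \<open>Pulled back along \<open>p\<close> to the unit interval, the functional has a primitive
  \<Phi> by convexity. There \<Phi> minus the pullback of \<psi> is locally constant, hence
  constant; this replaces a subdivision of the path.\<close>

lemma potential_on_local:
  assumes V: "V \<subseteq> U" and loc: "\<And>u. u \<in> V \<Longrightarrow> \<exists>W. open W \<and> u \<in> W \<and> potential_on (V \<inter> W) L \<psi>"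
  shows "potential_on V L \<psi>"
  unfolding potential_on_def
proof (intro allI impI)
  fix p :: "real \<Rightarrow> 'a" assume p: "path p" "path_image p \<subseteq> V"
  have pV: "p t \<in> V" if "t \<in> {0..1}" for t using p(2) that by (auto simp: path_image_def)
  have pU: "path_image p \<subseteq> U" using p(2) V by blast
  have "path_functional {0..1} (\<lambda>r. L (p \<circ> r))"
    by (rule pullback) (use p(1) pV V in \<open>auto simp: path_def\<close>)
  then obtain \<Phi> where \<Phi>: "potential_on {0..1} (\<lambda>r. L (p \<circ> r)) \<Phi>"
    by (rule exact_onE[OF exact_on_convex]) auto
  define f where "f = (\<lambda>t. \<Phi> t - \<psi> (p t))"
  have "f 0 = f 1"
  proof (rule connected_local_const[of "{0..1}" 0 1 f])
    show "\<forall>t\<in>{0..1}. \<forall>\<^sub>F s in at t within {0..1}. f t = f s"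
    proof
      fix t :: real assume t: "t \<in> {0..1}"
      obtain W where W: "open W" "p t \<in> W" "potential_on (V \<inter> W) L \<psi>" using loc[OF pV[OF t]] by blast
      have "continuous_on {0..1} p" using p by (simp add: path_def)
      then obtain A where A: "open A" "p -` W \<inter> {0..1} = A \<inter> {0..1}"
        using W(1) unfolding continuous_on_open_invariant by metis
      then have "t \<in> A" using t W(2) by blast
      then obtain e where e: "e > 0" "ball t e \<subseteq> A" using A(1) open_contains_ball by blast
      show "\<forall>\<^sub>F s in at t within {0..1}. f t = f s"
        unfolding eventually_at
      proof (intro exI[of _ e] conjI ballI impI)
        fix s :: real assume s: "s \<in> {0..1}" "s \<noteq> t \<and> dist s t < e"
        have "closed_segment t s \<subseteq> ball t e"
          using s e by (intro closed_segment_subset) (auto simp: dist_commute)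
        moreover have "closed_segment t s \<subseteq> {0..1}"
          using s t by (intro closed_segment_subset) auto
        ultimately have "p ` closed_segment t s \<subseteq> V \<inter> W" using e A(2) pV by blast
        moreover have "path (p \<circ> linepath t s)"
          using p(1) \<open>closed_segment t s \<subseteq> {0..1}\<close> unfolding path_def[of p]
          by (intro path_continuous_image) (auto intro: continuous_on_subset)
        ultimately have "L (p \<circ> linepath t s) = \<psi> (p s) - \<psi> (p t)"
          using potential_onD[OF W(3), of "p \<circ> linepath t s"] by (simp add: path_image_compose pathfinish_compose pathstart_compose)
        moreover have "L (p \<circ> linepath t s) = \<Phi> s - \<Phi> t"
          using potential_onD[OF \<Phi>, of "linepath t s"] \<open>closed_segment t s \<subseteq> {0..1}\<close> by simp
        ultimately show "f t = f s" by (simp add: f_def)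
      qed (use e in simp)
    qed
  qed auto
  moreover have "L p = \<Phi> 1 - \<Phi> 0"
    using potential_onD[OF \<Phi>, of "\<lambda>t. t"] by (simp add: path_def path_image_def pathfinish_def pathstart_def o_def)
  ultimately show "L p = \<psi> (pathfinish p) - \<psi> (pathstart p)"
    by (simp add: f_def pathfinish_def pathstart_def)
qed

text \<open>The Mayer-Vietoris argument: on the path connected intersection the two potentials
  differ by a constant, which is absorbed into one of them. The glued function is then checked
  locally.\<close>

lemma exact_on_Un:
  assumes "open V" "open W" "V \<subseteq> U" "W \<subseteq> U" "exact_on V L" "exact_on W L" "path_connected (V \<inter> W)"
  shows "exact_on (V \<union> W) L"
proof -
  obtain \<psi> where \<psi>: "potential_on V L \<psi>" using assms(5) by (rule exact_onE)
  obtain \<phi> where \<phi>: "potential_on W L \<phi>" using assms(6) by (rule exact_onE)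
  obtain c where c: "\<And>x. x \<in> V \<inter> W \<Longrightarrow> \<psi> x - \<phi> x = c"
  proof (cases "V \<inter> W = {}")
    case False
    then obtain a where a: "a \<in> V \<inter> W" by blast
    show thesis
      by (rule that[of "\<psi> a - \<phi> a"], rule potentials_differ_by_const[OF assms(7)])
        (use \<psi> \<phi> a potential_on_subset in blast)+
  qed (use that in blast)
  define \<eta> where "\<eta> = (\<lambda>x. if x \<in> V then \<psi> x else \<phi> x + c)"
  have "potential_on (V \<union> W) L \<eta>"
  proof (rule potential_on_local)
    fix u assume "u \<in> V \<union> W"
    moreover have "potential_on V L \<eta>"
      unfolding potential_on_def
    proof (intro allI impI)
      fix p :: "real \<Rightarrow> 'a" assume p: "path p" "path_image p \<subseteq> V"
      then have "pathstart p \<in> V" "pathfinish p \<in> V" by auto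
      then show "L p = \<eta> (pathfinish p) - \<eta> (pathstart p)" using potential_onD[OF \<psi> p] by (simp add: \<eta>_def)
    qed
    moreover have "potential_on W L \<eta>"
      unfolding potential_on_def
    proof (intro allI impI)
      fix p :: "real \<Rightarrow> 'a" assume p: "path p" "path_image p \<subseteq> W"
      have "\<eta> x = \<phi> x + c" if "x \<in> W" for x using c[of x] that by (auto simp: \<eta>_def)
      moreover have "pathstart p \<in> W" "pathfinish p \<in> W" using p by auto
      ultimately show "L p = \<eta> (pathfinish p) - \<eta> (pathstart p)" using potential_onD[OF \<phi> p] by simp
    qed
    ultimately show "\<exists>A. open A \<and> u \<in> A \<and> potential_on ((V \<union> W) \<inter> A) L \<eta>"
      using assms(1,2) by (metis Int_lower2 Un_iff potential_on_subset)
  qed (use assms in auto)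
  then show ?thesis by (auto simp: exact_on_def)
qed

end

lemma path_functional_subset:
  assumes "path_functional U L" "V \<subseteq> U" shows "path_functional V L"
proof -
  interpret path_functional U L by fact
  show ?thesis
  proof
    show "L p = L q" if "homotopic_paths V p q" for p q
      by (rule homotopic[OF homotopic_paths_subset[OF that assms(2)]])
    show "L (p +++ q) = L p + L q" if "path p" "path q" "path_image p \<subseteq> V" "path_image q \<subseteq> V" "pathfinish p = pathstart q" for p q
      by (rule join) (use that assms(2) in auto)
  qed
qed

text \<open>The punctured disc is covered by a half plane via the exponential map; the vanishing of the
  functional on one circle makes the potential on the half plane periodic.\<close>

lemma exact_on_punctured_ball:
  fixes L :: "(real \<Rightarrow> complex) \<Rightarrow> real"
  assumes L: "path_functional (ball s e - {s}) L" and r: "0 < r" "r < e"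
    and circ: "L (\<lambda>t. s + of_real r * (\<i> * cis (2 * pi * t))) = 0"
  shows "exact_on (ball s e - {s}) L"
proof -
  interpret path_functional "ball s e - {s}" L by (rule L)
  define C where "C = {w. Re w < ln e}"
  define F where "F = (\<lambda>w. s + exp w)"
  have e: "0 < e" using r by simp
  have CI: "w \<in> C \<longleftrightarrow> F w \<in> ball s e - {s}" for w
  proof -
    have "Re w < ln e \<longleftrightarrow> exp (Re w) < e" using e by (metis exp_ln exp_less_cancel_iff)
    moreover have "dist s (F w) = exp (Re w)" by (simp add: F_def dist_norm)
    moreover have "F w \<noteq> s" by (simp add: F_def)
    ultimately show ?thesis by (simp add: C_def)
  qed
  have C: "convex C" unfolding C_def by (rule convex_halfspace_Re_lt)
  have L': "path_functional C (\<lambda>p. L (F \<circ> p))"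
    by (rule pullback) (use CI in \<open>auto simp: F_def intro!: continuous_intros\<close>)
  obtain \<Psi> where \<Psi>: "potential_on C (\<lambda>p. L (F \<circ> p)) \<Psi>"
    using exact_on_convex[OF L' C] by (rule exact_onE)
  let ?T = "2 * of_real pi * \<i>"
  have FT: "F (w + ?T) = F w" for w by (simp add: F_def exp_add)
  have seg: "L (F \<circ> linepath a b) = \<Psi> b - \<Psi> a" if "a \<in> C" "b \<in> C" for a b
    using potential_onD[OF \<Psi>, of "linepath a b"] that C by (simp add: closed_segment_subset)
  \<comment> \<open>The circle starts at its top because of the factor \<open>\<i>\<close>, and this
    point has the logarithm \<open>w0\<close> relative to the centre. The vertical segment of length
    2 pi above \<open>w0\<close> covers the circle once.\<close>
  define w0 where "w0 = of_real (ln r) + \<i> * of_real (pi / 2)"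
  have w0: "w0 \<in> C" using r by (simp add: w0_def C_def)
  have CT: "w + ?T \<in> C \<longleftrightarrow> w \<in> C" for w by (simp add: C_def)
  have "F \<circ> linepath w0 (w0 + ?T) = (\<lambda>t. s + of_real r * (\<i> * cis (2 * pi * t)))"
  proof
    fix t
    have "linepath w0 (w0 + ?T) t = w0 + \<i> * of_real (2 * pi * t)"
      by (simp add: linepath_def scaleR_conv_of_real algebra_simps)
    then have "linepath w0 (w0 + ?T) t = of_real (ln r) + (\<i> * of_real (pi / 2) + \<i> * of_real (2 * pi * t))"
      by (simp only: w0_def add.assoc)
    then have "exp (linepath w0 (w0 + ?T) t) = of_real r * (cis (pi / 2) * cis (2 * pi * t))"
      using r by (simp only: exp_add cis_conv_exp exp_of_real exp_ln)
    then show "(F \<circ> linepath w0 (w0 + ?T)) t = s + of_real r * (\<i> * cis (2 * pi * t))" by (simp add: F_def)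
  qed
  then have "\<Psi> (w0 + ?T) = \<Psi> w0" using seg[of w0 "w0 + ?T"] w0 circ CT by simp
  \<comment> \<open>The segments from \<open>w0\<close> to \<open>w\<close> and from
    \<open>w0 + ?T\<close> to \<open>w + ?T\<close> have the same image under
    \<open>F\<close>.\<close>
  then have per: "\<Psi> (w + ?T) = \<Psi> w" if "w \<in> C" for w
  proof -
    have "linepath (w0 + ?T) (w + ?T) t = linepath w0 w t + ?T" for t
      by (simp add: linepath_def scaleR_conv_of_real algebra_simps)
    then have "F \<circ> linepath (w0 + ?T) (w + ?T) = F \<circ> linepath w0 w"
      by (simp add: fun_eq_iff FT)
    then show ?thesis
      using seg[of w0 w] seg[of "w0 + ?T" "w + ?T"] w0 that CT \<open>\<Psi> (w0 + ?T) = \<Psi> w0\<close> by simp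
  qed
  have pern: "\<Psi> (w + of_nat k * ?T) = \<Psi> w" if "w \<in> C" for w k
  proof (induction k)
    case (Suc k)
    have "w + of_nat k * ?T \<in> C" using that by (simp add: C_def)
    then show ?case using per[of "w + of_nat k * ?T"] Suc by (simp add: algebra_simps)
  qed simp
  have peri: "\<Psi> v = \<Psi> w" if vw: "v \<in> C" "w \<in> C" "exp v = exp w" for v w
  proof -
    obtain k :: int where k: "v = w + of_int (2 * k) * of_real pi * \<i>" using vw(3) by (auto simp: exp_eq)
    show ?thesis
    proof (cases "k \<ge> 0")
      case True
      then have "v = w + of_nat (nat k) * ?T" using k by simp
      then show ?thesis using pern[OF vw(2)] by simp
    next
      case False
      then have "w = v + of_nat (nat (- k)) * ?T" using k by simp
      then show ?thesis using pern[OF vw(1)] by simp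
    qed
  qed
  \<comment> \<open>\<open>Ln\<close> jumps along a ray, but by \<open>peri\<close> only the
    exponential matters for \<Psi>. A continuous logarithm of a path may thus be replaced by
    \<open>Ln\<close> at its ends.\<close>
  have "potential_on (ball s e - {s}) L (\<lambda>u. \<Psi> (Ln (u - s)))"
    unfolding potential_on_def
  proof (intro allI impI)
    fix p assume p: "path p" "path_image p \<subseteq> ball s e - {s}"
    have ps: "p t \<in> ball s e - {s}" if "t \<in> {0..1}" for t using p(2) that unfolding path_image_def by blast
    have "continuous_on {0..1} (\<lambda>t. p t - s)" using p(1) unfolding path_def by (intro continuous_intros)
    moreover have "p t - s \<noteq> 0" if "t \<in> {0..1}" for t using ps[OF that] by auto
    moreover have "contractible {0..1::real}" by (intro convex_imp_contractible) auto
    ultimately obtain g where g: "continuous_on {0..1} g" "\<And>t. t \<in> {0..1} \<Longrightarrow> p t - s = exp (g t)"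
      using continuous_logarithm_on_contractible[of "{0..1::real}" "\<lambda>t. p t - s"] by metis
    have pF: "p t = F (g t)" if "t \<in> {0..1}" for t using g(2)[OF that] by (simp add: F_def algebra_simps)
    have gC: "g t \<in> C" if "t \<in> {0..1}" for t using CI[of "g t"] pF[OF that] ps[OF that] by simp
    have "L p = L (F \<circ> g)" by (rule cong[OF p]) (simp add: pF)
    also have "\<dots> = \<Psi> (g 1) - \<Psi> (g 0)"
    proof -
      have "path_image g \<subseteq> C" using gC unfolding path_image_def by blast
      then show ?thesis using potential_onD[OF \<Psi>, of g] g(1) by (simp add: path_def pathfinish_def pathstart_def)
    qed
    also have "\<Psi> (g t) = \<Psi> (Ln (p t - s))" if t: "t \<in> {0..1}" for t
    proof (rule peri)
      have "exp (Ln (p t - s)) = p t - s" using ps[OF t] by (intro exp_Ln) auto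
      then show "exp (g t) = exp (Ln (p t - s))" using g(2)[OF t] by simp
      have "F (Ln (p t - s)) = p t" using \<open>exp (Ln (p t - s)) = p t - s\<close> by (simp add: F_def)
      then show "Ln (p t - s) \<in> C" using CI ps[OF t] by metis
    qed (rule gC[OF t])
    then have "\<Psi> (g 1) - \<Psi> (g 0) = \<Psi> (Ln (p 1 - s)) - \<Psi> (Ln (p 0 - s))" by simp
    finally show "L p = \<Psi> (Ln (pathfinish p - s)) - \<Psi> (Ln (pathstart p - s))"
      by (simp add: pathfinish_def pathstart_def)
  qed
  then show ?thesis by (auto simp: exact_on_def)
qed

section \<open>Exactness on the plane minus a countable set\<close>

definition rect :: "real \<Rightarrow> real \<Rightarrow> real \<Rightarrow> real \<Rightarrow> complex set" where
  "rect a b c d = {z. a < Re z \<and> Re z < b \<and> c < Im z \<and> Im z < d}"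

lemma rect_eq: "rect a b c d = {z. a < Re z} \<inter> {z. Re z < b} \<inter> {z. c < Im z} \<inter> {z. Im z < d}"
  by (auto simp: rect_def)

lemma open_rect: "open (rect a b c d)"
  unfolding rect_eq by (intro open_Int open_halfspace_Re_lt open_halfspace_Re_gt open_halfspace_Im_lt open_halfspace_Im_gt)

lemma convex_rect: "convex (rect a b c d)"
  unfolding rect_eq by (intro convex_Int convex_halfspace_Re_lt convex_halfspace_Re_gt convex_halfspace_Im_lt convex_halfspace_Im_gt)

text \<open>Two paths with the same ends lie in a common rectangle, and bisection reduces exactness
  there to small boxes, first along a row and then vertically. Neighbouring boxes meet in a convex
  set minus countably many points, which is path connected, so \<open>exact_on_Un\<close> glues
  them.\<close>

lemma exact_on_complement_countable:
  fixes L :: "(real \<Rightarrow> complex) \<Rightarrow> real"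
  assumes L: "path_functional D L" and D: "open D" "countable (- D)"
    and loc: "\<And>s. \<exists>e>0. exact_on (ball s e \<inter> D) L"
  shows "exact_on D L"
proof -
  interpret path_functional D L by (rule L)
  have pc: "path_connected (V \<inter> D)" if "open V" "convex V" for V
    using path_connected_open_diff_countable[of V "- D"] that D(2) convex_connected[OF that(2)]
    by (simp add: Diff_eq)
  have glue: "exact_on ((V \<union> W) \<inter> D) L"
    if "open V" "open W" "convex V" "convex W" "exact_on (V \<inter> D) L" "exact_on (W \<inter> D) L" for V W
  proof -
    have "path_connected ((V \<inter> D) \<inter> (W \<inter> D))"
      using pc[of "V \<inter> W"] that by (simp add: open_Int convex_Int Int_ac)
    then have "exact_on ((V \<inter> D) \<union> (W \<inter> D)) L"
      using that D(1) by (intro exact_on_Un) auto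
    then show ?thesis by (simp add: Int_Un_distrib2)
  qed
  have rect_local: "rect (x - e / 2) (x + e / 2) (y - e / 2) (y + e / 2) \<subseteq> ball (Complex x y) e" for x y e
  proof
    fix z assume "z \<in> rect (x - e / 2) (x + e / 2) (y - e / 2) (y + e / 2)"
    then have "\<bar>Re (z - Complex x y)\<bar> < e / 2" "\<bar>Im (z - Complex x y)\<bar> < e / 2"
      unfolding abs_less_iff by (auto simp: rect_def)
    then show "z \<in> ball (Complex x y) e"
      using cmod_le[of "z - Complex x y"] by (simp add: dist_norm norm_minus_commute)
  qed
  \<comment> \<open>The margin \<epsilon> makes neighbouring rectangles overlap when two adjacent
    intervals are joined.\<close>
  have row: "\<exists>\<epsilon>>0. exact_on (rect (a - \<epsilon>) (b + \<epsilon>) (y - \<epsilon>) (y + \<epsilon>) \<inter> D) L" if "a \<le> b" for a b y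
    using that
  proof (induction a b rule: Bolzano)
    case (trans a b c)
    then obtain \<epsilon>1 \<epsilon>2 where 1: "\<epsilon>1 > 0" "exact_on (rect (a - \<epsilon>1) (b + \<epsilon>1) (y - \<epsilon>1) (y + \<epsilon>1) \<inter> D) L"
      and 2: "\<epsilon>2 > 0" "exact_on (rect (b - \<epsilon>2) (c + \<epsilon>2) (y - \<epsilon>2) (y + \<epsilon>2) \<inter> D) L" by blast
    define \<epsilon> where "\<epsilon> = min \<epsilon>1 \<epsilon>2"
    have "exact_on (rect (a - \<epsilon>) (b + \<epsilon>) (y - \<epsilon>) (y + \<epsilon>) \<inter> D) L"
      "exact_on (rect (b - \<epsilon>) (c + \<epsilon>) (y - \<epsilon>) (y + \<epsilon>) \<inter> D) L"
      by (rule exact_on_subset[OF 1(2)], force simp: rect_def \<epsilon>_def)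
        (rule exact_on_subset[OF 2(2)], force simp: rect_def \<epsilon>_def)
    from glue[OF open_rect open_rect convex_rect convex_rect this]
    have "exact_on (rect (a - \<epsilon>) (c + \<epsilon>) (y - \<epsilon>) (y + \<epsilon>) \<inter> D) L"
      by (rule exact_on_subset) (use 1 2 in \<open>auto simp: rect_def \<epsilon>_def\<close>)
    then show ?case using 1 2 by (intro exI[of _ \<epsilon>]) (simp add: \<epsilon>_def)
  next
    case (local x)
    obtain e where e: "e > 0" "exact_on (ball (Complex x y) e \<inter> D) L" using loc by blast
    show ?case
    \<comment> \<open>An interval shorter than \<open>e / 4\<close> around \<open>x\<close>,
      enlarged by \<open>e / 4\<close>, stays within \<open>e / 2\<close> of \<open>x\<close>; the
      square of that half side fits into the ball of radius \<open>e\<close>.\<close>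
    proof (rule exI[of _ "e / 4"], intro conjI allI impI)
      fix a b assume ab: "a \<le> x \<and> x \<le> b \<and> b - a < e / 4"
      have "rect (a - e / 4) (b + e / 4) (y - e / 4) (y + e / 4) \<subseteq> rect (x - e / 2) (x + e / 2) (y - e / 2) (y + e / 2)"
        using ab e(1) by (auto simp: rect_def)
      then have "rect (a - e / 4) (b + e / 4) (y - e / 4) (y + e / 4) \<inter> D \<subseteq> ball (Complex x y) e \<inter> D"
        using rect_local by blast
      then have "exact_on (rect (a - e / 4) (b + e / 4) (y - e / 4) (y + e / 4) \<inter> D) L"
        by (rule exact_on_subset[OF e(2)])
      then show "\<exists>\<epsilon>>0. exact_on (rect (a - \<epsilon>) (b + \<epsilon>) (y - \<epsilon>) (y + \<epsilon>) \<inter> D) L"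
        using e(1) by (intro exI[of _ "e / 4"]) simp
    qed (use e in simp)
  qed
  have box: "\<exists>\<epsilon>>0. exact_on (rect (a - \<epsilon>) (b + \<epsilon>) (c - \<epsilon>) (d + \<epsilon>) \<inter> D) L" if ab: "a \<le> b" and "c \<le> d" for a b c d
    using that(2)
  proof (induction c d rule: Bolzano)
    case (trans c d f)
    then obtain \<epsilon>1 \<epsilon>2 where 1: "\<epsilon>1 > 0" "exact_on (rect (a - \<epsilon>1) (b + \<epsilon>1) (c - \<epsilon>1) (d + \<epsilon>1) \<inter> D) L"
      and 2: "\<epsilon>2 > 0" "exact_on (rect (a - \<epsilon>2) (b + \<epsilon>2) (d - \<epsilon>2) (f + \<epsilon>2) \<inter> D) L" by blast
    define \<epsilon> where "\<epsilon> = min \<epsilon>1 \<epsilon>2"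
    have "exact_on (rect (a - \<epsilon>) (b + \<epsilon>) (c - \<epsilon>) (d + \<epsilon>) \<inter> D) L"
      "exact_on (rect (a - \<epsilon>) (b + \<epsilon>) (d - \<epsilon>) (f + \<epsilon>) \<inter> D) L"
      by (rule exact_on_subset[OF 1(2)], force simp: rect_def \<epsilon>_def)
        (rule exact_on_subset[OF 2(2)], force simp: rect_def \<epsilon>_def)
    from glue[OF open_rect open_rect convex_rect convex_rect this]
    have "exact_on (rect (a - \<epsilon>) (b + \<epsilon>) (c - \<epsilon>) (f + \<epsilon>) \<inter> D) L"
      by (rule exact_on_subset) (use 1 2 in \<open>auto simp: rect_def \<epsilon>_def\<close>)
    then show ?case using 1 2 by (intro exI[of _ \<epsilon>]) (simp add: \<epsilon>_def)
  next
    case (local y)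
    obtain e where e: "e > 0" "exact_on (rect (a - e) (b + e) (y - e) (y + e) \<inter> D) L" using row[OF ab] by blast
    show ?case
    proof (rule exI[of _ "e / 2"], intro conjI allI impI)
      fix c d assume cd: "c \<le> y \<and> y \<le> d \<and> d - c < e / 2"
      have "rect (a - e / 2) (b + e / 2) (c - e / 2) (d + e / 2) \<subseteq> rect (a - e) (b + e) (y - e) (y + e)"
        using cd e(1) by (auto simp: rect_def)
      then have "exact_on (rect (a - e / 2) (b + e / 2) (c - e / 2) (d + e / 2) \<inter> D) L"
        by (intro exact_on_subset[OF e(2)]) blast
      then show "\<exists>\<epsilon>>0. exact_on (rect (a - \<epsilon>) (b + \<epsilon>) (c - \<epsilon>) (d + \<epsilon>) \<inter> D) L"
        using e(1) by (intro exI[of _ "e / 2"]) simp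
    qed (use e in simp)
  qed
  show ?thesis
  proof (rule exact_onI)
    show "path_connected D" using pc[of UNIV] by simp
    fix p q assume *: "path p" "path q" "path_image p \<subseteq> D" "path_image q \<subseteq> D"
      "pathstart p = pathstart q" "pathfinish p = pathfinish q"
    have "bounded (path_image p \<union> path_image q)"
      using *(1,2) by (simp add: bounded_path_image)
    then obtain R where R: "\<And>z. z \<in> path_image p \<union> path_image q \<Longrightarrow> cmod z \<le> R"
      unfolding bounded_iff by blast
    have "R \<ge> 0" using R[of "pathstart p"] norm_ge_zero order_trans by blast
    then obtain \<epsilon> where \<epsilon>: "\<epsilon> > 0" "exact_on (rect (- R - \<epsilon>) (R + \<epsilon>) (- R - \<epsilon>) (R + \<epsilon>) \<inter> D) L"
      using box[of "- R" R "- R" R] by auto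
    then obtain \<psi> where \<psi>: "potential_on (rect (- R - \<epsilon>) (R + \<epsilon>) (- R - \<epsilon>) (R + \<epsilon>) \<inter> D) L \<psi>"
      by (auto elim: exact_onE)
    have "z \<in> rect (- R - \<epsilon>) (R + \<epsilon>) (- R - \<epsilon>) (R + \<epsilon>)" if "z \<in> path_image p \<union> path_image q" for z
      using R[OF that] \<epsilon>(1) abs_Re_le_cmod[of z] abs_Im_le_cmod[of z] by (auto simp: rect_def)
    then have "path_image p \<subseteq> rect (- R - \<epsilon>) (R + \<epsilon>) (- R - \<epsilon>) (R + \<epsilon>) \<inter> D"
      "path_image q \<subseteq> rect (- R - \<epsilon>) (R + \<epsilon>) (- R - \<epsilon>) (R + \<epsilon>) \<inter> D"
      using *(3,4) by blast+
    then show "L p = L q"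
      using potential_onD[OF \<psi> *(1)] potential_onD[OF \<psi> *(2)] *(5,6) by simp
  qed simp
qed

section \<open>Homomorphisms to the reals as functionals on configuration paths\<close>

text \<open>The factor \<open>\<i>\<close> makes the circle start at its top, which the glide
  reflection takes to the top of the image. The image is therefore the circle run backwards from the
  same starting point.\<close>

lemma circle_reflection:
  "act 0 1 (z + of_real r * (\<i> * cis \<theta>)) = act 0 1 z + of_real r * (\<i> * cis (- \<theta>))"
  by (simp add: complex_eq_iff)

locale klein_braids_hom = klein_braids +
  fixes h :: "(real \<Rightarrow> nat \<Rightarrow> (real \<times> real) set) set \<Rightarrow> real"
  assumes hom: "A \<in> carrier G \<Longrightarrow> B \<in> carrier G \<Longrightarrow> h (A \<otimes>\<^bsub>G\<^esub> B) = h A + h B"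
begin

lemma ext_homotopic:
  "path_homotopic X p p' \<Longrightarrow> groupoid_extension X base h p = groupoid_extension X base h p'"
  by (rule groupoid_extension_homotopic[OF base_in_X]) (auto intro: hom)

lemma ext_concat:
  "pathin X p \<Longrightarrow> pathin X p' \<Longrightarrow> p 1 = p' 0 \<Longrightarrow>
    groupoid_extension X base h (concat_loops p p') = groupoid_extension X base h p + groupoid_extension X base h p'"
  by (rule groupoid_extension_concat[OF base_in_X]) (auto intro: hom)

lemma ext_loop: "p \<in> loops X base \<Longrightarrow> groupoid_extension X base h p = h (loop_class X base p)"
  by (rule groupoid_extension_loop[OF base_in_X]) (auto intro: hom)

text \<open>The covering of the configuration space with a separate deck transformation for each
  string. Its fundamental group is the kernel of the map from the pure braid group to the
  \<open>n\<close>-th power of the Klein bottle group.\<close>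

definition Y :: "(nat \<Rightarrow> complex) set" where
  "Y = {z. config_ok n z \<and> (\<forall>i. i \<notin> {1..n} \<longrightarrow> z i = 0)}"

definition \<Lambda> :: "(real \<Rightarrow> nat \<Rightarrow> complex) \<Rightarrow> real" where
  "\<Lambda> p = groupoid_extension X base h (\<lambda>t. config_proj n (p t))"

lemma continuous_map_Y:
  assumes "continuous_on S l" "l \<in> S \<rightarrow> Y"
  shows "continuous_map (top_of_set S) X (\<lambda>t. config_proj n (l t))"
  by (rule continuous_map_config_proj)
    (use assms in \<open>auto simp: Y_def intro: continuous_on_product_then_coordinatewise\<close>)

lemma pathin_Y: "path p \<Longrightarrow> path_image p \<subseteq> Y \<Longrightarrow> pathin X (\<lambda>t. config_proj n (p t))"
  unfolding pathin_def path_def path_image_def by (rule continuous_map_Y) auto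

lemma \<Lambda>: "path_functional Y \<Lambda>"
proof
  fix p q assume "homotopic_paths Y p q"
  then obtain k :: "real \<times> real \<Rightarrow> nat \<Rightarrow> complex" where k: "continuous_on ({0..1} \<times> {0..1}) k" "k \<in> {0..1} \<times> {0..1} \<rightarrow> Y"
    "\<forall>x\<in>{0..1}. k (0, x) = p x" "\<forall>x\<in>{0..1}. k (1, x) = q x"
    "\<forall>t\<in>{0..1}. pathstart (k \<circ> Pair t) = pathstart p \<and> pathfinish (k \<circ> Pair t) = pathfinish p"
    unfolding homotopic_paths by blast
  have "path_homotopic X (\<lambda>t. config_proj n (p t)) (\<lambda>t. config_proj n (q t))"
    unfolding path_homotopic
    by (intro exI[of _ "\<lambda>s. config_proj n (k s)"] conjI continuous_map_Y[OF k(1,2)])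
      (use k(3-5) in \<open>auto simp: pathstart_def pathfinish_def\<close>)
  then show "\<Lambda> p = \<Lambda> q"
    unfolding \<Lambda>_def by (rule ext_homotopic)
next
  fix p q :: "real \<Rightarrow> nat \<Rightarrow> complex"
  assume *: "path p" "path q" "path_image p \<subseteq> Y" "path_image q \<subseteq> Y" "pathfinish p = pathstart q"
  have "(\<lambda>t. config_proj n ((p +++ q) t)) = concat_loops (\<lambda>t. config_proj n (p t)) (\<lambda>t. config_proj n (q t))"
    by (auto simp: joinpaths_def concat_loops_def)
  then show "\<Lambda> (p +++ q) = \<Lambda> p + \<Lambda> q"
    using ext_concat[OF pathin_Y[OF *(1,3)] pathin_Y[OF *(2,4)]] *(5)
    by (simp add: \<Lambda>_def pathfinish_def pathstart_def)
qed

sublocale path_functional Y \<Lambda>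
  by (rule \<Lambda>)

text \<open>Used to apply deck transformations to individual strings: \<Lambda> is defined through
  the projection and does not notice them.\<close>

lemma \<Lambda>_cong_proj:
  assumes "\<And>t i. i \<in> {1..n} \<Longrightarrow> kproj (p t i) = kproj (p' t i)" shows "\<Lambda> p = \<Lambda> p'"
proof -
  have "config_proj n (p t) = config_proj n (p' t)" for t
    unfolding config_proj_eq_iff using assms by blast
  then show ?thesis unfolding \<Lambda>_def by (simp only:)
qed

section \<open>Configurations in which a single string moves\<close>

definition room :: "(nat \<Rightarrow> complex) \<Rightarrow> nat \<Rightarrow> complex set" where
  "room z i = {w. \<forall>j\<in>{1..n} - {i}. kproj w \<noteq> kproj (z j)}"

text \<open>For a string \<open>i\<close>, the entry \<open>z i\<close> is a placeholder without any
  condition, to be overwritten by the moving string.\<close>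

definition others_ok :: "(nat \<Rightarrow> complex) \<Rightarrow> nat \<Rightarrow> bool" where
  "others_ok z i \<longleftrightarrow> inj_on (\<lambda>j. kproj (z j)) ({1..n} - {i}) \<and> (\<forall>j. j \<notin> {1..n} \<longrightarrow> z j = 0)"

lemma room_eq: "room z i = - {w. \<exists>j\<in>{1..n} - {i}. kproj w = kproj (z j)}"
  unfolding room_def by blast

lemma others_okI:
  assumes "\<And>a b. a \<in> {1..n} - {i} \<Longrightarrow> b \<in> {1..n} - {i} \<Longrightarrow> a \<noteq> b \<Longrightarrow> kproj (z a) \<noteq> kproj (z b)"
    and "\<And>j. j \<notin> {1..n} \<Longrightarrow> z j = 0"
  shows "others_ok z i"
  unfolding others_ok_def inj_on_def using assms by blast

lemma others_okD:
  "others_ok z i \<Longrightarrow> a \<in> {1..n} - {i} \<Longrightarrow> b \<in> {1..n} - {i} \<Longrightarrow> a \<noteq> b \<Longrightarrow> kproj (z a) \<noteq> kproj (z b)"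
  unfolding others_ok_def inj_on_def by blast

lemma others_ok_0: "others_ok z i \<Longrightarrow> j \<notin> {1..n} \<Longrightarrow> z j = 0"
  unfolding others_ok_def by blast

lemma YI:
  assumes "\<And>a b. a \<in> {1..n} \<Longrightarrow> b \<in> {1..n} \<Longrightarrow> a \<noteq> b \<Longrightarrow> kproj (z a) \<noteq> kproj (z b)"
    and "\<And>j. j \<notin> {1..n} \<Longrightarrow> z j = 0"
  shows "z \<in> Y"
  unfolding Y_def config_ok_def inj_on_def using assms by blast

lemma YD: "z \<in> Y \<Longrightarrow> a \<in> {1..n} \<Longrightarrow> b \<in> {1..n} \<Longrightarrow> a \<noteq> b \<Longrightarrow> kproj (z a) \<noteq> kproj (z b)"
  unfolding Y_def config_ok_def inj_on_def by blast

lemma Y_0: "z \<in> Y \<Longrightarrow> j \<notin> {1..n} \<Longrightarrow> z j = 0"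
  unfolding Y_def by blast

lemma open_room: "open (room z i)"
  unfolding room_eq by (intro open_Compl closed_obstacles) simp

lemma countable_Compl_room: "countable (- room z i)"
  unfolding room_eq double_complement by (intro countable_obstacles) simp

lemma fun_upd_in_Y:
  assumes z: "others_ok z i" and i: "i \<in> {1..n}" and w: "w \<in> room z i" shows "z(i := w) \<in> Y"
proof (rule YI)
  have w': "kproj w \<noteq> kproj (z b)" if "b \<in> {1..n} - {i}" for b using w that unfolding room_def by blast
  fix a b assume ab: "a \<in> {1..n}" "b \<in> {1..n}" "a \<noteq> b"
  consider "a = i" | "b = i" | "a \<noteq> i" "b \<noteq> i" by blast
  then show "kproj ((z(i := w)) a) \<noteq> kproj ((z(i := w)) b)"
  proof cases
    case 1
    then show ?thesis using w'[of b] ab by simp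
  next
    case 2
    then show ?thesis using w'[of a] ab by simp
  next
    case 3
    then show ?thesis using others_okD[OF z, of a b] ab by simp
  qed
next
  fix j assume "j \<notin> {1..n}"
  then show "(z(i := w)) j = 0" using others_ok_0[OF z, of j] i by (cases "j = i") (simp_all del: atLeastAtMost_iff)
qed

lemma Y_others_ok: "z \<in> Y \<Longrightarrow> others_ok z i"
  by (rule others_okI) (simp_all add: YD Y_0 del: atLeastAtMost_iff)

lemma Y_in_room: "z \<in> Y \<Longrightarrow> i \<in> {1..n} \<Longrightarrow> z i \<in> room z i"
  unfolding room_def using YD by blast

lemma continuous_on_fun_upd:
  fixes z :: "nat \<Rightarrow> complex"
  assumes "continuous_on S f" shows "continuous_on S (\<lambda>t. z(i := f t))"
  by (rule continuous_on_coordinatewise_then_product) (rule continuous_on_config_fun_upd[OF assms])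

lemma strand_functional:
  assumes "others_ok z i" "i \<in> {1..n}"
  shows "path_functional (room z i) (\<lambda>p. \<Lambda> (\<lambda>t. z(i := p t)))"
proof -
  have "path_functional (room z i) (\<lambda>p. \<Lambda> ((\<lambda>w. z(i := w)) \<circ> p))"
    by (rule pullback) (use fun_upd_in_Y[OF assms] continuous_on_fun_upd[OF continuous_on_id] in \<open>auto simp: id_def\<close>)
  then show ?thesis by (simp add: o_def)
qed

lemma exact_pullback_convex:
  fixes C :: "'c::real_normed_vector set"
  assumes "convex C" "continuous_on C F" "F \<in> C \<rightarrow> Y"
  obtains \<Psi> where "\<And>p. path p \<Longrightarrow> path_image p \<subseteq> C \<Longrightarrow> \<Lambda> (\<lambda>t. F (p t)) = \<Psi> (pathfinish p) - \<Psi> (pathstart p)"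
proof -
  have "exact_on C (\<lambda>p. \<Lambda> (F \<circ> p))"
    by (rule exact_on_convex[OF pullback[OF assms(2,3)] assms(1)])
  then show thesis
    by (elim exact_onE) (rule that, simp add: potential_on_def o_def)
qed

text \<open>A small circle of string \<open>i\<close> around string \<open>j\<close> is freely homotopic to its inverse: transport
  both strings along a path on which string \<open>j\<close> traverses an orientation reversing loop of the
  Klein bottle. Hence a homomorphism to a torsion-free abelian group vanishes on it.\<close>

lemma small_circle:
  assumes ij: "i \<in> {1..n}" "j \<in> {1..n}" "i \<noteq> j" and z: "others_ok z i"
  obtains r0 where "r0 > 0"
    "\<And>r. 0 < r \<Longrightarrow> r < r0 \<Longrightarrow> \<Lambda> (\<lambda>t. z(i := z j + of_real r * (\<i> * cis (2 * pi * t)))) = 0"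
proof -
  let ?K = "{1..n} - {i, j}"
  have zj: "kproj (z j) \<noteq> kproj (z k)" if "k \<in> ?K" for k
    by (rule others_okD[OF z]) (use ij that in auto)
  obtain \<beta> where \<beta>: "path \<beta>" "pathstart \<beta> = z j" "pathfinish \<beta> = act 0 1 (z j)"
    "\<And>t k. t \<in> {0..1} \<Longrightarrow> k \<in> ?K \<Longrightarrow> kproj (\<beta> t) \<noteq> kproj (z k)"
    by (rule path_avoiding_obstacles[of ?K "z j" z "act 0 1 (z j)"]) (use zj in auto)
  have "path_image \<beta> \<inter> {w. \<exists>k\<in>?K. kproj w = kproj (z k)} = {}"
    using \<beta>(4) unfolding path_image_def by blast
  then obtain \<delta> where \<delta>: "\<delta> > 0"
    "\<And>x y. x \<in> path_image \<beta> \<Longrightarrow> y \<in> {w. \<exists>k\<in>?K. kproj w = kproj (z k)} \<Longrightarrow> \<delta> \<le> dist x y"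
    using separate_compact_closed[OF compact_path_image[OF \<beta>(1)] closed_obstacles[of ?K z]] by auto
  \<comment> \<open>A radius below \<delta> keeps the circle off the orbits of the remaining strings
    all along \<beta>, and a radius below 1 keeps it off the orbit of its own centre.\<close>
  show thesis
  proof (rule that[of "min \<delta> 1"])
    fix r :: real assume r: "0 < r" "r < min \<delta> 1"
    define u where "u = (\<lambda>t. of_real r * (\<i> * cis (2 * pi * t)))"
    define H where "H = (\<lambda>s. z(j := \<beta> (fst s), i := \<beta> (fst s) + u (snd s)))"
    let ?S = "{0..1::real} \<times> {0..1::real}"
    have norm_u: "norm (u t) = r" for t using r by (simp add: u_def norm_mult)
    have c\<beta>: "continuous_on {0..1} \<beta>" using \<beta>(1) by (simp add: path_def)
    have cH: "continuous_on ?S H"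
    proof (rule continuous_on_coordinatewise_then_product)
      fix k
      have "continuous_on ?S (\<lambda>s. \<beta> (fst s))"
        by (rule continuous_on_compose2[OF c\<beta>]) (auto intro!: continuous_intros)
      moreover have "continuous_on ?S (\<lambda>s. \<beta> (fst s) + u (snd s))"
        unfolding u_def by (intro continuous_intros calculation)
      ultimately show "continuous_on ?S (\<lambda>s. H s k)"
        by (cases "k = i"; cases "k = j") (simp_all add: H_def)
    qed
    have HY: "H \<in> ?S \<rightarrow> Y"
    proof (rule Pi_I)
      fix s :: "real \<times> real" assume "s \<in> ?S"
      then have s: "fst s \<in> {0..1}" by auto
      then have im: "\<beta> (fst s) \<in> path_image \<beta>" by (simp add: path_image_def)
      have 1: "kproj (\<beta> (fst s) + u (snd s)) \<noteq> kproj (z k)" if "k \<in> ?K" for k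
      proof
        assume "kproj (\<beta> (fst s) + u (snd s)) = kproj (z k)"
        then have "\<delta> \<le> dist (\<beta> (fst s)) (\<beta> (fst s) + u (snd s))" using that by (intro \<delta>(2) im) blast
        then show False using norm_u r by (simp add: dist_norm)
      qed
      have 2: "kproj (\<beta> (fst s) + u (snd s)) \<noteq> kproj (\<beta> (fst s))"
      proof
        assume "kproj (\<beta> (fst s) + u (snd s)) = kproj (\<beta> (fst s))"
        moreover have "u (snd s) \<noteq> 0" using norm_u[of "snd s"] r by auto
        ultimately have "1 \<le> dist (\<beta> (fst s) + u (snd s)) (\<beta> (fst s))" by (intro kproj_separated) auto
        then show False using norm_u r by (simp add: dist_norm)
      qed
      have "others_ok (z(j := \<beta> (fst s))) i"
      proof (rule others_okI)
        fix a b assume ab: "a \<in> {1..n} - {i}" "b \<in> {1..n} - {i}" "a \<noteq> b"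
        consider "a = j" "b \<in> ?K" | "b = j" "a \<in> ?K" | "a \<noteq> j" "b \<noteq> j" using ab by blast
        then show "kproj ((z(j := \<beta> (fst s))) a) \<noteq> kproj ((z(j := \<beta> (fst s))) b)"
        proof cases
          case 1
          then show ?thesis using \<beta>(4)[OF s 1(2)] ab(3) by simp
        next
          case 2
          then show ?thesis using \<beta>(4)[OF s 2(2)] ab(3) by simp
        next
          case 3
          then show ?thesis using others_okD[OF z ab] by simp
        qed
      next
        fix k assume "k \<notin> {1..n}"
        then show "(z(j := \<beta> (fst s))) k = 0"
          using others_ok_0[OF z, of k] ij by (cases "k = j") (simp_all del: atLeastAtMost_iff)
      qed
      moreover have "\<beta> (fst s) + u (snd s) \<in> room (z(j := \<beta> (fst s))) i"
        unfolding room_def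
      proof (intro CollectI ballI)
        fix k assume "k \<in> {1..n} - {i}"
        then show "kproj (\<beta> (fst s) + u (snd s)) \<noteq> kproj ((z(j := \<beta> (fst s))) k)"
          using 1[of k] 2 by (cases "k = j") simp_all
      qed
      ultimately show "H s \<in> Y" unfolding H_def by (intro fun_upd_in_Y ij(1))
    qed
    have "convex ?S" by (intro convex_Times) auto
    then obtain \<Psi> where \<Psi>: "\<And>p. path p \<Longrightarrow> path_image p \<subseteq> ?S \<Longrightarrow> \<Lambda> (\<lambda>t. H (p t)) = \<Psi> (pathfinish p) - \<Psi> (pathstart p)"
      using exact_pullback_convex[OF _ cH HY] by metis
    have seg: "\<Lambda> (\<lambda>t. H (linepath a b t)) = \<Psi> b - \<Psi> a" if "a \<in> ?S" "b \<in> ?S" for a b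
      using \<Psi>[of "linepath a b"] closed_segment_subset[OF that \<open>convex ?S\<close>] by simp
    have lp: "linepath (a, b) (c, d) t = (linepath a c t, linepath b d t)" for a b c d t :: real
      by (simp add: linepath_def)
    have u01: "u 0 = u 1" by (simp add: u_def)
    \<comment> \<open>The edges of the square at circle times 0 and 1 are the same path, because the
      circle closes up.\<close>
    have "(\<lambda>t. H (linepath (0, 0) (1, 0) t)) = (\<lambda>t. H (linepath (0, 1) (1, 1) t))"
      by (simp add: lp H_def u01)
    then have sides: "\<Psi> (1, 0) - \<Psi> (0, 0) = \<Psi> (1, 1) - \<Psi> (0, 1)"
      using seg[of "(0, 0)" "(1, 0)"] seg[of "(0, 1)" "(1, 1)"] by simp
    \<comment> \<open>The far edge is the circle around \<open>act 0 1 (z j)\<close>. It projects to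
      the original circle run backwards, since \<open>act 0 1\<close> contains a reflection.\<close>
    have "\<Lambda> (\<lambda>t. H (linepath (1, 0) (1, 1) t)) = \<Lambda> (\<lambda>t. H (linepath (0, 1) (0, 0) t))"
    proof (rule \<Lambda>_cong_proj)
      fix t k
      have "act 0 1 (z j + u (1 - t)) = act 0 1 (z j) + u t"
      proof -
        have "cis (- (2 * pi * (1 - t))) = cis (2 * pi * (t + of_int (- 1)))" by (simp add: algebra_simps)
        also have "\<dots> = cis (2 * pi * t)" by (rule cis_add_2pi_int)
        finally show ?thesis by (simp only: u_def circle_reflection)
      qed
      then have "kproj (act 0 1 (z j) + u t) = kproj (z j + u (1 - t))" by (metis kproj_act)
      then show "kproj (H (linepath (1, 0) (1, 1) t) k) = kproj (H (linepath (0, 1) (0, 0) t) k)"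
        using \<beta>(2,3) by (simp add: lp H_def pathstart_def pathfinish_def linepath_def)
    qed
    then have "\<Psi> (1, 1) - \<Psi> (1, 0) = \<Psi> (0, 0) - \<Psi> (0, 1)"
      using seg[of "(1, 0)" "(1, 1)"] seg[of "(0, 1)" "(0, 0)"] by simp
    \<comment> \<open>Going around the square, the integral over the circle equals its own
      negative.\<close>
    then have "\<Psi> (0, 1) - \<Psi> (0, 0) = 0" using sides by simp
    then have "\<Lambda> (\<lambda>t. H (linepath (0, 0) (0, 1) t)) = 0" using seg[of "(0, 0)" "(0, 1)"] by simp
    moreover have "H (linepath (0, 0) (0, 1) t) = z(i := z j + of_real r * (\<i> * cis (2 * pi * t)))" for t
      using \<beta>(2) by (simp add: lp H_def u_def pathstart_def linepath_def fun_upd_idem)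
    ultimately show "\<Lambda> (\<lambda>t. z(i := z j + of_real r * (\<i> * cis (2 * pi * t)))) = 0" by simp
  qed (use \<delta> in simp)
qed

text \<open>Near a missing point there is no monodromy by \<open>small_circle\<close>, and near any
  other point convexity suffices; exactness then spreads over the whole plane minus the
  obstacles.\<close>

lemma strand_exact:
  assumes z: "others_ok z i" and i: "i \<in> {1..n}"
  shows "exact_on (room z i) (\<lambda>p. \<Lambda> (\<lambda>t. z(i := p t)))"
proof (rule exact_on_complement_countable[OF strand_functional[OF z i] open_room countable_Compl_room])
  fix s
  let ?L = "\<lambda>p. \<Lambda> (\<lambda>t. z(i := p t))"
  show "\<exists>e>0. exact_on (ball s e \<inter> room z i) ?L"
  proof (cases "s \<in> room z i")
    case True
    then obtain e where e: "e > 0" "ball s e \<subseteq> room z i" using open_room open_contains_ball by blast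
    have "exact_on (ball s e) ?L"
      by (rule exact_on_convex[OF path_functional_subset[OF strand_functional[OF z i] e(2)] convex_ball])
    then show ?thesis using e exact_on_subset by blast
  next
    case False
    then obtain j where j: "j \<in> {1..n} - {i}" "kproj s = kproj (z j)" unfolding room_def by blast
    have sk: "kproj s \<noteq> kproj (z k)" if "k \<in> {1..n} - {i} - {j}" for k
    proof -
      have "kproj (z j) \<noteq> kproj (z k)" by (rule others_okD[OF z j(1)]) (use that in auto)
      then show ?thesis using j(2) by simp
    qed
    obtain e where e: "0 < e" "e \<le> 1" "\<And>w k. dist w s < e \<Longrightarrow> w \<noteq> s \<Longrightarrow> k \<in> {1..n} - {i} \<Longrightarrow> kproj w \<noteq> kproj (z k)"
      by (rule punctured_ball_avoiding_obstacles[of "{1..n} - {i}" j s z]) (use sk j(2) in blast)+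
    have be: "ball s e - {s} \<subseteq> room z i"
    proof
      fix w assume "w \<in> ball s e - {s}"
      then have "dist w s < e" "w \<noteq> s" by (auto simp: dist_commute)
      then show "w \<in> room z i" unfolding room_def using e(3) by blast
    qed
    have eq: "ball s e \<inter> room z i = ball s e - {s}" using be False by blast
    \<comment> \<open>\<open>small_circle\<close> treats circles around the entry of string
      \<open>j\<close> itself, but \<open>s\<close> may be any point of its orbit. Replacing the
      entry by \<open>s\<close> leaves all projections unchanged.\<close>
    define z' where "z' = z(j := s)"
    have z': "others_ok z' i"
    proof (rule others_okI)
      fix a b assume ab: "a \<in> {1..n} - {i}" "b \<in> {1..n} - {i}" "a \<noteq> b"
      have "kproj (z' k) = kproj (z k)" for k using j(2) by (simp add: z'_def)
      then show "kproj (z' a) \<noteq> kproj (z' b)" using others_okD[OF z ab] by simp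
    next
      fix k assume "k \<notin> {1..n}"
      then show "z' k = 0"
        using others_ok_0[OF z, of k] j(1) by (cases "k = j") (simp_all add: z'_def del: atLeastAtMost_iff)
    qed
    obtain r0 where r0: "r0 > 0"
      "\<And>r. 0 < r \<Longrightarrow> r < r0 \<Longrightarrow> \<Lambda> (\<lambda>t. z'(i := z' j + of_real r * (\<i> * cis (2 * pi * t)))) = 0"
      using small_circle[OF i _ _ z', of j] j(1) by blast
    define r where "r = min e r0 / 2"
    have r: "0 < r" "r < e" "r < r0" using e r0 by (auto simp: r_def)
    have "?L (\<lambda>t. s + of_real r * (\<i> * cis (2 * pi * t))) =
        \<Lambda> (\<lambda>t. z'(i := z' j + of_real r * (\<i> * cis (2 * pi * t))))"
      by (rule \<Lambda>_cong_proj) (use j in \<open>simp add: z'_def\<close>)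
    also have "\<dots> = 0" using r0(2) r by simp
    finally have "exact_on (ball s e - {s}) ?L"
      by (rule exact_on_punctured_ball[OF path_functional_subset[OF strand_functional[OF z i] be] r(1,2)])
    then show ?thesis using e(1) eq by auto
  qed
qed

end

section \<open>A potential on the configuration space\<close>

context klein_braids_hom
begin

definition strand_pot :: "nat \<Rightarrow> (nat \<Rightarrow> complex) \<Rightarrow> complex \<Rightarrow> real" where
  "strand_pot i z = (SOME \<psi>. potential_on (room z i) (\<lambda>p. \<Lambda> (\<lambda>t. z(i := p t))) \<psi>)"

text \<open>The integral over any path of string \<open>i\<close> from \<open>w\<close> to
  \<open>w'\<close> while the others rest, see \<open>move_eq\<close>.\<close>

definition move :: "nat \<Rightarrow> (nat \<Rightarrow> complex) \<Rightarrow> complex \<Rightarrow> complex \<Rightarrow> real" where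
  "move i z w w' = strand_pot i z w' - strand_pot i z w"

lemma room_fun_upd [simp]: "room (z(i := a)) i = room z i"
  by (simp add: room_def)

text \<open>The choice in \<open>strand_pot\<close> is made from a predicate that involves
  \<open>z\<close> only through \<open>z(i := _)\<close>, so that equal predicates give literally
  the same potential.\<close>

lemma move_fun_upd [simp]: "move i (z(i := a)) = move i z"
  by (simp add: move_def strand_pot_def fun_eq_iff)

lemma move_add: "move i z a b + move i z b c = move i z a c"
  by (simp add: move_def)

lemma move_refl [simp]: "move i z a a = 0"
  by (simp add: move_def)

lemma move_eq:
  assumes "others_ok z i" "i \<in> {1..n}" "path p" "path_image p \<subseteq> room z i"
  shows "\<Lambda> (\<lambda>t. z(i := p t)) = move i z (pathstart p) (pathfinish p)"
proof -
  have "potential_on (room z i) (\<lambda>p. \<Lambda> (\<lambda>t. z(i := p t))) (strand_pot i z)"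
    using strand_exact[OF assms(1,2)] unfolding exact_on_def strand_pot_def by (rule someI_ex)
  from potential_onD[OF this assms(3,4)] show ?thesis by (simp add: move_def)
qed

section \<open>Moves of two different strings commute\<close>

lemma others_ok_fun_upd:
  assumes ok: "\<And>a b. a \<in> {1..n} - {i, j} \<Longrightarrow> b \<in> {1..n} - {i, j} \<Longrightarrow> a \<noteq> b \<Longrightarrow> kproj (z a) \<noteq> kproj (z b)"
    and z0: "\<And>k. k \<notin> {1..n} \<Longrightarrow> z k = 0" and j: "j \<in> {1..n}"
    and v: "\<And>k. k \<in> {1..n} - {i, j} \<Longrightarrow> kproj v \<noteq> kproj (z k)"
  shows "others_ok (z(j := v)) i"
proof (rule others_okI)
  fix a b assume ab: "a \<in> {1..n} - {i}" "b \<in> {1..n} - {i}" "a \<noteq> b"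
  consider "a = j" "b \<in> {1..n} - {i, j}" | "b = j" "a \<in> {1..n} - {i, j}"
    | "a \<in> {1..n} - {i, j}" "b \<in> {1..n} - {i, j}" "a \<noteq> j" "b \<noteq> j" using ab by blast
  then show "kproj ((z(j := v)) a) \<noteq> kproj ((z(j := v)) b)"
  proof cases
    case 1
    then show ?thesis using v[OF 1(2)] ab(3) by simp
  next
    case 2
    then show ?thesis using v[OF 2(2)] ab(3) by simp
  next
    case 3
    then show ?thesis using ok[OF 3(1,2) ab(3)] by simp
  qed
next
  fix k assume "k \<notin> {1..n}"
  then show "(z(j := v)) k = 0" using z0[of k] j by (cases "k = j") (simp_all del: atLeastAtMost_iff)
qed

lemma room_fun_updI:
  assumes "\<And>k. k \<in> {1..n} - {i, j} \<Longrightarrow> kproj w \<noteq> kproj (z k)" "kproj w \<noteq> kproj v"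
  shows "w \<in> room (z(j := v)) i"
  unfolding room_def
proof (intro CollectI ballI)
  fix k assume "k \<in> {1..n} - {i}"
  then show "kproj w \<noteq> kproj ((z(j := v)) k)"
    using assms(1)[of k] assms(2) by (cases "k = j") simp_all
qed

text \<open>Take one path \<gamma> of string \<open>i\<close> that avoids \<open>v0\<close>. By
  compactness string \<open>j\<close> can move in a small disc around \<open>v0\<close> without
  meeting it. The product of the unit interval and this disc is convex, so \<Lambda> has a potential
  there, and both sides are its increment between opposite corners of a rectangle.\<close>

lemma move_square_local:
  assumes ij: "i \<in> {1..n}" "j \<in> {1..n}" "i \<noteq> j"
    and ok: "\<And>a b. a \<in> {1..n} - {i, j} \<Longrightarrow> b \<in> {1..n} - {i, j} \<Longrightarrow> a \<noteq> b \<Longrightarrow> kproj (z a) \<noteq> kproj (z b)"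
    and z0: "\<And>k. k \<notin> {1..n} \<Longrightarrow> z k = 0"
    and w: "\<And>k. k \<in> {1..n} - {i, j} \<Longrightarrow> kproj w \<noteq> kproj (z k)"
    and w': "\<And>k. k \<in> {1..n} - {i, j} \<Longrightarrow> kproj w' \<noteq> kproj (z k)"
    and v0: "\<And>k. k \<in> {1..n} - {i, j} \<Longrightarrow> kproj v0 \<noteq> kproj (z k)" "kproj w \<noteq> kproj v0" "kproj w' \<noteq> kproj v0"
  shows "\<exists>d>0. \<forall>v. dist v v0 < d \<longrightarrow>
     move j (z(i := w)) v0 v + move i (z(j := v)) w w' = move i (z(j := v0)) w w' + move j (z(i := w')) v0 v"
proof -
  let ?K = "{1..n} - {i, j}"
  have rw: "w \<in> room (z(j := v0)) i" and rw': "w' \<in> room (z(j := v0)) i"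
    by (rule room_fun_updI; use w w' v0 in blast)+
  obtain \<gamma> where \<gamma>: "path \<gamma>" "pathstart \<gamma> = w" "pathfinish \<gamma> = w'"
    "\<And>t k. t \<in> {0..1} \<Longrightarrow> k \<in> {1..n} - {i} \<Longrightarrow> kproj (\<gamma> t) \<noteq> kproj ((z(j := v0)) k)"
    by (rule path_avoiding_obstacles[of "{1..n} - {i}" w "z(j := v0)" w'])
      (use rw rw' in \<open>unfold room_def, blast+\<close>)
  have \<gamma>z: "kproj (\<gamma> t) \<noteq> kproj (z k)" if "t \<in> {0..1}" "k \<in> ?K" for t k
    using \<gamma>(4)[OF that(1), of k] that(2) by simp
  have \<gamma>v: "kproj (\<gamma> t) \<noteq> kproj v0" if "t \<in> {0..1}" for t
    using \<gamma>(4)[OF that, of j] ij by simp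
  have "path_image \<gamma> \<inter> {u. kproj u = kproj v0} = {}"
    using \<gamma>v unfolding path_image_def by blast
  then obtain d1 where d1: "d1 > 0" "\<And>x y. x \<in> path_image \<gamma> \<Longrightarrow> kproj y = kproj v0 \<Longrightarrow> d1 \<le> dist x y"
    using separate_compact_closed[OF compact_path_image[OF \<gamma>(1)] closed_orbit[of "kproj v0"]] by blast
  have "open (- {u. \<exists>k\<in>?K. kproj u = kproj (z k)})" by (intro open_Compl closed_obstacles) simp
  moreover have "v0 \<in> - {u. \<exists>k\<in>?K. kproj u = kproj (z k)}" using v0(1) by blast
  ultimately obtain d2 where d2: "d2 > 0" "\<And>v. dist v v0 < d2 \<Longrightarrow> v \<in> - {u. \<exists>k\<in>?K. kproj u = kproj (z k)}"
    unfolding open_dist by blast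
  define d where "d = min d1 d2"
  have vz: "kproj v \<noteq> kproj (z k)" if "dist v v0 < d" "k \<in> ?K" for v k
    using d2(2)[of v] that by (auto simp: d_def)
  have \<gamma>v': "kproj (\<gamma> t) \<noteq> kproj v" if "dist v v0 < d" "t \<in> {0..1}" for v t
  proof
    assume "kproj (\<gamma> t) = kproj v"
    then obtain m k where mk: "\<gamma> t = act m k v" by (metis kproj_eqE)
    \<comment> \<open>If \<gamma> met the orbit of \<open>v\<close>, the same deck transformation
      would take \<open>v0\<close> to a point of its orbit within distance \<open>d\<close> of
      \<gamma>.\<close>
    have "d1 \<le> dist (\<gamma> t) (act m k v0)" using that(2) by (intro d1(2)) (simp_all add: path_image_def)
    then show False using that(1) by (simp add: mk d_def)
  qed
  show ?thesis
  proof (intro exI[of _ d] conjI allI impI)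
    fix v assume v: "dist v v0 < d"
    let ?C = "{0..1::real} \<times> ball v0 d"
    define H where "H = (\<lambda>s. z(j := snd s, i := \<gamma> (fst s)))"
    have "continuous_on {0..1} \<gamma>" using \<gamma>(1) by (simp add: path_def)
    then have "continuous_on ?C (\<lambda>s. \<gamma> (fst s))"
      by (rule continuous_on_compose2) (auto intro!: continuous_intros)
    then have cH: "continuous_on ?C H"
      unfolding H_def
    proof (intro continuous_on_coordinatewise_then_product)
      fix k assume "continuous_on ?C (\<lambda>s. \<gamma> (fst s))"
      then show "continuous_on ?C (\<lambda>s. (z(j := snd s, i := \<gamma> (fst s))) k)"
        by (cases "k = i"; cases "k = j") (simp_all add: continuous_on_snd)
    qed
    have okv: "others_ok (z(j := v)) i" if "dist v v0 < d" for v
      by (rule others_ok_fun_upd) (use ok z0 ij vz[OF that] in blast)+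
    have rv: "\<gamma> t \<in> room (z(j := v)) i" if "dist v v0 < d" "t \<in> {0..1}" for v t
      by (rule room_fun_updI) (use \<gamma>z \<gamma>v' that in blast)+
    have HY: "H \<in> ?C \<rightarrow> Y"
    proof (rule Pi_I)
      fix s assume "s \<in> ?C"
      then have s: "fst s \<in> {0..1}" "dist (snd s) v0 < d" by (auto simp: dist_commute)
      show "H s \<in> Y" unfolding H_def by (rule fun_upd_in_Y[OF okv[OF s(2)] ij(1) rv[OF s(2,1)]])
    qed
    have C: "convex ?C" by (intro convex_Times) auto
    obtain \<Psi> where \<Psi>: "\<And>p. path p \<Longrightarrow> path_image p \<subseteq> ?C \<Longrightarrow> \<Lambda> (\<lambda>t. H (p t)) = \<Psi> (pathfinish p) - \<Psi> (pathstart p)"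
      using exact_pullback_convex[OF C cH HY] by metis
    have mi: "move i (z(j := v)) w w' = \<Psi> (1, v) - \<Psi> (0, v)" if v: "dist v v0 < d" for v
    proof -
      have "path_image \<gamma> \<subseteq> room (z(j := v)) i" using rv[OF v] unfolding path_image_def by blast
      then have "move i (z(j := v)) w w' = \<Lambda> (\<lambda>t. (z(j := v))(i := \<gamma> t))"
        using move_eq[OF okv[OF v] ij(1) \<gamma>(1)] \<gamma>(2,3) by simp
      also have "\<dots> = \<Lambda> (\<lambda>t. H (linepath (0, v) (1, v) t))"
        by (simp add: H_def linepath_def algebra_simps)
      also have "\<dots> = \<Psi> (1, v) - \<Psi> (0, v)"
      proof -
        have "closed_segment (0, v) (1, v) \<subseteq> ?C"
          using v by (intro closed_segment_subset C) (auto simp: dist_commute)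
        then show ?thesis using \<Psi>[of "linepath (0, v) (1, v)"] by simp
      qed
      finally show ?thesis .
    qed
    have mj: "move j (z(i := \<gamma> c)) v0 v = \<Psi> (c, v) - \<Psi> (c, v0)" if c: "c \<in> {0..1}" for c
    proof -
      have 1: "others_ok (z(i := \<gamma> c)) j"
        by (rule others_ok_fun_upd) (use ok z0 ij \<gamma>z[OF c] insert_commute[of i j] in \<open>auto simp del: atLeastAtMost_iff\<close>)
      have seg: "closed_segment v0 v \<subseteq> ball v0 d"
        using v d1 d2 by (intro closed_segment_subset) (auto simp: d_def dist_commute)
      have 2: "path_image (linepath v0 v) \<subseteq> room (z(i := \<gamma> c)) j"
      proof
        fix u assume "u \<in> path_image (linepath v0 v)"
        then have u: "dist u v0 < d" using seg by (auto simp: dist_commute)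
        show "u \<in> room (z(i := \<gamma> c)) j"
          by (rule room_fun_updI) (use vz[OF u] \<gamma>v'[OF u c] insert_commute[of i j] in metis)+
      qed
      have "move j (z(i := \<gamma> c)) v0 v = \<Lambda> (\<lambda>t. (z(i := \<gamma> c))(j := linepath v0 v t))"
        using move_eq[OF 1 ij(2) path_linepath 2] by simp
      also have "(\<lambda>t. (z(i := \<gamma> c))(j := linepath v0 v t)) = (\<lambda>t. H (linepath (c, v0) (c, v) t))"
        using ij(3) by (simp add: H_def linepath_def fun_eq_iff algebra_simps)
      also have "\<Lambda> \<dots> = \<Psi> (c, v) - \<Psi> (c, v0)"
      proof -
        have "closed_segment (c, v0) (c, v) \<subseteq> ?C"
          using v c d1 d2 by (intro closed_segment_subset C) (auto simp: dist_commute d_def)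
        then show ?thesis using \<Psi>[of "linepath (c, v0) (c, v)"] by simp
      qed
      finally show ?thesis .
    qed
    have "\<gamma> 0 = w" "\<gamma> 1 = w'" using \<gamma>(2,3) by (simp_all add: pathstart_def pathfinish_def)
    then show "move j (z(i := w)) v0 v + move i (z(j := v)) w w' = move i (z(j := v0)) w w' + move j (z(i := w')) v0 v"
      using mi[OF v] mi[of v0] mj[of 0] mj[of 1] d1 d2 by (simp add: d_def)
  qed (use d1 d2 in \<open>simp add: d_def\<close>)
qed

text \<open>A path of string \<open>i\<close> that avoids a whole path of string \<open>j\<close>
  need not be at hand, so only small moves of \<open>j\<close> are compared directly. They show that
  \<open>F\<close> is locally constant in the position of \<open>j\<close>, which varies in the
  plane minus countably many points, a connected set. The claim is
  \<open>F y0 = F y\<close>.\<close>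

lemma move_square:
  assumes ij: "i \<in> {1..n}" "j \<in> {1..n}" "i \<noteq> j"
    and ok: "\<And>a b. a \<in> {1..n} - {i, j} \<Longrightarrow> b \<in> {1..n} - {i, j} \<Longrightarrow> a \<noteq> b \<Longrightarrow> kproj (z a) \<noteq> kproj (z b)"
    and z0: "\<And>k. k \<notin> {1..n} \<Longrightarrow> z k = 0"
    and w: "\<And>k. k \<in> {1..n} - {i, j} \<Longrightarrow> kproj w \<noteq> kproj (z k)"
    and w': "\<And>k. k \<in> {1..n} - {i, j} \<Longrightarrow> kproj w' \<noteq> kproj (z k)"
    and y: "\<And>k. k \<in> {1..n} - {i, j} \<Longrightarrow> kproj y \<noteq> kproj (z k)" "kproj w \<noteq> kproj y" "kproj w' \<noteq> kproj y"
    and y0: "\<And>k. k \<in> {1..n} - {i, j} \<Longrightarrow> kproj y0 \<noteq> kproj (z k)" "kproj w \<noteq> kproj y0" "kproj w' \<noteq> kproj y0"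
  shows "move j (z(i := w)) y0 y + move i (z(j := y)) w w' = move i (z(j := y0)) w w' + move j (z(i := w')) y0 y"
proof -
  define A where "A = {v. (\<forall>k\<in>{1..n} - {i, j}. kproj v \<noteq> kproj (z k)) \<and> kproj w \<noteq> kproj v \<and> kproj w' \<noteq> kproj v}"
  define F where "F = (\<lambda>v. move j (z(i := w)) y0 v + move i (z(j := v)) w w' - move j (z(i := w')) y0 v)"
  have "- A = {v. \<exists>k\<in>{1..n} - {i, j}. kproj v = kproj (z k)} \<union> {v. kproj v = kproj w} \<union> {v. kproj v = kproj w'}"
    unfolding A_def by (auto simp: eq_commute[of "kproj w"] eq_commute[of "kproj w'"])
  then have "countable (- A)" using countable_obstacles[of "{1..n} - {i, j}" z] countable_orbit by (simp add: countable_Un)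
  then have "connected (- (- A))"
    by (intro path_connected_imp_connected path_connected_complement_countable) simp_all
  then have "connected A" by simp
  have "F y0 = F y"
  proof (rule connected_local_const[OF \<open>connected A\<close>])
    show "y0 \<in> A" "y \<in> A" unfolding A_def using y y0 by blast+
    show "\<forall>v0\<in>A. \<forall>\<^sub>F v in at v0 within A. F v0 = F v"
    proof
      fix v0 assume "v0 \<in> A"
      then have v0: "\<And>k. k \<in> {1..n} - {i, j} \<Longrightarrow> kproj v0 \<noteq> kproj (z k)" "kproj w \<noteq> kproj v0" "kproj w' \<noteq> kproj v0"
        unfolding A_def by blast+
      have "\<exists>d>0. \<forall>v. dist v v0 < d \<longrightarrow>
         move j (z(i := w)) v0 v + move i (z(j := v)) w w' = move i (z(j := v0)) w w' + move j (z(i := w')) v0 v"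
      proof (rule move_square_local[OF ij])
        show "kproj (z a) \<noteq> kproj (z b)" if "a \<in> {1..n} - {i, j}" "b \<in> {1..n} - {i, j}" "a \<noteq> b" for a b
          by (rule ok[OF that])
        show "z k = 0" if "k \<notin> {1..n}" for k by (rule z0[OF that])
        show "kproj w \<noteq> kproj (z k)" "kproj w' \<noteq> kproj (z k)" "kproj v0 \<noteq> kproj (z k)"
          if "k \<in> {1..n} - {i, j}" for k
          by (rule w[OF that] w'[OF that] v0(1)[OF that])+
      qed (rule v0)+
      then obtain d where d: "d > 0" "\<And>v. dist v v0 < d \<Longrightarrow>
         move j (z(i := w)) v0 v + move i (z(j := v)) w w' = move i (z(j := v0)) w w' + move j (z(i := w')) v0 v"
        by metis
      have "F v0 = F v" if "dist v v0 < d" for v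
        using d(2)[OF that] move_add[of j "z(i := w)" y0 v0 v] move_add[of j "z(i := w')" y0 v0 v]
        by (simp add: F_def)
      then show "\<forall>\<^sub>F v in at v0 within A. F v0 = F v" using d(1) unfolding eventually_at by blast
    qed
  qed
  then show ?thesis by (simp add: F_def)
qed

end

text \<open>Potentials are first defined on a dense set of configurations of product form, on which the
  points of different strings never lie on a common orbit: string \<open>i\<close> is restricted to heights in
  a coset of the rationals that depends on \<open>i\<close>.\<close>

definition irr :: real where
  "irr = (SOME c. c \<notin> \<rat>)"

lemma irr: "irr \<notin> \<rat>"
proof -
  have "\<exists>c::real. c \<notin> \<rat>"
  proof (rule ccontr)
    assume "\<nexists>c::real. c \<notin> \<rat>"
    then have "(UNIV :: real set) = \<rat>" by blast
    then show False using countable_rat uncountable_UNIV_real by metis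
  qed
  then show ?thesis unfolding irr_def by (rule someI_ex)
qed

definition level :: "nat \<Rightarrow> complex set" where
  "level i = {u. Im u - of_nat i * irr \<in> \<rat>}"

text \<open>Deck transformations change heights by integers. Points of one orbit on two levels would
  therefore make a nonzero integer multiple of \<open>irr\<close> rational.\<close>

lemma level_disjoint:
  assumes u: "u \<in> level i" and v: "v \<in> level j" and ij: "i \<noteq> j" shows "kproj u \<noteq> kproj v"
proof
  assume "kproj u = kproj v"
  then obtain m k where mk: "v = act m k u" by (rule kproj_eqE)
  have "(Im u - of_nat i * irr) - (Im v - of_nat j * irr) + of_int k \<in> \<rat>"
    using u v unfolding level_def by (metis Rats_add Rats_diff Rats_of_int mem_Collect_eq)
  then have "(of_nat j - of_nat i) * irr \<in> \<rat>" by (simp add: mk algebra_simps)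
  then have "((of_nat j - of_nat i) * irr) / (of_nat j - of_nat i) \<in> \<rat>" by (intro Rats_divide Rats_diff Rats_of_nat)
  then show False using ij irr by simp
qed

lemma level_dense:
  assumes "e > 0" obtains v where "v \<in> level i" "dist v u < e"
proof -
  obtain r where r: "r \<in> \<rat>" "Im u - of_nat i * irr < r" "r < Im u - of_nat i * irr + e"
    using Rats_dense_in_real[of "Im u - of_nat i * irr" "Im u - of_nat i * irr + e"] assms by auto
  have "dist (Complex (Re u) (r + of_nat i * irr)) u = \<bar>r + of_nat i * irr - Im u\<bar>"
    by (simp add: dist_norm cmod_def)
  then show thesis
    using r by (intro that[of "Complex (Re u) (r + of_nat i * irr)"]) (auto simp: level_def)
qed

lemma finite_common_bound:
  fixes Q :: "'a \<Rightarrow> real \<Rightarrow> bool"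
  assumes "finite A" "\<And>a. a \<in> A \<Longrightarrow> \<exists>e>0. Q a e" "\<And>a e e'. Q a e \<Longrightarrow> 0 < e' \<Longrightarrow> e' \<le> e \<Longrightarrow> Q a e'"
  shows "\<exists>e>0. \<forall>a\<in>A. Q a e"
  using assms(1,2)
proof (induction A rule: finite_induct)
  case (insert x F)
  obtain e1 where 1: "e1 > 0" "\<And>a. a \<in> F \<Longrightarrow> Q a e1" using insert by blast
  obtain e2 where 2: "e2 > 0" "Q x e2" using insert(4)[of x] by blast
  show ?case
  proof (intro exI[of _ "min e1 e2"] conjI ballI)
    fix a assume "a \<in> insert x F"
    then show "Q a (min e1 e2)" using 1 2 assms(3)[of a e1 "min e1 e2"] assms(3)[of x e2 "min e1 e2"] by auto
  qed (use 1 2 in simp)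
qed (auto intro: exI[of _ 1])

context klein_braids_hom
begin

section \<open>The potential on the grid\<close>

definition grid :: "(nat \<Rightarrow> complex) set" where
  "grid = {p. (\<forall>i\<in>{1..n}. p i \<in> level i) \<and> (\<forall>i. i \<notin> {1..n} \<longrightarrow> p i = 0)}"

lemma gridD: "p \<in> grid \<Longrightarrow> i \<in> {1..n} \<Longrightarrow> p i \<in> level i"
  and grid_0: "p \<in> grid \<Longrightarrow> i \<notin> {1..n} \<Longrightarrow> p i = 0"
  unfolding grid_def by blast+

lemma grid_fun_upd:
  assumes "p \<in> grid" "i \<in> {1..n}" "s \<in> level i" shows "p(i := s) \<in> grid"
  using assms unfolding grid_def by (auto simp del: atLeastAtMost_iff)

definition origin :: "nat \<Rightarrow> complex" where
  "origin i = (if i \<in> {1..n} then Complex 0 (of_nat i * irr) else 0)"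

lemma origin_level: "i \<in> {1..n} \<Longrightarrow> origin i \<in> level i"
  by (simp add: origin_def level_def)

definition mix :: "nat \<Rightarrow> (nat \<Rightarrow> complex) \<Rightarrow> nat \<Rightarrow> complex" where
  "mix k p = (\<lambda>l. if l < k then p l else origin l)"

lemma mix_in_grid: "p \<in> grid \<Longrightarrow> mix k p \<in> grid"
  using origin_level unfolding grid_def mix_def by (auto simp: origin_def simp del: atLeastAtMost_iff)

lemma mix_Suc: "mix (Suc k) p = (mix k p)(k := p k)"
  by (auto simp: mix_def fun_eq_iff less_Suc_eq)

text \<open>The integral along the route from \<open>origin\<close> to \<open>p\<close> that moves
  the strings one after another in the order of their indices; \<open>mix k p\<close> is the
  configuration just before string \<open>k\<close> moves.\<close>

definition grid_pot :: "(nat \<Rightarrow> complex) \<Rightarrow> real" where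
  "grid_pot p = (\<Sum>k\<in>{1..n}. move k (mix k p) (origin k) (p k))"

text \<open>The terms before \<open>i\<close> are unchanged, term \<open>i\<close> changes by the
  move from \<open>p i\<close> to \<open>s\<close>, and each later term is carried past this move by
  \<open>move_square\<close>. The levels keep these squares free of collisions.\<close>

lemma grid_step:
  assumes p: "p \<in> grid" and i: "i \<in> {1..n}" and s: "s \<in> level i"
  shows "grid_pot (p(i := s)) - grid_pot p = move i p (p i) s"
proof -
  define p' where "p' = p(i := s)"
  have p': "p' \<in> grid" unfolding p'_def using p i s by (rule grid_fun_upd)
  define d where "d k = move k (mix k p') (origin k) (p' k) - move k (mix k p) (origin k) (p k)" for k
  \<comment> \<open>On the right, string \<open>i\<close> moves while the strings above
    \<open>m\<close> still rest at the origin. The induction starts at \<open>m = i\<close>, and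
    \<open>m = n\<close> is the claim.\<close>
  have "m \<le> n \<longrightarrow> (\<Sum>k\<in>{1..m}. d k) = move i (mix (Suc m) p) (p i) s" if "i \<le> m" for m
    using that
  proof (induction m rule: dec_induct)
    case base
    have mix: "mix k p' = mix k p" if "k \<le> i" for k using that by (auto simp: mix_def p'_def fun_eq_iff)
    have "(\<Sum>k\<in>{1..i}. d k) = (\<Sum>k\<in>{i}. d k)"
    proof (rule sum.mono_neutral_right)
      show "\<forall>k\<in>{1..i} - {i}. d k = 0"
      proof
        fix k assume "k \<in> {1..i} - {i}"
        then have "k \<le> i" "k \<noteq> i" by auto
        then show "d k = 0" by (simp add: d_def mix) (simp add: p'_def)
      qed
    qed (use i in auto)
    also have "\<dots> = move i (mix i p) (p i) s"
      by (simp add: d_def mix) (simp add: p'_def move_def)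
    also have "\<dots> = move i (mix (Suc i) p) (p i) s" by (simp add: mix_Suc)
    finally show ?case by simp
  next
    case (step m)
    show ?case
    proof
      assume "Suc m \<le> n"
      define k where "k = Suc m"
      have k: "k \<in> {1..n}" "i < k" "k \<noteq> i" using \<open>Suc m \<le> n\<close> step(1) i by (auto simp: k_def)
      define z where "z = mix k p"
      have z: "z \<in> grid" unfolding z_def using p by (rule mix_in_grid)
      have lev: "kproj u \<noteq> kproj (z l)" if "u \<in> level a" "l \<in> {1..n}" "a \<noteq> l" for u a l
        by (rule level_disjoint[OF that(1) gridD[OF z that(2)] that(3)])
      have "move k (z(i := p i)) (origin k) (p k) + move i (z(k := p k)) (p i) s =
        move i (z(k := origin k)) (p i) s + move k (z(i := s)) (origin k) (p k)"
      proof (rule move_square[OF i k(1) k(3)[symmetric]])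
        show "kproj (z a) \<noteq> kproj (z b)" if "a \<in> {1..n} - {i, k}" "b \<in> {1..n} - {i, k}" "a \<noteq> b" for a b
          by (rule lev[OF gridD[OF z]]) (use that in auto)
        show "z l = 0" if "l \<notin> {1..n}" for l using grid_0[OF z that] .
        show "kproj (p i) \<noteq> kproj (z l)" "kproj s \<noteq> kproj (z l)" "kproj (p k) \<noteq> kproj (z l)" "kproj (origin k) \<noteq> kproj (z l)"
          if "l \<in> {1..n} - {i, k}" for l
          using that lev[OF gridD[OF p i], of l] lev[OF s, of l] lev[OF gridD[OF p k(1)], of l] lev[OF origin_level[OF k(1)], of l]
          by blast+
        show "kproj (p i) \<noteq> kproj (p k)" "kproj s \<noteq> kproj (p k)" "kproj (p i) \<noteq> kproj (origin k)" "kproj s \<noteq> kproj (origin k)"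
          using level_disjoint[of _ i _ k] gridD[OF p i] s gridD[OF p k(1)] origin_level[OF k(1)] k(3) by blast+
      qed
      moreover have "z(i := p i) = mix k p" "z(k := p k) = mix (Suc k) p" "z(k := origin k) = mix k p" "z(i := s) = mix k p'"
        using k by (auto simp: z_def mix_def p'_def fun_eq_iff less_Suc_eq)
      ultimately have "move i (mix (Suc k) p) (p i) s = move i (mix k p) (p i) s + d k"
        using k(3) by (simp add: d_def p'_def)
      then show "(\<Sum>k\<in>{1..Suc m}. d k) = move i (mix (Suc (Suc m)) p) (p i) s"
        using step(3) \<open>Suc m \<le> n\<close> by (simp add: k_def)
    qed
  qed
  then have "(\<Sum>k\<in>{1..n}. d k) = move i (mix (Suc n) p) (p i) s" using i by simp
  moreover have "mix (Suc n) p = p"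
  proof
    fix l
    show "mix (Suc n) p l = p l"
      using grid_0[OF p, of l] by (cases "l < Suc n") (simp_all add: mix_def origin_def)
  qed
  moreover have "(\<Sum>k\<in>{1..n}. d k) = grid_pot p' - grid_pot p"
    by (simp add: d_def grid_pot_def sum_subtractf)
  ultimately show ?thesis by (simp add: p'_def)
qed

section \<open>From the grid to all configurations\<close>

definition polydisc :: "(nat \<Rightarrow> complex) \<Rightarrow> real \<Rightarrow> (nat \<Rightarrow> complex) set" where
  "polydisc u e = {v. (\<forall>i\<in>{1..n}. dist (v i) (u i) < e) \<and> (\<forall>i. i \<notin> {1..n} \<longrightarrow> v i = 0)}"

lemma polydiscD: "v \<in> polydisc u e \<Longrightarrow> i \<in> {1..n} \<Longrightarrow> dist (v i) (u i) < e"
  and polydisc_0: "v \<in> polydisc u e \<Longrightarrow> i \<notin> {1..n} \<Longrightarrow> v i = 0"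
  and polydiscI: "(\<And>i. i \<in> {1..n} \<Longrightarrow> dist (v i) (u i) < e) \<Longrightarrow> (\<And>i. i \<notin> {1..n} \<Longrightarrow> v i = 0) \<Longrightarrow> v \<in> polydisc u e"
  unfolding polydisc_def by blast+

lemma polydisc_centre: "u \<in> Y \<Longrightarrow> e > 0 \<Longrightarrow> u \<in> polydisc u e"
  by (rule polydiscI) (simp_all add: Y_0 del: atLeastAtMost_iff)

lemma polydisc_in_Y:
  assumes u: "u \<in> Y" obtains e where "e > 0" "polydisc u e \<subseteq> Y"
proof -
  define Q where "Q ab e \<longleftrightarrow> (fst ab \<noteq> snd ab \<longrightarrow>
      (\<forall>z' w'. dist z' (u (fst ab)) < e \<longrightarrow> dist w' (u (snd ab)) < e \<longrightarrow> kproj z' \<noteq> kproj w'))" for ab and e :: real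
  have "\<exists>e>0. \<forall>ab\<in>{1..n} \<times> {1..n}. Q ab e"
  proof (rule finite_common_bound)
    fix ab assume ab: "ab \<in> {1..n} \<times> {1..n}"
    show "\<exists>e>0. Q ab e"
    proof (cases "fst ab = snd ab")
      case True
      then have "Q ab 1" by (simp add: Q_def)
      then show ?thesis by (intro exI[of _ 1]) simp
    next
      case False
      have "fst ab \<in> {1..n}" "snd ab \<in> {1..n}" using ab by auto
      from YD[OF u this False] obtain e where e: "e > 0"
        "\<And>z' w'. dist z' (u (fst ab)) < e \<Longrightarrow> dist w' (u (snd ab)) < e \<Longrightarrow> kproj z' \<noteq> kproj w'"
        by (rule kproj_neq_nhds) blast
      then have "Q ab e" unfolding Q_def by blast
      with e(1) show ?thesis by blast
    qed
  next
    fix ab and e e' :: real assume Q: "Q ab e" and "0 < e'" "e' \<le> e"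
    show "Q ab e'"
      unfolding Q_def
    proof (intro impI allI)
      fix z' w' assume "fst ab \<noteq> snd ab" "dist z' (u (fst ab)) < e'" "dist w' (u (snd ab)) < e'"
      then show "kproj z' \<noteq> kproj w'"
        using Q[unfolded Q_def, rule_format, of z' w'] \<open>e' \<le> e\<close> by simp
    qed
  qed simp
  then obtain e where e0: "e > 0" "\<forall>ab\<in>{1..n} \<times> {1..n}. Q ab e" by blast
  have e: "kproj z' \<noteq> kproj w'" if "a \<in> {1..n}" "b \<in> {1..n}" "a \<noteq> b" "dist z' (u a) < e" "dist w' (u b) < e" for a b z' w'
    using bspec[OF e0(2), of "(a, b)"] that unfolding Q_def by simp
  have "polydisc u e \<subseteq> Y"
  proof
    fix v assume v: "v \<in> polydisc u e"
    show "v \<in> Y"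
    proof (rule YI)
      show "kproj (v a) \<noteq> kproj (v b)" if "a \<in> {1..n}" "b \<in> {1..n}" "a \<noteq> b" for a b
        by (rule e[OF that polydiscD[OF v that(1)] polydiscD[OF v that(2)]])
    qed (rule polydisc_0[OF v])
  qed
  with e0(1) show thesis by (rule that)
qed

lemma polydisc_inner:
  assumes v: "v \<in> polydisc u e" obtains d where "d > 0" "polydisc v d \<subseteq> polydisc u e"
proof -
  have "\<exists>d>0. \<forall>i\<in>{1..n}. dist (v i) (u i) + d \<le> e"
  proof (rule finite_common_bound)
    show "\<exists>d>0. dist (v i) (u i) + d \<le> e" if "i \<in> {1..n}" for i
      using polydiscD[OF v that] by (intro exI[of _ "e - dist (v i) (u i)"]) simp
  qed auto
  then obtain d where d: "d > 0" "\<And>i. i \<in> {1..n} \<Longrightarrow> dist (v i) (u i) + d \<le> e" by blast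
  have "polydisc v d \<subseteq> polydisc u e"
  proof
    fix w assume w: "w \<in> polydisc v d"
    show "w \<in> polydisc u e"
    proof (rule polydiscI)
      fix i assume i: "i \<in> {1..n}"
      show "dist (w i) (u i) < e" using polydiscD[OF w i] d(2)[OF i] dist_triangle[of "w i" "u i" "v i"] by simp
    qed (rule polydisc_0[OF w])
  qed
  with d(1) show thesis by (rule that)
qed

lemma polydisc_convex:
  assumes a: "a \<in> polydisc u e" and b: "b \<in> polydisc u e" and s: "0 \<le> s" "s \<le> 1"
  shows "(\<lambda>i. (1 - s) *\<^sub>R a i + s *\<^sub>R b i) \<in> polydisc u e"
proof (rule polydiscI)
  fix i assume i: "i \<in> {1..n}"
  have "(1 - s) *\<^sub>R a i + s *\<^sub>R b i \<in> ball (u i) e"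
    using polydiscD[OF a i] polydiscD[OF b i] s by (intro convexD_alt[OF convex_ball]) (simp_all add: dist_commute)
  then show "dist ((1 - s) *\<^sub>R a i + s *\<^sub>R b i) (u i) < e" by (simp add: dist_commute)
next
  fix i assume "i \<notin> {1..n}"
  then show "(1 - s) *\<^sub>R a i + s *\<^sub>R b i = 0" using polydisc_0[OF a, of i] polydisc_0[OF b, of i] by simp
qed

lemma path_connected_polydisc: "path_connected (polydisc u e)"
  unfolding path_connected_def
proof (intro ballI)
  fix a b assume ab: "a \<in> polydisc u e" "b \<in> polydisc u e"
  let ?p = "\<lambda>t i. (1 - t) *\<^sub>R a i + t *\<^sub>R b i"
  have "path ?p" unfolding path_def by (intro continuous_on_coordinatewise_then_product continuous_intros)
  moreover have "path_image ?p \<subseteq> polydisc u e"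
    unfolding path_image_def using polydisc_convex[OF ab] by auto
  moreover have "pathstart ?p = a" "pathfinish ?p = b" by (simp_all add: pathstart_def pathfinish_def)
  ultimately show "\<exists>g. path g \<and> path_image g \<subseteq> polydisc u e \<and> pathstart g = a \<and> pathfinish g = b" by blast
qed

text \<open>The straight-line homotopy again, now coordinate by coordinate: the product topology on
  sequences is induced by no norm, so \<open>exact_on_convex\<close> does not apply.\<close>

lemma exact_on_polydisc:
  assumes P: "polydisc u e \<subseteq> Y" shows "exact_on (polydisc u e) \<Lambda>"
proof (rule exact_onI[OF path_connected_polydisc P])
  fix p q assume *: "path p" "path q" "path_image p \<subseteq> polydisc u e" "path_image q \<subseteq> polydisc u e"
    "pathstart p = pathstart q" "pathfinish p = pathfinish q"
  have pq: "p t \<in> polydisc u e" "q t \<in> polydisc u e" if "t \<in> {0..1}" for t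
    using *(3,4) that unfolding path_image_def by blast+
  have "homotopic_paths Y p q"
    unfolding homotopic_paths
  proof (intro exI[of _ "\<lambda>x i. (1 - fst x) *\<^sub>R p (snd x) i + fst x *\<^sub>R q (snd x) i"] conjI ballI)
    have c: "continuous_on ({0..1} \<times> {0..1}) (\<lambda>x. f (snd x) i)" if "path f" for f :: "real \<Rightarrow> nat \<Rightarrow> complex" and i
    proof (rule continuous_on_compose2[of "{0..1}" "\<lambda>t. f t i"])
      show "continuous_on {0..1} (\<lambda>t. f t i)"
        using that unfolding path_def by (rule continuous_on_product_then_coordinatewise)
    qed (auto intro!: continuous_intros)
    show "continuous_on ({0..1} \<times> {0..1}) (\<lambda>x i. (1 - fst x) *\<^sub>R p (snd x) i + fst x *\<^sub>R q (snd x) i)"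
      by (intro continuous_on_coordinatewise_then_product continuous_intros c *)
    show "(\<lambda>x i. (1 - fst x) *\<^sub>R p (snd x) i + fst x *\<^sub>R q (snd x) i) \<in> {0..1} \<times> {0..1} \<rightarrow> Y"
    proof (rule Pi_I)
      fix x :: "real \<times> real" assume "x \<in> {0..1} \<times> {0..1}"
      then have "(\<lambda>i. (1 - fst x) *\<^sub>R p (snd x) i + fst x *\<^sub>R q (snd x) i) \<in> polydisc u e"
        using pq[of "snd x"] by (intro polydisc_convex) auto
      then show "(\<lambda>i. (1 - fst x) *\<^sub>R p (snd x) i + fst x *\<^sub>R q (snd x) i) \<in> Y" using P by blast
    qed
  qed (use *(5,6) in \<open>auto simp: pathstart_def pathfinish_def fun_eq_iff algebra_simps\<close>)
  then show "\<Lambda> p = \<Lambda> q" by (rule homotopic)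
qed

lemma grid_dense:
  assumes "e > 0" obtains v where "v \<in> grid" "v \<in> polydisc u e"
proof -
  have "\<forall>i. \<exists>v. v \<in> level i \<and> dist v (u i) < e" using level_dense[OF assms] by metis
  then obtain f where f: "\<And>i. f i \<in> level i" "\<And>i. dist (f i) (u i) < e" by metis
  let ?v = "\<lambda>i. if i \<in> {1..n} then f i else 0"
  show thesis
  proof (rule that)
    show "?v \<in> grid" using f(1) unfolding grid_def by simp
    show "?v \<in> polydisc u e" using f(2) unfolding polydisc_def by simp
  qed
qed

text \<open>The coordinates are exchanged one at a time. Grid and polydisc have product form, so the
  intermediate configurations lie in both, and each exchange changes \<Phi> and
  \<open>grid_pot\<close> by the same \<open>move\<close>.\<close>

lemma grid_pot_polydisc:
  assumes P: "polydisc u e \<subseteq> Y" and \<Phi>: "potential_on (polydisc u e) \<Lambda> \<Phi>"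
    and v: "v \<in> grid" "v \<in> polydisc u e" and v': "v' \<in> grid" "v' \<in> polydisc u e"
  shows "\<Phi> v' - grid_pot v' = \<Phi> v - grid_pot v"
proof -
  define z where "z k = (\<lambda>l. if l < k then v' l else v l)" for k
  have zg: "z k \<in> grid" for k
    using v(1) v'(1) unfolding grid_def z_def by (simp del: atLeastAtMost_iff)
  have zP: "z k \<in> polydisc u e" for k
    using v(2) v'(2) unfolding polydisc_def z_def by (simp del: atLeastAtMost_iff)
  have "k \<le> Suc n \<longrightarrow> \<Phi> (z k) - grid_pot (z k) = \<Phi> v - grid_pot v" for k
  proof (induction k)
    case 0
    then show ?case by (simp add: z_def)
  next
    case (Suc k)
    have zS: "z (Suc k) = (z k)(k := v' k)" by (auto simp: z_def fun_eq_iff less_Suc_eq)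
    have zk: "z k k = v k" by (simp add: z_def)
    show ?case
    proof
      assume "Suc k \<le> Suc n"
      show "\<Phi> (z (Suc k)) - grid_pot (z (Suc k)) = \<Phi> v - grid_pot v"
      proof (cases "k \<in> {1..n}")
        case k: True
        have inP: "(z k)(k := w) \<in> polydisc u e" if "w \<in> closed_segment (v k) (v' k)" for w
        proof (rule polydiscI)
          fix i assume i: "i \<in> {1..n}"
          have "closed_segment (v k) (v' k) \<subseteq> ball (u k) e"
            using polydiscD[OF v(2) k] polydiscD[OF v'(2) k]
            by (intro closed_segment_subset convex_ball) (simp_all add: dist_commute)
          then show "dist (((z k)(k := w)) i) (u i) < e"
            using that polydiscD[OF zP i] by (cases "i = k") (auto simp: dist_commute)
        next
          fix i assume "i \<notin> {1..n}"
          then show "((z k)(k := w)) i = 0"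
            using polydisc_0[OF zP[of k], of i] k by (cases "i = k") (simp_all del: atLeastAtMost_iff)
        qed
        have "path_image (linepath (v k) (v' k)) \<subseteq> room (z k) k"
        proof
          fix w assume "w \<in> path_image (linepath (v k) (v' k))"
          then have "(z k)(k := w) \<in> Y" using inP P by auto
          from Y_in_room[OF this k] show "w \<in> room (z k) k" by simp
        qed
        then have "\<Lambda> (\<lambda>t. (z k)(k := linepath (v k) (v' k) t)) = move k (z k) (v k) (v' k)"
          using move_eq[OF Y_others_ok k path_linepath] zP P by fastforce
        moreover have "\<Lambda> (\<lambda>t. (z k)(k := linepath (v k) (v' k) t)) = \<Phi> ((z k)(k := v' k)) - \<Phi> ((z k)(k := v k))"
        proof -
          have "path (\<lambda>t. (z k)(k := linepath (v k) (v' k) t))"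
            unfolding path_def by (intro continuous_on_fun_upd continuous_on_linepath)
          moreover have "path_image (\<lambda>t. (z k)(k := linepath (v k) (v' k) t)) \<subseteq> polydisc u e"
          proof
            fix y assume "y \<in> path_image (\<lambda>t. (z k)(k := linepath (v k) (v' k) t))"
            then obtain t where t: "t \<in> {0..1}" "y = (z k)(k := linepath (v k) (v' k) t)"
              unfolding path_image_def by blast
            then show "y \<in> polydisc u e" using inP linepath_in_path[OF t(1)] by blast
          qed
          ultimately show ?thesis
            using potential_onD[OF \<Phi>, of "\<lambda>t. (z k)(k := linepath (v k) (v' k) t)"]
            by (simp add: pathstart_def pathfinish_def linepath_def)
        qed
        moreover have "grid_pot ((z k)(k := v' k)) - grid_pot (z k) = move k (z k) (v k) (v' k)"
          using grid_step[OF zg k gridD[OF v'(1) k]] zk by simp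
        moreover have "(z k)(k := v k) = z k" using zk by (simp add: fun_upd_idem)
        ultimately show ?thesis using Suc \<open>Suc k \<le> Suc n\<close> zS by simp
      next
        case False
        then have "v' k = v k" using grid_0[OF v(1)] grid_0[OF v'(1)] by simp
        then have "z (Suc k) = z k" unfolding zS using zk by (simp add: fun_upd_idem)
        then show ?thesis using Suc \<open>Suc k \<le> Suc n\<close> by simp
      qed
    qed
  qed
  moreover have "z (Suc n) = v'"
  proof
    fix l
    show "z (Suc n) l = v' l"
      using grid_0[OF v(1), of l] grid_0[OF v'(1), of l] by (cases "l < Suc n") (simp_all add: z_def)
  qed
  ultimately show ?thesis by (metis order_refl)
qed

text \<open>On each polydisc the potential is normalised to equal \<open>grid_pot\<close> at the
  grid points. As the grid is dense, a small polydisc around a common point of two polydiscs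
  contains a grid point, and the two normalised potentials agree there. The local potentials thus
  fit together.\<close>

lemma Y_exact: "exact_on Y \<Lambda>"
proof -
  define good where "good u e \<Phi> \<longleftrightarrow> e > 0 \<and> polydisc u e \<subseteq> Y \<and> potential_on (polydisc u e) \<Lambda> \<Phi> \<and>
      (\<forall>v\<in>grid \<inter> polydisc u e. \<Phi> v = grid_pot v)" for u e \<Phi>
  have "\<exists>e \<Phi>. good u e \<Phi>" if u: "u \<in> Y" for u
  proof -
    obtain e where e: "e > 0" "polydisc u e \<subseteq> Y" by (rule polydisc_in_Y[OF u])
    obtain \<Phi> where \<Phi>: "potential_on (polydisc u e) \<Lambda> \<Phi>" using exact_on_polydisc[OF e(2)] by (rule exact_onE)
    obtain v0 where v0: "v0 \<in> grid" "v0 \<in> polydisc u e" by (rule grid_dense[OF e(1)])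
    have "good u e (\<lambda>v. \<Phi> v - (\<Phi> v0 - grid_pot v0))"
      unfolding good_def
    proof (intro conjI ballI e)
      show "potential_on (polydisc u e) \<Lambda> (\<lambda>v. \<Phi> v - (\<Phi> v0 - grid_pot v0))"
        using \<Phi> by (simp add: potential_on_def)
      show "\<Phi> v - (\<Phi> v0 - grid_pot v0) = grid_pot v" if "v \<in> grid \<inter> polydisc u e" for v
        using grid_pot_polydisc[OF e(2) \<Phi> v0, of v] that by simp
    qed
    then show ?thesis by blast
  qed
  then obtain \<epsilon> \<Phi> where good: "\<And>u. u \<in> Y \<Longrightarrow> good u (\<epsilon> u) (\<Phi> u)" by metis
  note g = good[unfolded good_def, THEN conjunct1] good[unfolded good_def, THEN conjunct2, THEN conjunct1]
    good[unfolded good_def, THEN conjunct2, THEN conjunct2, THEN conjunct1]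
    good[unfolded good_def, THEN conjunct2, THEN conjunct2, THEN conjunct2]
  define \<psi> where "\<psi> u = \<Phi> u u" for u
  have \<psi>: "\<psi> u' = \<Phi> u u'" if u: "u \<in> Y" and u': "u' \<in> polydisc u (\<epsilon> u)" for u u'
  proof -
    have u'Y: "u' \<in> Y" using u' g(2)[OF u] by blast
    obtain d where d: "d > 0" "polydisc u' d \<subseteq> polydisc u (\<epsilon> u)" by (rule polydisc_inner[OF u'])
    define d' where "d' = min d (\<epsilon> u')"
    have d': "d' > 0" "polydisc u' d' \<subseteq> polydisc u (\<epsilon> u)" "polydisc u' d' \<subseteq> polydisc u' (\<epsilon> u')"
      using d g(1)[OF u'Y] by (auto simp: d'_def polydisc_def)
    obtain v where v: "v \<in> grid" "v \<in> polydisc u' d'" by (rule grid_dense[OF d'(1)])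
    have "\<Phi> u u' - \<Phi> u' u' = \<Phi> u v - \<Phi> u' v"
      by (rule potentials_differ_by_const[OF path_connected_polydisc
          potential_on_subset[OF g(3)[OF u] d'(2)] potential_on_subset[OF g(3)[OF u'Y] d'(3)] v(2)
          polydisc_centre[OF u'Y d'(1)]])
    also have "\<Phi> u v = grid_pot v" by (rule g(4)[OF u, THEN bspec]) (use v d'(2) in blast)
    also have "\<Phi> u' v = grid_pot v" by (rule g(4)[OF u'Y, THEN bspec]) (use v d'(3) in blast)
    finally show ?thesis by (simp add: \<psi>_def)
  qed
  have "potential_on Y \<Lambda> \<psi>"
  proof (rule potential_on_local)
    fix u assume u: "u \<in> Y"
    let ?W = "\<Inter>i\<in>{1..n}. {v. dist (v i) (u i) < \<epsilon> u}"
    have "open ?W"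
    proof (intro open_INT ballI finite_atLeastAtMost)
      fix i
      have "continuous_on UNIV (\<lambda>v::nat \<Rightarrow> complex. dist (v i) (u i))"
        by (intro continuous_intros continuous_on_product_coordinates)
      then show "open {v. dist (v i) (u i) < \<epsilon> u}" by (intro open_Collect_less continuous_on_const)
    qed
    moreover have "u \<in> ?W" using g(1)[OF u] by simp
    moreover have "potential_on (Y \<inter> ?W) \<Lambda> \<psi>"
    proof -
      have sub: "Y \<inter> ?W \<subseteq> polydisc u (\<epsilon> u)" unfolding polydisc_def using Y_0 by blast
      show ?thesis
        unfolding potential_on_def
      proof (intro allI impI)
        fix p :: "real \<Rightarrow> nat \<Rightarrow> complex" assume p: "path p" "path_image p \<subseteq> Y \<inter> ?W"
        then have P: "path_image p \<subseteq> polydisc u (\<epsilon> u)" using sub by blast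
        then have "pathstart p \<in> polydisc u (\<epsilon> u)" "pathfinish p \<in> polydisc u (\<epsilon> u)" by auto
        then show "\<Lambda> p = \<psi> (pathfinish p) - \<psi> (pathstart p)"
          using potential_onD[OF g(3)[OF u] p(1) P] \<psi>[OF u] by simp
      qed
    qed
    ultimately show "\<exists>W. open W \<and> u \<in> W \<and> potential_on (Y \<inter> W) \<Lambda> \<psi>" by blast
  qed simp
  then show ?thesis by (auto simp: exact_on_def)
qed

end

section \<open>Rational homology of the pure braid group\<close>

context klein_braids_hom
begin

lemma lift_\<Lambda>:
  assumes p: "p \<in> loops X base" and l: "is_lift p l"
  shows "path l" "path_image l \<subseteq> Y" "\<Lambda> l = h (loop_class X base p)" "pathstart l = q"
proof -
  show pl: "path l"
    unfolding path_def using l by (intro continuous_on_coordinatewise_then_product) (simp add: is_lift_def)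
  show lY: "path_image l \<subseteq> Y"
    unfolding path_image_def Y_def using l unfolding is_lift_def by blast
  show "pathstart l = q" using l by (simp add: is_lift_def pathstart_def)
  have eq: "config_proj n (l t) = p t" if "t \<in> {0..1}" for t using l that by (simp add: is_lift_def)
  have "path_homotopic X (\<lambda>t. config_proj n (l t)) p"
  proof (rule path_homotopic_convex[of "{0..1}" X "\<lambda>t. config_proj n (l t)" "\<lambda>t. t" "\<lambda>t. t"])
    show "continuous_map (top_of_set {0..1}) X (\<lambda>t. config_proj n (l t))"
      using pathin_Y[OF pl lY] by (simp add: pathin_def)
    show "p t = config_proj n (l t)" if "t \<in> {0..1}" for t using eq[OF that] by simp
  qed (auto intro!: continuous_intros)
  then have "\<Lambda> l = groupoid_extension X base h p" unfolding \<Lambda>_def by (rule ext_homotopic)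
  then show "\<Lambda> l = h (loop_class X base p)" using ext_loop[OF p] by simp
qed

text \<open>A braid that reverses the orientation of every string, by which \<open>hom_zero\<close>
  conjugates. The strings move one after another; those already moved have kept their orbits, so the
  obstacles stay the same.\<close>

lemma reflecting_path:
  obtains \<beta> where "path \<beta>" "path_image \<beta> \<subseteq> Y" "pathstart \<beta> = q"
    "pathfinish \<beta> = (\<lambda>i. if i \<in> {1..n} then act 0 1 (q i) else q i)"
proof -
  define z where "z k = (\<lambda>i. if i \<in> {1..k} then act 0 1 (q i) else q i)" for k
  have kz: "kproj (z k i) = kproj (q i)" for k i by (simp add: z_def)
  have qY: "q \<in> Y" unfolding Y_def using q q0 by simp
  have zY: "z k \<in> Y" if "k \<le> n" for k
  proof (rule YI)
    show "kproj (z k a) \<noteq> kproj (z k b)" if "a \<in> {1..n}" "b \<in> {1..n}" "a \<noteq> b" for a b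
      unfolding kz by (rule YD[OF qY that])
    show "z k j = 0" if "j \<notin> {1..n}" for j
      using q0[OF that] that \<open>k \<le> n\<close> by (auto simp: z_def)
  qed
  have "k \<le> n \<longrightarrow> path_component Y q (z k)" for k
  proof (induction k)
    case 0
    have "z 0 = q" by (simp add: z_def)
    then show ?case using qY by (simp add: path_component_refl)
  next
    case (Suc k)
    show ?case
    proof
      assume "Suc k \<le> n"
      define i where "i = Suc k"
      have i: "i \<in> {1..n}" using \<open>Suc k \<le> n\<close> by (simp add: i_def)
      have zk: "z k \<in> Y" using \<open>Suc k \<le> n\<close> by (intro zY) simp
      have zi: "z k i = q i" by (simp add: z_def i_def)
      have zS: "z (Suc k) = (z k)(i := act 0 1 (q i))"
        by (auto simp: z_def i_def fun_eq_iff le_Suc_eq)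
      have r: "kproj (q i) \<noteq> kproj (z k j)" if "j \<in> {1..n} - {i}" for j
        unfolding kz by (rule YD[OF qY i]) (use that in auto)
      obtain \<gamma> where \<gamma>: "path \<gamma>" "pathstart \<gamma> = q i" "pathfinish \<gamma> = act 0 1 (q i)"
        "\<And>t j. t \<in> {0..1} \<Longrightarrow> j \<in> {1..n} - {i} \<Longrightarrow> kproj (\<gamma> t) \<noteq> kproj (z k j)"
        by (rule path_avoiding_obstacles[of "{1..n} - {i}" "q i" "z k" "act 0 1 (q i)"]) (use r in simp_all)
      have "path (\<lambda>t. (z k)(i := \<gamma> t))"
        using \<gamma>(1) unfolding path_def by (rule continuous_on_fun_upd)
      moreover have "path_image (\<lambda>t. (z k)(i := \<gamma> t)) \<subseteq> Y"
      proof
        fix y assume "y \<in> path_image (\<lambda>t. (z k)(i := \<gamma> t))"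
        then obtain t where t: "t \<in> {0..1}" "y = (z k)(i := \<gamma> t)" unfolding path_image_def by blast
        have "\<gamma> t \<in> room (z k) i" unfolding room_def using \<gamma>(4)[OF t(1)] by blast
        then show "y \<in> Y" unfolding t(2) by (rule fun_upd_in_Y[OF Y_others_ok[OF zk] i])
      qed
      moreover have "pathstart (\<lambda>t. (z k)(i := \<gamma> t)) = z k" "pathfinish (\<lambda>t. (z k)(i := \<gamma> t)) = z (Suc k)"
        using \<gamma>(2,3) zi by (simp_all add: pathstart_def pathfinish_def zS fun_upd_idem)
      ultimately have "path_component Y (z k) (z (Suc k))" unfolding path_component_def by blast
      then show "path_component Y q (z (Suc k))"
        using Suc \<open>Suc k \<le> n\<close> path_component_trans by (metis Suc_leD)
    qed
  qed
  then have "path_component Y q (z n)" by simp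
  then show thesis unfolding path_component_def z_def using that by blast
qed

text \<open>A braid all of whose strings have winding number zero is, up to a braid with trivial
  image in the fundamental group of the product of Klein bottles, conjugate to its inverse by a
  braid whose strings all reverse the orientation.\<close>

lemma hom_zero:
  assumes A: "A \<in> carrier G" and w: "\<And>i. i \<in> {1..n} \<Longrightarrow> wnd i A = 0"
  shows "h A = 0"
proof -
  obtain p where p: "p \<in> loops X base" "A = loop_class X base p" using A by (rule carrier_fundamental_groupE)
  obtain l where l: "is_lift p l" using lift_exists[OF p(1)] .
  obtain m k where mk: "\<And>i. l 1 i = act (m i) (k i) (q i)" "\<And>i. i \<notin> {1..n} \<Longrightarrow> m i = 0 \<and> k i = 0"
    by (rule lift_endpoint[OF p(1) l]) blast
  have k: "k i = 0" for i
    using w[of i] wnd_act[OF p(1) l mk(1), of i] mk(2)[of i] p(2) by (cases "i \<in> {1..n}") auto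
  note L = lift_\<Lambda>[OF p(1) l, folded p(2)]
  have l1: "pathfinish l = (\<lambda>i. act (m i) 0 (q i))" using mk(1) k by (simp add: pathfinish_def fun_eq_iff)
  obtain \<psi> where \<psi>: "potential_on Y \<Lambda> \<psi>" using Y_exact by (rule exact_onE)
  \<comment> \<open>Two deck transformations of \<open>Y\<close>: \<sigma> reverses the orientation
    for every string, and \<tau> undoes the displacement at the end of \<open>l\<close>.\<close>
  define \<sigma> where "\<sigma> = (\<lambda>z i. if i \<in> {1..n} then act 0 1 (z i) else (z i :: complex))"
  define \<tau> where "\<tau> = (\<lambda>z i. act (- m i) 0 (z i))"
  have k\<sigma>: "kproj (\<sigma> z i) = kproj (z i)" and k\<tau>: "kproj (\<tau> z i) = kproj (z i)" for z i
    by (simp_all add: \<sigma>_def \<tau>_def)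
  have \<sigma>Y: "\<sigma> z \<in> Y" if "z \<in> Y" for z
  proof (rule YI)
    show "kproj (\<sigma> z a) \<noteq> kproj (\<sigma> z b)" if "a \<in> {1..n}" "b \<in> {1..n}" "a \<noteq> b" for a b
      unfolding k\<sigma> by (rule YD[OF \<open>z \<in> Y\<close> that])
    show "\<sigma> z j = 0" if "j \<notin> {1..n}" for j
      using Y_0[OF \<open>z \<in> Y\<close> that] that unfolding \<sigma>_def by (simp only: if_False)
  qed
  have \<tau>Y: "\<tau> z \<in> Y" if "z \<in> Y" for z
  proof (rule YI)
    show "kproj (\<tau> z a) \<noteq> kproj (\<tau> z b)" if "a \<in> {1..n}" "b \<in> {1..n}" "a \<noteq> b" for a b
      unfolding k\<tau> by (rule YD[OF \<open>z \<in> Y\<close> that])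
    show "\<tau> z j = 0" if "j \<notin> {1..n}" for j
      using Y_0[OF \<open>z \<in> Y\<close> that] mk(2)[OF that] by (simp add: \<tau>_def)
  qed
  have coord: "continuous_on {0..1} (\<lambda>t. f t i)" if "path f" for f :: "real \<Rightarrow> nat \<Rightarrow> complex" and i
    using that unfolding path_def by (rule continuous_on_product_then_coordinatewise)
  \<comment> \<open>\<Lambda> sees only projections, so a path and its image under \<sigma> or
    \<tau> have the same integral, which \<psi> evaluates at the ends of the image.\<close>
  have transl: "\<Lambda> f = \<psi> (T (pathfinish f)) - \<psi> (T (pathstart f))"
    if f: "path f" "path_image f \<subseteq> Y" and T: "T = \<sigma> \<or> T = \<tau>" for f T
  proof -
    have "path (\<lambda>t. T (f t))"
      unfolding path_def
    proof (intro continuous_on_coordinatewise_then_product)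
      fix i
      show "continuous_on {0..1} (\<lambda>t. T (f t) i)"
        using T coord[OF f(1), of i] by (cases "i \<in> {1..n}") (auto simp: \<sigma>_def \<tau>_def intro!: continuous_intros)
    qed
    moreover have "path_image (\<lambda>t. T (f t)) \<subseteq> Y"
      using T f(2) \<sigma>Y \<tau>Y unfolding path_image_def by blast
    ultimately have "\<Lambda> (\<lambda>t. T (f t)) = \<psi> (T (pathfinish f)) - \<psi> (T (pathstart f))"
      using potential_onD[OF \<psi>, of "\<lambda>t. T (f t)"] by (simp add: pathfinish_def pathstart_def)
    moreover have "\<Lambda> (\<lambda>t. T (f t)) = \<Lambda> f" using T k\<sigma> k\<tau> by (intro \<Lambda>_cong_proj) blast
    ultimately show ?thesis by simp
  qed
  obtain \<beta> where \<beta>: "path \<beta>" "path_image \<beta> \<subseteq> Y" "pathstart \<beta> = q" "pathfinish \<beta> = \<sigma> q"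
    unfolding \<sigma>_def by (rule reflecting_path)
  \<comment> \<open>In the Klein bottle group \<open>act 0 1\<close> conjugates
    \<open>act m 0\<close> to its inverse.\<close>
  have e1: "\<sigma> (\<lambda>i. act (m i) 0 (q i)) = \<tau> (\<sigma> q)"
    using mk(2) by (auto simp: \<sigma>_def \<tau>_def fun_eq_iff complex_eq_iff)
  have e2: "\<tau> (\<lambda>i. act (m i) 0 (q i)) = q" by (simp add: \<tau>_def fun_eq_iff complex_eq_iff)
  \<comment> \<open>The increment of \<psi> from a point to its image under \<tau> is
    \<open>h A\<close> at \<open>\<sigma> q\<close> and \<open>- h A\<close> at \<open>q\<close>.
    Comparing \<beta> with its image under \<tau> shows that both increments are equal.\<close>
  have "h A = \<psi> (\<tau> (\<sigma> q)) - \<psi> (\<sigma> q)"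
    using transl[OF L(1,2), of \<sigma>] L(3,4) l1 e1 by simp
  moreover have "h A = \<psi> q - \<psi> (\<tau> q)"
    using transl[OF L(1,2), of \<tau>] L(3,4) l1 e2 by simp
  moreover have "\<psi> (\<tau> (\<sigma> q)) - \<psi> (\<tau> q) = \<psi> (\<sigma> q) - \<psi> q"
    using transl[OF \<beta>(1,2), of \<tau>] potential_onD[OF \<psi> \<beta>(1,2)] \<beta>(3,4) by simp
  ultimately show ?thesis by simp
qed

end

lemma (in group) additive_pow:
  fixes f :: "'a \<Rightarrow> real"
  assumes f: "\<And>a b. a \<in> carrier G \<Longrightarrow> b \<in> carrier G \<Longrightarrow> f (a \<otimes> b) = f a + f b" and a: "a \<in> carrier G"
  shows "f \<one> = 0" "f (inv a) = - f a" "f (a [^] (k::nat)) = of_nat k * f a" "f (a [^] (j::int)) = of_int j * f a"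
proof -
  show 1: "f \<one> = 0" using f[of \<one> \<one>] by simp
  show i: "f (inv a) = - f a" using f[of a "inv a"] a 1 by simp
  have n: "f (a [^] (k::nat)) = of_nat k * f a" for k
  proof (induction k)
    case (Suc k)
    then show ?case using f[OF nat_pow_closed[OF a, of k] a] by (simp add: distrib_right)
  qed (simp add: 1)
  then show "f (a [^] (k::nat)) = of_nat k * f a" .
  have finv: "f (inv b) = - f b" if "b \<in> carrier G" for b using f[of b "inv b"] that 1 by simp
  show "f (a [^] (j::int)) = of_int j * f a"
  proof (cases "j < 0")
    case True
    then have "a [^] j = inv (a [^] nat (- j))" by (simp only: int_pow_def2 if_True)
    then show ?thesis unfolding \<open>a [^] j = _\<close> finv[OF nat_pow_closed[OF a]] n using True by simp
  next
    case False
    then have "a [^] j = a [^] nat j" by (simp only: int_pow_def2 if_False)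
    then show ?thesis unfolding \<open>a [^] j = _\<close> n using False by simp
  qed
qed

context klein_braids
begin

text \<open>A suitable power of \<open>B (Suc m)\<close> removes one winding number at a time, until
  \<open>hom_zero\<close> applies. The induction is on a bound for the strings whose winding number
  may be nonzero.\<close>

lemma hom_eq_sum:
  fixes h :: "(real \<Rightarrow> nat \<Rightarrow> (real \<times> real) set) set \<Rightarrow> real"
  assumes h: "\<And>A B. A \<in> carrier G \<Longrightarrow> B \<in> carrier G \<Longrightarrow> h (A \<otimes>\<^bsub>G\<^esub> B) = h A + h B"
    and B: "\<And>i. i \<in> {1..n} \<Longrightarrow> B i \<in> carrier G" "\<And>i j. i \<in> {1..n} \<Longrightarrow> wnd j (B i) = (if j = i then 1 else 0)"
    and A: "A \<in> carrier G"
  shows "h A = (\<Sum>i\<in>{1..n}. of_int (wnd i A) * h (B i))"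
proof -
  interpret klein_braids_hom n q h by unfold_locales (rule h)
  have "m \<le> n \<longrightarrow> (\<forall>A\<in>carrier G. (\<forall>i\<in>{1..n}. m < i \<longrightarrow> wnd i A = 0) \<longrightarrow>
      h A = (\<Sum>i\<in>{1..m}. of_int (wnd i A) * h (B i)))" for m
  proof (induction m)
    case 0
    then show ?case using hom_zero by simp
  next
    case (Suc m)
    show ?case
    proof (intro impI ballI)
      fix A assume m: "Suc m \<le> n" and A: "A \<in> carrier G" and w: "\<forall>i\<in>{1..n}. Suc m < i \<longrightarrow> wnd i A = 0"
      define b where "b = B (Suc m)"
      have i: "Suc m \<in> {1..n}" using m by simp
      have b: "b \<in> carrier G" "\<And>j. wnd j b = (if j = Suc m then 1 else 0)" using B i by (simp_all add: b_def)
      define c where "c = b [^]\<^bsub>G\<^esub> (- wnd (Suc m) A)"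
      have c: "c \<in> carrier G" using b by (simp add: c_def)
      have hc: "h c = - of_int (wnd (Suc m) A) * h b"
        unfolding c_def using additive_pow(4)[OF h b(1)] by simp
      have wc: "real_of_int (wnd j c) = - of_int (wnd (Suc m) A) * of_int (wnd j b)" for j
        unfolding c_def
        using additive_pow(4)[of "\<lambda>A. real_of_int (wnd j A)", OF _ b(1)] wnd_mult by simp
      have wc': "wnd j c = (if j = Suc m then - wnd (Suc m) A else 0)" for j
        using wc[of j] b(2)[of j] by (auto split: if_splits)
      have wAc: "wnd j (A \<otimes>\<^bsub>G\<^esub> c) = (if j = Suc m then 0 else wnd j A)" for j
        using wnd_mult[OF A c, of j] wc'[of j] by simp
      have "h (A \<otimes>\<^bsub>G\<^esub> c) = (\<Sum>i\<in>{1..m}. of_int (wnd i (A \<otimes>\<^bsub>G\<^esub> c)) * h (B i))"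
      proof -
        have "\<forall>i\<in>{1..n}. m < i \<longrightarrow> wnd i (A \<otimes>\<^bsub>G\<^esub> c) = 0"
        proof (intro ballI impI)
          fix i assume "i \<in> {1..n}" "m < i"
          then show "wnd i (A \<otimes>\<^bsub>G\<^esub> c) = 0" using w wAc[of i] by (cases "i = Suc m") auto
        qed
        then show ?thesis using Suc m A c by simp
      qed
      also have "\<dots> = (\<Sum>i\<in>{1..m}. of_int (wnd i A) * h (B i))"
        by (rule sum.cong) (auto simp: wAc)
      finally show "h A = (\<Sum>i\<in>{1..Suc m}. of_int (wnd i A) * h (B i))"
        using h[OF A c] hc by (simp add: b_def)
    qed
  qed
  from this[of n] A show ?thesis by simp
qed

end

section \<open>Twisted conjugacy in the pure braid group\<close>

text \<open>The all-ones vector lies in the kernel of M minus the identity, so its determinant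
  vanishes, and so does that of the transpose. A kernel vector of the transpose is the required row
  vector.\<close>

lemma left_fixed_vector_of_row_stochastic:
  fixes M :: "nat \<Rightarrow> nat \<Rightarrow> real"
  assumes n: "n \<ge> 1" and M: "\<And>i. i \<in> {1..n} \<Longrightarrow> (\<Sum>j\<in>{1..n}. M i j) = 1"
  obtains u k where "k \<in> {1..n}" "u k \<noteq> 0" "\<And>j. j \<in> {1..n} \<Longrightarrow> (\<Sum>i\<in>{1..n}. u i * M i j) = u j"
proof -
  have shift: "(\<Sum>i\<in>{1..n}. f i) = (\<Sum>i\<in>{0..<n}. f (Suc i))" for f :: "nat \<Rightarrow> real"
    using sum.shift_bounds_Suc_ivl[of f 0 n] by (simp add: atLeastLessThanSuc_atLeastAtMost One_nat_def)
  define A :: "real mat" where "A = mat n n (\<lambda>(i, j). M (Suc i) (Suc j) - (if i = j then 1 else 0))"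
  have A: "A \<in> carrier_mat n n" by (simp add: A_def)
  have "A *\<^sub>v vec n (\<lambda>_. 1) = 0\<^sub>v n"
  proof (rule eq_vecI)
    fix i assume "i < dim_vec (0\<^sub>v n)"
    then have i: "i < n" by simp
    have "(A *\<^sub>v vec n (\<lambda>_. 1)) $ i = (\<Sum>j\<in>{0..<n}. M (Suc i) (Suc j) - (if i = j then 1 else 0))"
      using i by (simp add: A_def scalar_prod_def)
    also have "\<dots> = (\<Sum>j\<in>{0..<n}. M (Suc i) (Suc j)) - 1"
      using i by (simp add: sum_subtractf)
    also have "\<dots> = 0" using M[of "Suc i"] i by (simp add: shift)
    finally show "(A *\<^sub>v vec n (\<lambda>_. 1)) $ i = 0\<^sub>v n $ i" using i by simp
  qed (simp add: A_def)
  moreover have "vec n (\<lambda>_. 1::real) \<noteq> 0\<^sub>v n"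
  proof
    assume "vec n (\<lambda>_. 1::real) = 0\<^sub>v n"
    then have "vec n (\<lambda>_. 1::real) $ 0 = 0\<^sub>v n $ 0" by simp
    then show False using n by simp
  qed
  ultimately have "det A = 0"
    using det_0_iff_vec_prod_zero[OF A] vec_carrier by blast
  then have "det A\<^sup>T = 0" using det_transpose[OF A] by simp
  then obtain v where v: "v \<in> carrier_vec n" "v \<noteq> 0\<^sub>v n" "A\<^sup>T *\<^sub>v v = 0\<^sub>v n"
    using det_0_iff_vec_prod_zero[of "A\<^sup>T" n] A by auto
  obtain k where k: "k < n" "v $ k \<noteq> 0"
  proof (rule ccontr)
    assume "\<not> thesis"
    then have "v = 0\<^sub>v n" using that v(1) by (intro eq_vecI) auto
    then show False using v(2) by simp
  qed
  show thesis
  \<comment> \<open>Matrix indices start at 0 and strings at 1, hence the shift.\<close>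
  proof (rule that[of "Suc k" "\<lambda>i. v $ (i - 1)"])
    fix j assume "j \<in> {1..n}"
    then obtain l where l: "j = Suc l" "l < n" by (cases j) auto
    have "0 = (A\<^sup>T *\<^sub>v v) $ l" using v(3) l by simp
    also have "\<dots> = (\<Sum>i\<in>{0..<n}. (M (Suc i) (Suc l) - (if i = l then 1 else 0)) * v $ i)"
      using l v(1) by (simp add: A_def scalar_prod_def)
    also have "\<dots> = (\<Sum>i\<in>{0..<n}. v $ i * M (Suc i) (Suc l)) - (\<Sum>i\<in>{0..<n}. if i = l then v $ i else 0)"
      by (subst sum_subtractf[symmetric], rule sum.cong) (auto simp: algebra_simps)
    also have "\<dots> = (\<Sum>i\<in>{0..<n}. v $ i * M (Suc i) (Suc l)) - v $ l" using l by simp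
    finally show "(\<Sum>i\<in>{1..n}. v $ (i - 1) * M i j) = v $ (j - 1)" by (simp add: shift l)
  qed (use k in simp_all)
qed

lemma (in group) reidemeister_infinite:
  fixes f :: "'a \<Rightarrow> real"
  assumes \<phi>: "\<phi> \<in> hom G G"
    and f: "\<And>a b. a \<in> carrier G \<Longrightarrow> b \<in> carrier G \<Longrightarrow> f (a \<otimes> b) = f a + f b"
    and inv_f: "\<And>a. a \<in> carrier G \<Longrightarrow> f (\<phi> a) = f a" and b: "b \<in> carrier G" "f b \<noteq> 0"
  shows "reidemeister_number G \<phi> = \<infinity>"
proof -
  interpret \<phi>: group_hom G G \<phi> by unfold_locales (rule \<phi>)
  let ?r = "twisted_conj G \<phi>"
  have const: "f y = f x" if "(x, y) \<in> ?r" for x y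
  proof -
    obtain z where z: "z \<in> carrier G" "z \<otimes> x \<otimes> inv (\<phi> z) = y" "x \<in> carrier G"
      using \<open>(x, y) \<in> ?r\<close> unfolding twisted_conj_def by auto
    then have "f y = f z + f x + f (inv (\<phi> z))" using f by (metis \<phi>.hom_closed inv_closed m_closed)
    then show ?thesis using additive_pow(2)[OF f, of "\<phi> z"] inv_f z by simp
  qed
  have refl: "(x, x) \<in> ?r" if "x \<in> carrier G" for x
    using that unfolding twisted_conj_def by (auto intro!: bexI[of _ \<one>])
  have inj: "inj (\<lambda>k::nat. ?r `` {b [^] k})"
  proof (rule injI)
    fix k l :: nat assume "?r `` {b [^] k} = ?r `` {b [^] l}"
    then have "(b [^] k, b [^] l) \<in> ?r" using refl[of "b [^] l"] b by blast
    from const[OF this] show "k = l" using additive_pow(3)[OF f b(1)] b(2) by simp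
  qed
  have "range (\<lambda>k::nat. ?r `` {b [^] k}) \<subseteq> carrier G // ?r" using b by (auto intro!: quotientI)
  then have "infinite (carrier G // ?r)"
    using inj range_inj_infinite infinite_super by blast
  then show ?thesis by (simp add: reidemeister_number_def)
qed

section \<open>The sign character of the automorphism group\<close>

definition sign_group :: "int monoid" where
  "sign_group = \<lparr>carrier = {1, - 1}, mult = (*), one = 1\<rparr>"

lemma group_sign_group: "Group.group sign_group"
  by (rule groupI) (auto simp: sign_group_def)

context klein_braids
begin

lemma in_autoD:
  assumes "\<phi> \<in> auto G"
  shows "\<phi> \<in> hom G G" "\<phi> ` carrier G = carrier G"
  using assms by (auto simp: auto_def Bij_def bij_betw_def)

lemma auto_central:
  assumes \<phi>: "\<phi> \<in> auto G" and c: "c \<in> carrier G" "\<And>A. A \<in> carrier G \<Longrightarrow> c \<otimes>\<^bsub>G\<^esub> A = A \<otimes>\<^bsub>G\<^esub> c"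
    and A: "A \<in> carrier G"
  shows "\<phi> c \<otimes>\<^bsub>G\<^esub> A = A \<otimes>\<^bsub>G\<^esub> \<phi> c"
proof -
  obtain B where B: "B \<in> carrier G" "A = \<phi> B" using in_autoD(2)[OF \<phi>] A by blast
  then show ?thesis using hom_mult[OF in_autoD(1)[OF \<phi>]] c by metis
qed

lemma normal_subgroup_with_infinite_reidemeister:
  assumes n: "n \<ge> 1"
  obtains H where "H \<lhd> AutoGroup G" "finite (rcosets\<^bsub>AutoGroup G\<^esub> H)" "card (rcosets\<^bsub>AutoGroup G\<^esub> H) \<le> 2"
    "\<And>\<phi>. \<phi> \<in> H \<Longrightarrow> reidemeister_number G \<phi> = \<infinity>"
proof -
  have "\<forall>i\<in>{1..n}. \<exists>B. B \<in> carrier G \<and> (\<forall>j. wnd j B = (if j = i then 1 else 0))"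
    using generator by blast
  from bchoice[OF this] obtain B where B: "\<And>i. i \<in> {1..n} \<Longrightarrow> B i \<in> carrier G"
    "\<And>i j. i \<in> {1..n} \<Longrightarrow> wnd j (B i) = (if j = i then 1 else 0)" by blast
  obtain Z where Z: "Z \<in> carrier G" "\<And>A. A \<in> carrier G \<Longrightarrow> Z \<otimes>\<^bsub>G\<^esub> A = A \<otimes>\<^bsub>G\<^esub> Z" "\<And>i. i \<in> {1..n} \<Longrightarrow> wnd i Z = 2"
    by (rule central_element) blast
  have one: "1 \<in> {1..n}" using n by simp
  have M: "real_of_int (wnd i (\<phi> A)) = (\<Sum>j\<in>{1..n}. of_int (wnd j A) * of_int (wnd i (\<phi> (B j))))"
    if \<phi>: "\<phi> \<in> hom G G" and A: "A \<in> carrier G" for \<phi> A i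
  proof (rule hom_eq_sum[where h = "\<lambda>A. real_of_int (wnd i (\<phi> A))" and B = B])
    fix a b assume ab: "a \<in> carrier G" "b \<in> carrier G"
    show "real_of_int (wnd i (\<phi> (a \<otimes>\<^bsub>G\<^esub> b))) = real_of_int (wnd i (\<phi> a)) + real_of_int (wnd i (\<phi> b))"
      unfolding hom_mult[OF \<phi> ab] wnd_mult[OF hom_in_carrier[OF \<phi> ab(1)] hom_in_carrier[OF \<phi> ab(2)]] by simp
  qed (rule B A; assumption)+
  \<comment> \<open>The winding numbers of a central \<open>c\<close> are all
    \<open>wnd 1 c\<close>, which factors out of \<open>M\<close> and leaves a row sum.\<close>
  have Mc: "wnd i (\<phi> c) = wnd 1 c * (\<Sum>j\<in>{1..n}. wnd i (\<phi> (B j)))"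
    if \<phi>: "\<phi> \<in> hom G G" and c: "c \<in> carrier G" "\<And>A. A \<in> carrier G \<Longrightarrow> c \<otimes>\<^bsub>G\<^esub> A = A \<otimes>\<^bsub>G\<^esub> c" for \<phi> c i
  proof -
    have "real_of_int (wnd i (\<phi> c)) = (\<Sum>j\<in>{1..n}. of_int (wnd 1 c) * of_int (wnd i (\<phi> (B j))))"
      unfolding M[OF \<phi> c(1)]
    proof (rule sum.cong[OF refl])
      fix j assume "j \<in> {1..n}"
      then have "wnd j c = wnd 1 c" using central_imp_wnd_eq[OF c] one by blast
      then show "real_of_int (wnd j c) * of_int (wnd i (\<phi> (B j))) = of_int (wnd 1 c) * of_int (wnd i (\<phi> (B j)))"
        by (simp only:)
    qed
    also have "\<dots> = real_of_int (wnd 1 c * (\<Sum>j\<in>{1..n}. wnd i (\<phi> (B j))))" by (simp add: sum_distrib_left)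
    finally show ?thesis by (simp only: of_int_eq_iff)
  qed
  \<comment> \<open>Row 1 stands for all rows: for an automorphism, \<phi> maps \<open>Z\<close> to
    a central element, whose winding numbers are twice the row sums and agree by
    \<open>central_imp_wnd_eq\<close>.\<close>
  define lam where "lam \<phi> = (\<Sum>j\<in>{1..n}. wnd 1 (\<phi> (B j)))" for \<phi>
  interpret A: group "AutoGroup G" by (rule AutoGroup)
  have carr: "carrier (AutoGroup G) = auto G" by (simp add: AutoGroup_def)
  have lamZ: "wnd 1 (\<phi> Z) = 2 * lam \<phi>" if "\<phi> \<in> auto G" for \<phi>
    using Mc[OF in_autoD(1)[OF that] Z(1,2)] Z(3)[OF one] by (simp add: lam_def)
  \<comment> \<open>Evaluate at \<open>Z\<close>. The element \<open>\<phi>' Z\<close> is central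
    again, so \<open>Mc\<close> applies a second time, and the factor 2 cancels.\<close>
  have lam_mult: "lam (\<phi> \<otimes>\<^bsub>AutoGroup G\<^esub> \<phi>') = lam \<phi> * lam \<phi>'" if \<phi>: "\<phi> \<in> auto G" and \<phi>': "\<phi>' \<in> auto G" for \<phi> \<phi>'
  proof -
    have in_Aut: "\<phi> \<otimes>\<^bsub>AutoGroup G\<^esub> \<phi>' \<in> auto G" using A.m_closed \<phi> \<phi>' by (simp add: carr)
    have "(\<phi> \<otimes>\<^bsub>AutoGroup G\<^esub> \<phi>') Z = \<phi> (\<phi>' Z)"
      using \<phi> \<phi>' Z(1) by (simp add: AutoGroup_def BijGroup_def auto_def compose_def)
    moreover have "wnd 1 (\<phi> (\<phi>' Z)) = wnd 1 (\<phi>' Z) * lam \<phi>"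
      unfolding lam_def
      by (rule Mc[OF in_autoD(1)[OF \<phi>] hom_in_carrier[OF in_autoD(1)[OF \<phi>'] Z(1)]])
        (rule auto_central[OF \<phi>' Z(1,2)])
    ultimately show ?thesis using lamZ[OF in_Aut] lamZ[OF \<phi>'] by (simp add: mult.commute)
  qed
  have lam_one: "lam \<one>\<^bsub>AutoGroup G\<^esub> = 1"
  proof -
    have "\<one>\<^bsub>AutoGroup G\<^esub> \<in> auto G" using A.one_closed by (simp add: carr)
    moreover have "\<one>\<^bsub>AutoGroup G\<^esub> Z = Z" using Z(1) by (simp add: AutoGroup_def BijGroup_def)
    ultimately show ?thesis using lamZ[of "\<one>\<^bsub>AutoGroup G\<^esub>"] Z(3)[OF one] by simp
  qed
  have lam_unit: "lam \<phi> \<in> {1, - 1}" if \<phi>: "\<phi> \<in> auto G" for \<phi>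
  proof -
    have "inv\<^bsub>AutoGroup G\<^esub> \<phi> \<in> auto G" using A.inv_closed \<phi> by (simp add: carr)
    from lam_mult[OF \<phi> this] have "lam \<phi> * lam (inv\<^bsub>AutoGroup G\<^esub> \<phi>) = 1"
      using A.r_inv[of \<phi>] \<phi> lam_one unfolding carr by (simp only:)
    then show ?thesis by (auto simp: zmult_eq_1_iff)
  qed
  interpret lam: group_hom "AutoGroup G" sign_group lam
    by (rule group_hom.intro[OF A.is_group group_sign_group], unfold_locales)
      (use lam_unit lam_mult in \<open>auto simp: hom_def carr sign_group_def\<close>)
  let ?H = "kernel (AutoGroup G) sign_group lam"
  have inj: "inj_on (\<lambda>C. the_elem (lam ` C)) (rcosets\<^bsub>AutoGroup G\<^esub> ?H)"
    using lam.FactGroup_inj_on by (simp add: FactGroup_def)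
  have sub: "(\<lambda>C. the_elem (lam ` C)) ` (rcosets\<^bsub>AutoGroup G\<^esub> ?H) \<subseteq> {1, - 1}"
    using lam.FactGroup_the_elem_mem by (auto simp: FactGroup_def sign_group_def)
  show thesis
  proof (rule that[of ?H])
    show "?H \<lhd> AutoGroup G" by (rule lam.normal_kernel)
    show "finite (rcosets\<^bsub>AutoGroup G\<^esub> ?H)" using inj_on_finite[OF inj sub] by simp
    have "card (rcosets\<^bsub>AutoGroup G\<^esub> ?H) \<le> card {1, - 1 :: int}"
      by (rule card_inj_on_le[OF inj sub]) simp
    then show "card (rcosets\<^bsub>AutoGroup G\<^esub> ?H) \<le> 2" by simp
    fix \<phi> assume "\<phi> \<in> ?H"
    then have \<phi>: "\<phi> \<in> auto G" "lam \<phi> = 1" by (auto simp: kernel_def carr sign_group_def)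
    note hom = in_autoD(1)[OF \<phi>(1)]
    have rows: "(\<Sum>j\<in>{1..n}. real_of_int (wnd i (\<phi> (B j)))) = 1" if i: "i \<in> {1..n}" for i
    proof -
      have "wnd i (\<phi> Z) = wnd 1 (\<phi> Z)"
        by (rule central_imp_wnd_eq[OF hom_in_carrier[OF hom Z(1)] auto_central[OF \<phi>(1) Z(1,2)] i one])
      also have "\<dots> = 2" using lamZ[OF \<phi>(1)] \<phi>(2) by simp
      finally have "(\<Sum>j\<in>{1..n}. wnd i (\<phi> (B j))) = 1"
        using Mc[OF hom Z(1,2), of i] Z(3)[OF one] by simp
      then have "real_of_int (\<Sum>j\<in>{1..n}. wnd i (\<phi> (B j))) = real_of_int 1" by (simp only:)
      then show ?thesis by (simp only: of_int_sum of_int_1)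
    qed
    obtain u k where u: "k \<in> {1..n}" "u k \<noteq> 0"
      "\<And>j. j \<in> {1..n} \<Longrightarrow> (\<Sum>i\<in>{1..n}. u i * real_of_int (wnd i (\<phi> (B j)))) = u j"
      by (rule left_fixed_vector_of_row_stochastic[OF n, of "\<lambda>i j. real_of_int (wnd i (\<phi> (B j)))"])
        (use rows in blast)+
    define f where "f A = (\<Sum>i\<in>{1..n}. u i * real_of_int (wnd i A))" for A
    show "reidemeister_number G \<phi> = \<infinity>"
    proof (rule reidemeister_infinite[OF hom, of f "B k"])
      show "f (a \<otimes>\<^bsub>G\<^esub> b) = f a + f b" if "a \<in> carrier G" "b \<in> carrier G" for a b
        by (simp add: f_def wnd_mult[OF that] algebra_simps sum.distrib)
      show "f (\<phi> a) = f a" if a: "a \<in> carrier G" for a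
      proof -
        have "f (\<phi> a) = (\<Sum>i\<in>{1..n}. \<Sum>j\<in>{1..n}. of_int (wnd j a) * (u i * of_int (wnd i (\<phi> (B j)))))"
          by (simp add: f_def M[OF hom a] sum_distrib_left mult_ac)
        also have "\<dots> = (\<Sum>j\<in>{1..n}. of_int (wnd j a) * (\<Sum>i\<in>{1..n}. u i * of_int (wnd i (\<phi> (B j)))))"
          by (subst sum.swap) (simp add: sum_distrib_left)
        also have "\<dots> = f a" by (simp add: f_def u(3) mult.commute)
        finally show ?thesis .
      qed
      have "f (B k) = (\<Sum>i\<in>{1..n}. if i = k then u k else 0)"
        unfolding f_def by (rule sum.cong) (use u(1) in \<open>auto simp: B(2)\<close>)
      then show "f (B k) \<noteq> 0" using u(1,2) by simp
    qed (use B u in blast)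
  qed
qed

end

theorem corollary1p4:
  fixes n :: nat and x :: "nat \<Rightarrow> (real \<times> real) set"
  assumes "n \<ge> 2"
    and "x \<in> topspace (config_space n klein_bottle)"
  shows "\<exists>H. H \<lhd> AutoGroup (klein_pure_braid_group n x)
    \<and> finite (rcosets\<^bsub>AutoGroup (klein_pure_braid_group n x)\<^esub> H)
    \<and> card (rcosets\<^bsub>AutoGroup (klein_pure_braid_group n x)\<^esub> H) \<le> fact (2 * (n choose 2))
    \<and> (\<forall>\<phi>\<in>H. reidemeister_number (klein_pure_braid_group n x) \<phi> = \<infinity>)"
proof -
  have x: "x \<in> extensional {1..n}" "inj_on x {1..n}" "\<And>i. i \<in> {1..n} \<Longrightarrow> x i \<in> range kproj"
    using assms(2) by (auto simp: config_space_def topspace_klein_bottle PiE_iff simp del: atLeastAtMost_iff)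
  \<comment> \<open>Any points over the base configuration will do; the value 0 elsewhere is the
    convention of \<open>klein_braids\<close>.\<close>
  define q where "q = (\<lambda>i. if i \<in> {1..n} then (SOME z. kproj z = x i) else 0)"
  have kq: "kproj (q i) = x i" if "i \<in> {1..n}" for i
  proof -
    have "\<exists>z. kproj z = x i" using x(3)[OF that] by auto
    then have "kproj (SOME z. kproj z = x i) = x i" by (rule someI_ex)
    then show ?thesis using that by (simp add: q_def del: atLeastAtMost_iff)
  qed
  have qx: "config_proj n q = x"
    by (rule extensionalityI[of _ "{1..n}"]) (simp_all add: config_proj_def kq x(1) del: atLeastAtMost_iff)
  have "inj_on (config_proj n q) {1..n}" unfolding qx by (rule x(2))
  then have "config_ok n q" unfolding inj_on_config_proj .
  then interpret klein_braids n q by unfold_locales (simp_all add: q_def del: atLeastAtMost_iff)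
  obtain H where H: "H \<lhd> AutoGroup G" "finite (rcosets\<^bsub>AutoGroup G\<^esub> H)" "card (rcosets\<^bsub>AutoGroup G\<^esub> H) \<le> 2"
    "\<And>\<phi>. \<phi> \<in> H \<Longrightarrow> reidemeister_number G \<phi> = \<infinity>"
    by (rule normal_subgroup_with_infinite_reidemeister) (use assms(1) in auto)
  \<comment> \<open>The index is at most 2, so the bound follows as soon as the argument of the
    factorial is at least 2.\<close>
  have "n choose 2 \<ge> 1" using assms(1) by (simp add: Suc_le_eq zero_less_binomial_iff One_nat_def)
  then have "fact 2 \<le> (fact (2 * (n choose 2)) :: nat)" by (intro fact_mono) simp
  then have "card (rcosets\<^bsub>AutoGroup G\<^esub> H) \<le> fact (2 * (n choose 2))" using H(3) by (simp add: fact_2)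
  then show ?thesis using H unfolding klein_pure_braid_group_def qx by blast
qed

end
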